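(* Let $Y$ be the regular diffusion in natural scale on the compact interval $\mathcal{S}=[S(0),S(1)]$, with generator $(Af)(y)=\frac12 b(y)f''(y)$ and instantaneously reflecting boundaries. Assume that there exists a constant $\delta>0$ such that $b\ge\delta$ everywhere and that $b$ can be continuously extended to the boundaries of $\mathcal{S}$. For $n=2,3,4,\dots$ let $X^n\sim(\pi_0^n,P^n)$ be the birth-and-death chain on the grid $\mathcal{S}^n$ with transition matrix $P^n$ (defined in the context) and initial distribution $\pi_0^n$, and define the continuous-time process $Y^n$ by $Y^n_t:=X^n_{\lfloor t/h_n\rfloor}$ for $t\ge0$. If $Y^n_0\Rightarrow Y_0$, then $Y^n\Rightarrow Y$.
   Context: Let $X$ be a regular diffusion on $[0,1]$ with generator $\frac12 b_X(x)\frac{d^2}{dx^2}+a_X(x)\frac{d}{dx}$, $a_X,b_X\in C((0,1))$, $b_X>0$ on $(0,1)$, with both boundaries regular and instantaneously reflecting. Its scale function $S$ satisfies $S'(x)=s_X(x)=\exp\{-\int^x 2a_X(y)/b_X(y)\,dy\}$; $S(0),S(1)$ are finite. Put $Y=S(X)$, a regular diffusion on $\mathcal{S}=[S(0),S(1)]$ in natural scale with instantaneously reflecting boundaries and generator $(Af)(y)=\frac12 b(y)f''(y)$, where $b(y)=b_X(x)s_X(x)^2$ for $y=S(x)$. The domain is $\{f\in C(\mathcal{S})\cap C^2(\mathcal{S}^\circ): Af\in C(\mathcal{S}),\ f'(S(0)+)=f'(S(1)-)=0\}$. (Regular: each interior point is reached with positive probability from each interior point.) Approximating chains. For $n\ge2$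 let $\Delta=\Delta_n=[S(1)-S(0)]/n$, $\mathcal{S}^n=\{S(0),S(0)+\Delta,\dots,S(1)-\Delta,S(1)\}$, $h=h_n=\Delta^2/(2\sup_y b(y))$. Writing $i$ for the point $S(0)+i\Delta$, $P^n$ is the birth-and-death transition matrix on $\mathcal{S}^n$ with $P^n(i,i+1)=P^n(i,i-1)=\frac{b(i)h}{2\Delta^2}$ for $0<i<n$, $P^n(0,1)=\frac{b(0)h}{\Delta^2}$, $P^n(n,n-1)=\frac{b(n)h}{\Delta^2}$, and diagonal entries chosen so that rows sum to $1$. $X^n\sim(\pi_0^n,P^n)$ means $X^n$ is a discrete-time Markov chain with initial distribution $\pi_0^n$ (a probability measure on $\mathcal{S}^n$) and transition matrix $P^n$. $\Rightarrow$ denotes convergence in law; for processes it is convergence in law as random elements of the space $D_{\mathcal{S}}[0,\infty)$ of cadlag functions $[0,\infty)\to\mathcal{S}$ with the Skorohod topology. *)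

theory Defs
  imports "HOL-Probability.Probability"
begin

subsection \<open>Convergence in law\<close>

definition borel_sigma :: "'x topology \<Rightarrow> 'x measure" where
  "borel_sigma T = sigma (topspace T) {U. openin T U}"

text \<open>Convergence in law of \<open>(Z n)\<close>, \<open>n \<ge> n0\<close>, to \<open>Z'\<close> as random elements of the topological
  space \<open>T\<close>; every variable may live on its own probability space.\<close>

definition converges_in_law ::
  "nat \<Rightarrow> 'x topology \<Rightarrow> (nat \<Rightarrow> 'b measure) \<Rightarrow> (nat \<Rightarrow> 'b \<Rightarrow> 'x) \<Rightarrow> 'a measure \<Rightarrow> ('a \<Rightarrow> 'x) \<Rightarrow> bool"
where
  "converges_in_law n0 T M Z M' Z' \<longleftrightarrow>
     (\<forall>n\<ge>n0. prob_space (M n) \<and> Z n \<in> M n \<rightarrow>\<^sub>M borel_sigma T) \<and>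
     prob_space M' \<and> Z' \<in> M' \<rightarrow>\<^sub>M borel_sigma T \<and>
     (\<forall>\<phi>. continuous_map T euclideanreal \<phi> \<longrightarrow> bounded (\<phi> ` topspace T) \<longrightarrow>
        (\<lambda>n. \<integral>\<omega>. \<phi> (Z n \<omega>) \<partial>M n) \<longlonglongrightarrow> (\<integral>\<omega>. \<phi> (Z' \<omega>) \<partial>M'))"

subsection \<open>The Skorohod space of cadlag functions\<close>

text \<open>Functions on \<open>[0,\<infinity>)\<close> are represented as extensional functions on \<open>{0..}\<close>.\<close>

definition cadlag :: "(real \<Rightarrow> real) \<Rightarrow> bool" where
  "cadlag w \<longleftrightarrow> (\<forall>t\<ge>0. (w \<longlongrightarrow> w t) (at_right t)) \<and> (\<forall>t>0. \<exists>L. (w \<longlongrightarrow> L) (at_left t))"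

definition cadlag_paths :: "real set \<Rightarrow> (real \<Rightarrow> real) set" where
  "cadlag_paths E = {w \<in> {0..} \<rightarrow>\<^sub>E E. cadlag w}"

definition log_slopes :: "(real \<Rightarrow> real) \<Rightarrow> real set" where
  "log_slopes \<theta> = {\<bar>ln ((\<theta> s - \<theta> t) / (s - t))\<bar> | s t. 0 \<le> t \<and> t < s}"

definition time_changes :: "(real \<Rightarrow> real) set" where
  "time_changes = {\<theta>. strict_mono_on {0..} \<theta> \<and> \<theta> ` {0..} = {0..} \<and> bdd_above (log_slopes \<theta>)}"

text \<open>The metric on \<open>D[0,\<infinity>)\<close> of Ethier and Kurtz, Markov Processes, Section 3.5:
  \<open>inf\<^sub>\<theta> (\<gamma>(\<theta>) \<or> \<integral>\<^sub>0\<^sup>\<infinity> e\<^sup>-\<^sup>u sup\<^sub>t (|v(t \<and> u) - w(\<theta>(t) \<and> u)| \<and> 1) du)\<close>,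
  where \<open>\<gamma>(\<theta>)\<close> is the supremum of \<open>log_slopes \<theta>\<close>.\<close>

definition skorohod_dist :: "(real \<Rightarrow> real) \<Rightarrow> (real \<Rightarrow> real) \<Rightarrow> real" where
  "skorohod_dist v w =
     (INF \<theta>\<in>time_changes.
        max (Sup (log_slopes \<theta>))
            (LINT u:{0..}|lborel. exp (- u) * (SUP t\<in>{0..}. min 1 \<bar>v (min t u) - w (min (\<theta> t) u)\<bar>)))"

definition skorohod_topology :: "real set \<Rightarrow> (real \<Rightarrow> real) topology" where
  "skorohod_topology E = topology (\<lambda>U. U \<subseteq> cadlag_paths E \<and>
     (\<forall>v\<in>U. \<exists>\<epsilon>>0. \<forall>w\<in>cadlag_paths E. skorohod_dist v w < \<epsilon> \<longrightarrow> w \<in> U))"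

lemma openin_skorohod_topology:
  "openin (skorohod_topology E) U \<longleftrightarrow> U \<subseteq> cadlag_paths E \<and>
     (\<forall>v\<in>U. \<exists>\<epsilon>>0. \<forall>w\<in>cadlag_paths E. skorohod_dist v w < \<epsilon> \<longrightarrow> w \<in> U)"
proof -
  let ?L = "\<lambda>U. U \<subseteq> cadlag_paths E \<and>
     (\<forall>v\<in>U. \<exists>\<epsilon>>0. \<forall>w\<in>cadlag_paths E. skorohod_dist v w < \<epsilon> \<longrightarrow> w \<in> U)"
  have "istopology ?L"
    unfolding istopology_def
  proof (intro conjI allI impI)
    fix A B assume A: "?L A" and B: "?L B"
    show "A \<inter> B \<subseteq> cadlag_paths E" using A by blast
    show "\<forall>v\<in>A \<inter> B. \<exists>\<epsilon>>0. \<forall>w\<in>cadlag_paths E. skorohod_dist v w < \<epsilon> \<longrightarrow> w \<in> A \<inter> B"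
    proof
      fix v assume "v \<in> A \<inter> B"
      then obtain d e where "d > 0" "\<forall>w\<in>cadlag_paths E. skorohod_dist v w < d \<longrightarrow> w \<in> A"
        and "e > 0" "\<forall>w\<in>cadlag_paths E. skorohod_dist v w < e \<longrightarrow> w \<in> B"
        using A B by blast
      then show "\<exists>\<epsilon>>0. \<forall>w\<in>cadlag_paths E. skorohod_dist v w < \<epsilon> \<longrightarrow> w \<in> A \<inter> B"
        by (intro exI[of _ "min d e"]) auto
    qed
  next
    fix K assume K: "\<forall>U\<in>K. ?L U"
    show "\<Union>K \<subseteq> cadlag_paths E" using K by blast
    show "\<forall>v\<in>\<Union>K. \<exists>\<epsilon>>0. \<forall>w\<in>cadlag_paths E. skorohod_dist v w < \<epsilon> \<longrightarrow> w \<in> \<Union>K"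
      using K by (meson UnionE UnionI)
  qed
  then show ?thesis
    unfolding skorohod_topology_def by (simp add: topology_inverse')
qed

lemma topspace_skorohod_topology: "topspace (skorohod_topology E) = cadlag_paths E"
proof -
  have "openin (skorohod_topology E) (cadlag_paths E)"
    by (auto simp: openin_skorohod_topology intro: exI[of _ 1])
  then show ?thesis
    by (meson openin_skorohod_topology openin_subset openin_topspace subset_antisym)
qed

definition path_of :: "(real \<Rightarrow> 'a \<Rightarrow> real) \<Rightarrow> 'a \<Rightarrow> real \<Rightarrow> real" where
  "path_of Z \<omega> = (\<lambda>t\<in>{0..}. Z t \<omega>)"

subsection \<open>Regular diffusions on a compact interval\<close>

definition continuous_paths :: "real \<Rightarrow> real \<Rightarrow> (real \<Rightarrow> real) set" where
  "continuous_paths l r = {w \<in> {0..} \<rightarrow>\<^sub>E {l..r}. continuous_on {0..} w}"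

definition path_space :: "real \<Rightarrow> real \<Rightarrow> (real \<Rightarrow> real) measure" where
  "path_space l r = restrict_space (\<Pi>\<^sub>M t\<in>{0..}. borel) (continuous_paths l r)"

text \<open>The \<open>\<sigma>\<close>-algebra generated by the coordinates up to time \<open>t \<in> [0,\<infinity>]\<close>.\<close>

definition path_filtration :: "real \<Rightarrow> real \<Rightarrow> ennreal \<Rightarrow> (real \<Rightarrow> real) measure" where
  "path_filtration l r t =
     vimage_algebra (continuous_paths l r) (\<lambda>w. restrict w {s. 0 \<le> s \<and> ennreal s \<le> t})
       (\<Pi>\<^sub>M s\<in>{s. 0 \<le> s \<and> ennreal s \<le> t}. borel)"

lemma filtration_path_filtration: "filtration (continuous_paths l r) (path_filtration l r)"
proof
  show "space (path_filtration l r i) = continuous_paths l r" for i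
    by (simp add: path_filtration_def)
next
  fix i j :: ennreal assume ij: "i \<le> j"
  let ?I = "\<lambda>t. {s. 0 \<le> s \<and> ennreal s \<le> t}"
  let ?N = "path_filtration l r j"
  have "(\<lambda>w. restrict w (?I j)) \<in> ?N \<rightarrow>\<^sub>M (\<Pi>\<^sub>M s\<in>?I j. borel)"
    unfolding path_filtration_def
    by (rule measurable_vimage_algebra1) (auto simp: space_PiM)
  from measurable_compose[OF this measurable_component_singleton]
  have coord: "(\<lambda>w. w s) \<in> borel_measurable ?N" if "s \<in> ?I j" for s
    using that by (auto simp: restrict_def cong: measurable_cong)
  have "(\<lambda>w. restrict w (?I i)) \<in> ?N \<rightarrow>\<^sub>M (\<Pi>\<^sub>M s\<in>?I i. borel)"
    using ij by (intro measurable_restrict coord) auto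
  then show "sets (path_filtration l r i) \<le> sets ?N"
    unfolding path_filtration_def[of l r i]
    by (intro sets_image_in_sets) (auto simp: path_filtration_def)
qed

lemma sets_path_filtration_top: "sets (path_filtration l r \<top>) = sets (path_space l r)"
proof -
  have *: "{s::real. 0 \<le> s \<and> ennreal s \<le> \<top>} = {0..}" by auto
  have sub: "continuous_paths l r \<subseteq> space (\<Pi>\<^sub>M t\<in>{(0::real)..}. (borel :: real measure))"
    by (auto simp: continuous_paths_def space_PiM PiE_def)
  have "sets (path_filtration l r \<top>) =
      {(\<lambda>w. restrict w {0..}) -` A \<inter> continuous_paths l r | A.
        A \<in> sets (\<Pi>\<^sub>M t\<in>{(0::real)..}. (borel :: real measure))}"
    unfolding path_filtration_def * by (rule sets_vimage_algebra2) (auto simp: space_PiM)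
  also have "\<dots> = {continuous_paths l r \<inter> A | A.
        A \<in> sets (\<Pi>\<^sub>M t\<in>{(0::real)..}. (borel :: real measure))}"
  proof -
    have "restrict w {0..} = w" if "w \<in> continuous_paths l r" for w
      using that by (auto simp: continuous_paths_def PiE_def extensional_restrict)
    then have "(\<lambda>w. restrict w {0..}) -` A \<inter> continuous_paths l r = continuous_paths l r \<inter> A" for A
      by auto
    then show ?thesis by simp
  qed
  finally show ?thesis
    using sub by (auto simp: path_space_def sets_restrict_space)
qed

definition shift_path :: "real \<Rightarrow> (real \<Rightarrow> real) \<Rightarrow> real \<Rightarrow> real" where
  "shift_path s w = (\<lambda>t\<in>{0..}. w (s + t))"

text \<open>A diffusion with state space \<open>[l,r]\<close>: \<open>P x\<close> is the law on path space of the process started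
  at \<open>x\<close>. Only \<open>P x\<close> with \<open>x \<in> [l,r]\<close> is relevant.\<close>

definition diffusion :: "real \<Rightarrow> real \<Rightarrow> (real \<Rightarrow> (real \<Rightarrow> real) measure) \<Rightarrow> bool" where
  "diffusion l r P \<longleftrightarrow>
     P \<in> restrict_space borel {l..r} \<rightarrow>\<^sub>M prob_algebra (path_space l r) \<and>
     (\<forall>x\<in>{l..r}. AE w in P x. w 0 = x) \<and>
     (\<forall>x\<in>{l..r}. \<forall>\<tau>. stopping_time (path_filtration l r) \<tau> \<longrightarrow>
        (\<forall>A\<in>sets (filtration.pre_sigma (continuous_paths l r) (path_filtration l r) \<tau>).
         \<forall>B\<in>sets (path_space l r).
           measure (P x) {w\<in>A. \<tau> w < \<top> \<and> shift_path (enn2real (\<tau> w)) w \<in> B} =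
           (LINT w:{w\<in>A. \<tau> w < \<top>}|P x. measure (P (w (enn2real (\<tau> w)))) B)))"

definition regular_diffusion :: "real \<Rightarrow> real \<Rightarrow> (real \<Rightarrow> (real \<Rightarrow> real) measure) \<Rightarrow> bool" where
  "regular_diffusion l r P \<longleftrightarrow> diffusion l r P \<and>
     (\<forall>x\<in>{l<..<r}. \<forall>y\<in>{l<..<r}. measure (P x) {w \<in> space (P x). \<exists>t\<ge>0. w t = y} > 0)"

definition semigroup ::
  "(real \<Rightarrow> (real \<Rightarrow> real) measure) \<Rightarrow> real \<Rightarrow> (real \<Rightarrow> real) \<Rightarrow> real \<Rightarrow> real" where
  "semigroup P t f x = (\<integral>w. f (w t) \<partial>P x)"

definition feller :: "real \<Rightarrow> real \<Rightarrow> (real \<Rightarrow> (real \<Rightarrow> real) measure) \<Rightarrow> bool" where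
  "feller l r P \<longleftrightarrow>
     (\<forall>f t. continuous_on {l..r} f \<longrightarrow> t \<ge> 0 \<longrightarrow> continuous_on {l..r} (semigroup P t f))"

text \<open>Unbounded operators on \<open>C([l,r])\<close> are given by their graphs; functions are only relevant
  on \<open>[l,r]\<close>.\<close>

definition generator ::
  "real \<Rightarrow> real \<Rightarrow> (real \<Rightarrow> (real \<Rightarrow> real) measure) \<Rightarrow> ((real \<Rightarrow> real) \<times> (real \<Rightarrow> real)) set" where
  "generator l r P = {(f, g). continuous_on {l..r} f \<and> continuous_on {l..r} g \<and>
     uniform_limit {l..r} (\<lambda>t x. (semigroup P t f x - f x) / t) g (at_right 0)}"

text \<open>The operator \<open>Af = \<onehalf> b f''\<close> with domain
  \<open>{f \<in> C([l,r]) \<inter> C\<^sup>2((l,r)). Af \<in> C([l,r]), f'(l+) = f'(r-) = 0}\<close>. That \<open>Af \<in> C([l,r])\<close> means that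
  \<open>\<onehalf> b f''\<close>, defined on \<open>(l,r)\<close>, has a continuous extension \<open>g\<close> to \<open>[l,r]\<close>.\<close>

definition reflecting_operator ::
  "real \<Rightarrow> real \<Rightarrow> (real \<Rightarrow> real) \<Rightarrow> ((real \<Rightarrow> real) \<times> (real \<Rightarrow> real)) set" where
  "reflecting_operator l r b = {(f, g). continuous_on {l..r} f \<and> continuous_on {l..r} g \<and>
     (\<exists>f' f''. (\<forall>y\<in>{l<..<r}. (f has_real_derivative f' y) (at y)) \<and>
               (\<forall>y\<in>{l<..<r}. (f' has_real_derivative f'' y) (at y)) \<and>
               continuous_on {l<..<r} f'' \<and>
               (\<forall>y\<in>{l<..<r}. g y = 1/2 * b y * f'' y) \<and>
               (f' \<longlongrightarrow> 0) (at_right l) \<and> (f' \<longlongrightarrow> 0) (at_left r))}"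

text \<open>\<open>Y\<close> is a version of the diffusion \<open>P\<close> with an arbitrary initial law: it has continuous paths
  and its law is the mixture of the laws \<open>P x\<close> with respect to the law of \<open>Y\<^sub>0\<close>.\<close>

definition diffusion_process ::
  "real \<Rightarrow> real \<Rightarrow> (real \<Rightarrow> (real \<Rightarrow> real) measure) \<Rightarrow> 'a measure \<Rightarrow> (real \<Rightarrow> 'a \<Rightarrow> real) \<Rightarrow> bool" where
  "diffusion_process l r P N Y \<longleftrightarrow>
     prob_space N \<and> path_of Y \<in> N \<rightarrow>\<^sub>M path_space l r \<and>
     distr N (path_space l r) (path_of Y) = distr N (restrict_space borel {l..r}) (Y 0) \<bind> P"

text \<open>The scale function \<open>S\<close> and its density \<open>s\<close> for the coefficients \<open>a\<close>, \<open>b\<close> on \<open>(0,1)\<close>. The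
  indefinite integral \<open>\<integral>\<^sup>x 2a/b\<close> stands for an arbitrary antiderivative \<open>I\<close>; that \<open>S(0)\<close>, \<open>S(1)\<close>
  are finite is continuity of the real function \<open>S\<close> at the end points.\<close>

definition scale_function ::
  "(real \<Rightarrow> real) \<Rightarrow> (real \<Rightarrow> real) \<Rightarrow> (real \<Rightarrow> real) \<Rightarrow> (real \<Rightarrow> real) \<Rightarrow> bool" where
  "scale_function a b s S \<longleftrightarrow>
     (\<exists>I. \<forall>x\<in>{0<..<1}. (I has_real_derivative 2 * a x / b x) (at x) \<and> s x = exp (- I x)) \<and>
     (\<forall>x\<in>{0<..<1}. (S has_real_derivative s x) (at x)) \<and> continuous_on {0..1} S"

subsection \<open>The approximating birth-and-death chains\<close>

definition mesh :: "real \<Rightarrow> real \<Rightarrow> nat \<Rightarrow> real" where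
  "mesh l r n = (r - l) / real n"

definition grid :: "real \<Rightarrow> real \<Rightarrow> nat \<Rightarrow> nat \<Rightarrow> real" where
  "grid l r n i = l + real i * mesh l r n"

definition time_step :: "real \<Rightarrow> real \<Rightarrow> (real \<Rightarrow> real) \<Rightarrow> nat \<Rightarrow> real" where
  "time_step l r b n = (mesh l r n)\<^sup>2 / (2 * (SUP y\<in>{l..r}. b y))"

text \<open>The state \<open>i \<in> {0..n}\<close> stands for the point \<open>grid l r n i\<close>.\<close>

definition jump_prob :: "real \<Rightarrow> real \<Rightarrow> (real \<Rightarrow> real) \<Rightarrow> nat \<Rightarrow> nat \<Rightarrow> nat \<Rightarrow> real" where
  "jump_prob l r b n i j =
     (let q = b (grid l r n i) * time_step l r b n / (mesh l r n)\<^sup>2 in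
      if 0 < i \<and> i < n \<and> (j = i + 1 \<or> j + 1 = i) then q / 2
      else if i = 0 \<and> j = 1 then q
      else if i = n \<and> j + 1 = n then q
      else 0)"

definition transition_matrix :: "real \<Rightarrow> real \<Rightarrow> (real \<Rightarrow> real) \<Rightarrow> nat \<Rightarrow> nat \<Rightarrow> nat \<Rightarrow> real" where
  "transition_matrix l r b n i j =
     (if i = j then 1 - (\<Sum>k\<in>{0..n} - {i}. jump_prob l r b n i k) else jump_prob l r b n i j)"

text \<open>A discrete-time Markov chain on a countable set \<open>E\<close> with initial law \<open>\<pi>\<close> and transition
  matrix \<open>Q\<close>. The Markov property is stated with denominators cleared.\<close>

definition markov_chain ::
  "'b measure \<Rightarrow> 's set \<Rightarrow> 's pmf \<Rightarrow> ('s \<Rightarrow> 's \<Rightarrow> real) \<Rightarrow> (nat \<Rightarrow> 'b \<Rightarrow> 's) \<Rightarrow> bool" where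
  "markov_chain M E \<pi> Q X \<longleftrightarrow>
     prob_space M \<and> set_pmf \<pi> \<subseteq> E \<and>
     (\<forall>k. X k \<in> M \<rightarrow>\<^sub>M count_space E) \<and>
     (\<forall>i\<in>E. measure M {\<omega>\<in>space M. X 0 \<omega> = i} = pmf \<pi> i) \<and>
     (\<forall>k p. (\<forall>m\<le>Suc k. p m \<in> E) \<longrightarrow>
        measure M {\<omega>\<in>space M. \<forall>m\<le>Suc k. X m \<omega> = p m} =
        measure M {\<omega>\<in>space M. \<forall>m\<le>k. X m \<omega> = p m} * Q (p k) (p (Suc k)))"

definition interpolated_chain ::
  "real \<Rightarrow> real \<Rightarrow> (real \<Rightarrow> real) \<Rightarrow> nat \<Rightarrow> (nat \<Rightarrow> 'b \<Rightarrow> nat) \<Rightarrow> real \<Rightarrow> 'b \<Rightarrow> real" where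
  "interpolated_chain l r b n X t \<omega> = grid l r n (X (nat \<lfloor>t / time_step l r b n\<rfloor>) \<omega>)"

end

theory Submission
  imports Defs
begin

text \<open>For \<open>(f, Af)\<close> in the domain of the generator, a second order Taylor expansion shows that the
  generators of the chains converge uniformly on the grid, also at the reflecting end points because
  \<open>f'\<close> vanishes there. The semigroup maps the domain into itself and the orbit of \<open>Af\<close> is
  equicontinuous, so the one-step errors add up to something small and the discrete semigroups converge;
  polynomials in \<open>cos (pi (y - l) / (r - l))\<close> lie in the domain and are dense, which extends this to all
  continuous functions and then to the finite-dimensional distributions.

  Since the limit has continuous paths, it suffices to test with functionals that are Lipschitz for the
  weighted uniform distance \<open>sup\<^sub>t e\<^sup>-\<^sup>t |v(t) - w(t)|\<close>, whose topology is finer than Skorohod's. Such a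
  functional is approximated by finite sums of products of functions of the values at the times \<open>i / m\<close>;
  the error is controlled by the oscillation between these times, for the chains through an
  exponential supermartingale and Doob's maximal inequality.\<close>

subsection \<open>A uniform distance on path space\<close>

text \<open>No compactness of laws is invoked: limits are computed on test functionals, choosing the
  tolerance first, then the sampling parameter m, then n. The obstacle is to approximate by the
  values at times i / m uniformly in n. There are about m K sampling intervals, and an increment
  over one of them has variance of order 1 / m, so Chebyshev's inequality leaves a union bound of
  order 1; exponential moments make each interval cost exp(- c sqrt m) instead.

  The cosine serves two ends for one reason: its derivative vanishes at both boundaries and it is
  injective in between. So its polynomials satisfy the boundary condition, and along the chain it
  needs no boundary correction.

  Functions in the domain are only C^2 inside, so the Taylor remainder is governed by the modulus of
  continuity of f'' = 2 Af / b. The expansion is applied to T_s f for all s up to a horizon, which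
  is why the whole orbit of Af has to be equicontinuous.

  Cadlag paths under the uniform distance form a nonseparable space, so measurability of Lipschitz
  functionals of the paths is proved by hand, as limits of functionals of finitely many
  coordinates.\<close>

definition path_dist :: "(real \<Rightarrow> real) \<Rightarrow> (real \<Rightarrow> real) \<Rightarrow> real" where
  "path_dist v w = (SUP t\<in>{0..}. exp (- t) * \<bar>v t - w t\<bar>)"

lemma path_dist_le:
  assumes "\<And>t. t \<ge> 0 \<Longrightarrow> exp (- t) * \<bar>v t - w t\<bar> \<le> c"
  shows "path_dist v w \<le> c"
  unfolding path_dist_def using assms by (intro cSUP_least) auto

lemma cadlag_paths_bounds:
  assumes "w \<in> cadlag_paths {l..r}" "t \<ge> 0"
  shows "w t \<in> {l..r}"
  using assms unfolding cadlag_paths_def by (auto simp: PiE_iff)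

lemma cadlag_paths_diff_le:
  assumes "v \<in> cadlag_paths {l..r}" "w \<in> cadlag_paths {l..r}" "t \<ge> 0"
  shows "\<bar>v t - w t\<bar> \<le> r - l"
  using cadlag_paths_bounds[OF assms(1,3)] cadlag_paths_bounds[OF assms(2,3)] by auto

text \<open>Values in a bounded interval bound the family; without that the real supremum would be
  unspecified.\<close>

lemma le_path_dist:
  assumes "v \<in> cadlag_paths {l..r}" "w \<in> cadlag_paths {l..r}" "t \<ge> 0"
  shows "exp (- t) * \<bar>v t - w t\<bar> \<le> path_dist v w"
proof -
  have "exp (- s) * \<bar>v s - w s\<bar> \<le> 1 * (r - l)" if "s \<ge> 0" for s
    using cadlag_paths_diff_le[OF assms(1,2) that] that by (intro mult_mono) auto
  then have "bdd_above ((\<lambda>t. exp (- t) * \<bar>v t - w t\<bar>) ` {0..})"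
    by (intro bdd_aboveI2[where M = "1 * (r - l)"]) auto
  then show ?thesis unfolding path_dist_def using assms(3) by (intro cSUP_upper) auto
qed

lemma path_dist_nonneg:
  assumes "v \<in> cadlag_paths {l..r}" "w \<in> cadlag_paths {l..r}"
  shows "0 \<le> path_dist v w"
proof -
  have "0 \<le> exp (- 0) * \<bar>v 0 - w 0\<bar>" by simp
  also have "\<dots> \<le> path_dist v w" using le_path_dist[OF assms order_refl] .
  finally show ?thesis .
qed

lemma path_dist_le_width:
  assumes "v \<in> cadlag_paths {l..r}" "w \<in> cadlag_paths {l..r}"
  shows "path_dist v w \<le> r - l"
proof (rule path_dist_le)
  fix t :: real assume "t \<ge> 0"
  then have "exp (- t) * \<bar>v t - w t\<bar> \<le> 1 * (r - l)"
    using cadlag_paths_diff_le[OF assms] by (intro mult_mono) auto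
  then show "exp (- t) * \<bar>v t - w t\<bar> \<le> r - l" by simp
qed

lemma path_dist_commute: "path_dist v w = path_dist w v"
  by (simp add: path_dist_def abs_minus_commute)

lemma path_dist_self [simp]: "path_dist v v = 0"
  by (simp add: path_dist_def)

lemma path_dist_triangle:
  assumes "u \<in> cadlag_paths {l..r}" "v \<in> cadlag_paths {l..r}" "w \<in> cadlag_paths {l..r}"
  shows "path_dist u w \<le> path_dist u v + path_dist v w"
proof (rule path_dist_le)
  fix t :: real assume t: "t \<ge> 0"
  have "exp (- t) * \<bar>u t - w t\<bar> \<le> exp (- t) * (\<bar>u t - v t\<bar> + \<bar>v t - w t\<bar>)"
    by (intro mult_left_mono) auto
  also have "\<dots> \<le> path_dist u v + path_dist v w"
    using le_path_dist[OF assms(1,2) t] le_path_dist[OF assms(2,3) t] by (simp add: distrib_left)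
  finally show "exp (- t) * \<bar>u t - w t\<bar> \<le> path_dist u v + path_dist v w" .
qed

text \<open>The integrand is twice the density of the exponential law of rate 1/2. The exponent - u
  / 2 is what a square root leaves of \<open>exp (- u)\<close> in the next comparison of
  distances.\<close>

lemma set_integral_exp_half:
  "set_integrable lborel {0..} (\<lambda>u::real. exp (- u / 2))"
  "(LINT u:{0..}|lborel. exp (- u / 2)) = (2::real)"
proof -
  have "has_bochner_integral lborel (\<lambda>x. erlang_density 0 (1/2) x * x ^ 0)
      (fact (0 + 0) / (fact 0 * (1/2) ^ 0))"
    using nn_integral_erlang_ith_moment[of "1/2" 0 0]
    by (intro has_bochner_integral_nn_integral) (auto simp: erlang_density_def)
  then have "has_bochner_integral lborel (\<lambda>x. 2 * (erlang_density 0 (1/2) x * x ^ 0)) (2 * (1::real))"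
    by (intro has_bochner_integral_mult_right) auto
  also have "(\<lambda>x. 2 * (erlang_density 0 (1/2) x * x ^ 0)) = (\<lambda>x::real. indicator {0..} x *\<^sub>R exp (- x / 2))"
    by (auto simp: erlang_density_def indicator_def fun_eq_iff)
  finally have *: "has_bochner_integral lborel (\<lambda>x::real. indicator {0..} x *\<^sub>R exp (- x / 2)) 2" by simp
  show "set_integrable lborel {0..} (\<lambda>u::real. exp (- u / 2))"
    using * unfolding set_integrable_def has_bochner_integral_iff by auto
  show "(LINT u:{0..}|lborel. exp (- u / 2)) = (2::real)"
    using * unfolding set_lebesgue_integral_def has_bochner_integral_iff by auto
qed

lemma id_mem_time_changes: "(\<lambda>t. t) \<in> time_changes"
  and log_slopes_id: "log_slopes (\<lambda>t. t) = {0}"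
proof -
  show *: "log_slopes (\<lambda>t. t) = {0}"
  proof
    show "log_slopes (\<lambda>t. t) \<subseteq> {0}" unfolding log_slopes_def by auto
    have "\<bar>ln ((1 - 0) / (1 - 0))\<bar> \<in> log_slopes (\<lambda>t. t)"
      unfolding log_slopes_def by (intro CollectI exI[of _ 1] exI[of _ 0]) auto
    then show "{0} \<subseteq> log_slopes (\<lambda>t. t)" by simp
  qed
  show "(\<lambda>t. t) \<in> time_changes"
    unfolding time_changes_def using * by (auto simp: strict_mono_on_def)
qed

text \<open>The identity time change has logarithmic slope 0, so only the integral remains. Up to
  time u the weight costs a factor exp u, hence with D = \<open>path_dist v w\<close> the integrand
  is at most both exp(-u) and D. Their geometric mean sqrt(D exp(-u)) is an integrable bound that
  vanishes with D, whereas D alone is not integrable.\<close>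

lemma skorohod_dist_le_path_dist:
  assumes v: "v \<in> cadlag_paths {l..r}" and w: "w \<in> cadlag_paths {l..r}"
  shows "skorohod_dist v w \<le> 2 * sqrt (path_dist v w)"
proof -
  let ?I = "\<lambda>\<theta>. LINT u:{0..}|lborel. exp (- u) * (SUP t\<in>{0..}. min 1 \<bar>v (min t u) - w (min (\<theta> t) u)\<bar>)"
  have Inonneg: "0 \<le> ?I \<theta>" for \<theta>
  proof -
    have "0 \<le> (SUP t\<in>{0..}. min 1 \<bar>v (min t u) - w (min (\<theta> t) u)\<bar>)" for u
      by (rule cSUP_upper2[where x = 0]) (auto intro!: bdd_aboveI2[where M = 1])
    then show ?thesis unfolding set_lebesgue_integral_def by (intro integral_nonneg_AE) auto
  qed
  have "skorohod_dist v w \<le> max (Sup (log_slopes (\<lambda>t. t))) (?I (\<lambda>t. t))"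
    unfolding skorohod_dist_def
    by (rule cINF_lower) (auto intro!: bdd_belowI2[where m = 0] Inonneg id_mem_time_changes simp: le_max_iff_disj)
  also have "\<dots> = ?I (\<lambda>t. t)" using Inonneg[of "\<lambda>t. t"] by (simp add: log_slopes_id)
  also have "\<dots> \<le> (LINT u:{0..}|lborel. sqrt (path_dist v w) * exp (- u / 2))"
    unfolding set_lebesgue_integral_def
  proof (rule integral_mono')
    show "integrable lborel (\<lambda>u::real. indicator {0..} u *\<^sub>R (sqrt (path_dist v w) * exp (- u / 2)))"
      unfolding set_integrable_def[symmetric]
      by (intro set_integrable_mult_right set_integral_exp_half(1))
    fix u :: real
    let ?s = "SUP t\<in>{0..}. min 1 \<bar>v (min t u) - w (min t u)\<bar>"
    show "0 \<le> indicator {0..} u *\<^sub>R (sqrt (path_dist v w) * exp (- u / 2))"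
      using path_dist_nonneg[OF v w] by (auto simp: indicator_def)
    have "exp (- u) * ?s \<le> sqrt (path_dist v w) * exp (- u / 2)" if u: "u \<ge> 0"
    proof -
      have "min 1 \<bar>v (min t u) - w (min t u)\<bar> \<le> min 1 (exp u * path_dist v w)" if "t \<ge> 0" for t
      proof -
        have "exp (- min t u) * \<bar>v (min t u) - w (min t u)\<bar> \<le> path_dist v w"
          by (rule le_path_dist[OF v w]) (use u that in auto)
        then have "\<bar>v (min t u) - w (min t u)\<bar> \<le> exp (min t u) * path_dist v w"
          by (simp add: exp_minus field_simps)
        also have "\<dots> \<le> exp u * path_dist v w"
          by (intro mult_right_mono path_dist_nonneg[OF v w]) auto
        finally show ?thesis by auto
      qed
      then have s: "?s \<le> min 1 (exp u * path_dist v w)" by (intro cSUP_least) auto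
      have le: "exp (- u) * ?s \<le> exp (- u)" "exp (- u) * ?s \<le> path_dist v w"
        using s by (auto simp: exp_minus field_simps)
      have sq: "exp (- u / 2) = sqrt (exp (- u))"
        by (rule real_sqrt_unique[symmetric]) (simp_all add: power2_eq_square flip: exp_add)
      have "exp (- u) * ?s \<le> sqrt (path_dist v w * exp (- u))"
      proof (rule real_le_rsqrt)
        have "0 \<le> ?s" by (rule cSUP_upper2[where x = 0]) (auto intro!: bdd_aboveI2[where M = 1])
        then show "(exp (- u) * ?s)\<^sup>2 \<le> path_dist v w * exp (- u)"
          unfolding power2_eq_square using le path_dist_nonneg[OF v w] by (intro mult_mono) auto
      qed
      then show ?thesis unfolding sq real_sqrt_mult .
    qed
    then show "indicator {0..} u *\<^sub>R (exp (- u) * ?s) \<le> indicator {0..} u *\<^sub>R (sqrt (path_dist v w) * exp (- u / 2))"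
      by (auto simp: indicator_def)
  qed
  also have "\<dots> = sqrt (path_dist v w) * 2"
    by (simp only: set_integral_mult_right set_integral_exp_half(2))
  finally show ?thesis by simp
qed

text \<open>The topology of \<open>path_dist\<close> is finer than Skorohod's; the radius (e / 2)^2
  inverts the bound 2 sqrt.\<close>

lemma openin_skorohod_path_dist:
  assumes U: "openin (skorohod_topology {l..r}) U" and v: "v \<in> U"
  obtains \<epsilon> where "\<epsilon> > 0" "\<And>w. w \<in> cadlag_paths {l..r} \<Longrightarrow> path_dist v w < \<epsilon> \<Longrightarrow> w \<in> U"
proof -
  from U v obtain e where e: "e > 0" "\<And>w. w \<in> cadlag_paths {l..r} \<Longrightarrow> skorohod_dist v w < e \<Longrightarrow> w \<in> U"
    and vD: "v \<in> cadlag_paths {l..r}"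
    unfolding openin_skorohod_topology by blast
  show thesis
  proof (rule that[of "(e / 2)\<^sup>2"])
    fix w assume w: "w \<in> cadlag_paths {l..r}" and d: "path_dist v w < (e / 2)\<^sup>2"
    have "sqrt (path_dist v w) < e / 2" using d e(1) by (intro real_less_lsqrt) auto
    then show "w \<in> U" using skorohod_dist_le_path_dist[OF vD w] by (intro e(2) w) linarith
  qed (use e in auto)
qed

section \<open>Lipschitz functionals decide measurability and convergence in law\<close>

definition path_lipschitz :: "real \<Rightarrow> real \<Rightarrow> real \<Rightarrow> ((real \<Rightarrow> real) \<Rightarrow> real) \<Rightarrow> bool" where
  "path_lipschitz l r L \<psi> \<longleftrightarrow>
     (\<forall>v\<in>cadlag_paths {l..r}. \<forall>w\<in>cadlag_paths {l..r}. \<bar>\<psi> v - \<psi> w\<bar> \<le> L * path_dist v w)"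

text \<open>An infimum of k-Lipschitz functions is k-Lipschitz as soon as it is finite, which the
  lower bound m ensures. Two instances matter: \<phi> = 0, k = 1 gives the distance to C, and C the
  whole path space gives a Lipschitz minorant of \<phi>.\<close>

lemma path_lipschitz_infconv:
  assumes k: "k \<ge> 0" and C: "C \<subseteq> cadlag_paths {l..r}" "C \<noteq> {}"
    and lb: "\<And>v. v \<in> C \<Longrightarrow> m \<le> \<phi> v"
  shows "path_lipschitz l r k (\<lambda>w. INF v\<in>C. \<phi> v + k * path_dist v w)"
proof -
  have bdd: "bdd_below ((\<lambda>v. \<phi> v + k * path_dist v w) ` C)" if w: "w \<in> cadlag_paths {l..r}" for w
  proof (rule bdd_belowI2[where m = m])
    fix v assume v: "v \<in> C"
    have "0 \<le> k * path_dist v w" using v C w by (intro mult_nonneg_nonneg k path_dist_nonneg) auto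
    then show "m \<le> \<phi> v + k * path_dist v w" using lb[OF v] by linarith
  qed
  have *: "(INF v\<in>C. \<phi> v + k * path_dist v w) - k * path_dist w' w \<le> (INF v\<in>C. \<phi> v + k * path_dist v w')"
    if w: "w \<in> cadlag_paths {l..r}" and w': "w' \<in> cadlag_paths {l..r}" for w w'
  proof (rule cINF_greatest[OF C(2)])
    fix v assume v: "v \<in> C"
    have "(INF v\<in>C. \<phi> v + k * path_dist v w) \<le> \<phi> v + k * path_dist v w"
      by (rule cINF_lower[OF bdd[OF w] v])
    also have "k * path_dist v w \<le> k * (path_dist v w' + path_dist w' w)"
      using v C w w' by (intro mult_left_mono k path_dist_triangle) auto
    finally show "(INF v\<in>C. \<phi> v + k * path_dist v w) - k * path_dist w' w \<le> \<phi> v + k * path_dist v w'"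
      by (simp add: algebra_simps)
  qed
  show ?thesis
    unfolding path_lipschitz_def
  proof (intro ballI)
    fix v w assume "v \<in> cadlag_paths {l..r}" "w \<in> cadlag_paths {l..r}"
    then show "\<bar>(INF u\<in>C. \<phi> u + k * path_dist u v) - (INF u\<in>C. \<phi> u + k * path_dist u w)\<bar> \<le> k * path_dist v w"
      using *[of v w] *[of w v] by (simp add: path_dist_commute[of v w] abs_le_iff)
  qed
qed

text \<open>A Skorohod open set U is where the \<open>path_dist\<close> distance to its complement
  is positive: the distance is 0 on the complement, and U contains a \<open>path_dist\<close> ball
  around each of its points. This distance is bounded and 1-Lipschitz.\<close>

lemma measurable_skorohodI:
  assumes Z: "\<And>\<omega>. \<omega> \<in> space M \<Longrightarrow> Z \<omega> \<in> cadlag_paths {l..r}"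
    and meas: "\<And>B \<psi>. path_lipschitz l r 1 \<psi> \<Longrightarrow> (\<And>w. w \<in> cadlag_paths {l..r} \<Longrightarrow> \<bar>\<psi> w\<bar> \<le> B)
      \<Longrightarrow> (\<lambda>\<omega>. \<psi> (Z \<omega>)) \<in> borel_measurable M"
  shows "Z \<in> M \<rightarrow>\<^sub>M borel_sigma (skorohod_topology {l..r})"
  unfolding borel_sigma_def topspace_skorohod_topology
proof (rule measurable_measure_of)
  show "{U. openin (skorohod_topology {l..r}) U} \<subseteq> Pow (cadlag_paths {l..r})"
    using openin_subset[of "skorohod_topology {l..r}"] unfolding topspace_skorohod_topology by auto
  show "Z \<in> space M \<rightarrow> cadlag_paths {l..r}" using Z by auto
  fix U assume "U \<in> {U. openin (skorohod_topology {l..r}) U}"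
  then have U: "openin (skorohod_topology {l..r}) U" by simp
  define C where "C = cadlag_paths {l..r} - U"
  show "Z -` U \<inter> space M \<in> sets M"
  \<comment> \<open>An infimum over an empty complement says nothing.\<close>
  proof (cases "C = {}")
    case True
    then have "Z -` U \<inter> space M = space M" using Z unfolding C_def by auto
    then show ?thesis by simp
  next
    case False
    define \<psi> where "\<psi> w = (INF v\<in>C. 0 + 1 * path_dist v w)" for w
    have bdd: "bdd_below ((\<lambda>v. 0 + 1 * path_dist v w) ` C)" if "w \<in> cadlag_paths {l..r}" for w
      using that by (intro bdd_belowI2[where m = 0]) (auto intro!: path_dist_nonneg simp: C_def)
    have nonneg: "0 \<le> \<psi> w" if "w \<in> cadlag_paths {l..r}" for w
      unfolding \<psi>_def using False that by (intro cINF_greatest) (auto intro!: path_dist_nonneg simp: C_def)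
    have bd: "\<bar>\<psi> w\<bar> \<le> r - l" if w: "w \<in> cadlag_paths {l..r}" for w
    proof -
      obtain v where v: "v \<in> C" using False by auto
      have "\<psi> w \<le> 0 + 1 * path_dist v w" unfolding \<psi>_def by (rule cINF_lower[OF bdd[OF w] v])
      also have "\<dots> \<le> r - l" using path_dist_le_width[of v l r w] v w unfolding C_def by auto
      finally show ?thesis using nonneg[OF w] by auto
    qed
    have lip: "path_lipschitz l r 1 \<psi>"
      unfolding \<psi>_def by (rule path_lipschitz_infconv[where m = 0]) (use False in \<open>auto simp: C_def\<close>)
    have "\<psi> w > 0 \<longleftrightarrow> w \<in> U" if w: "w \<in> cadlag_paths {l..r}" for w
    proof
      assume pos: "\<psi> w > 0"
      show "w \<in> U"
      proof (rule ccontr)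
        assume "w \<notin> U"
        then have "w \<in> C" using w unfolding C_def by auto
        then have "\<psi> w \<le> 0 + 1 * path_dist w w" unfolding \<psi>_def by (intro cINF_lower[OF bdd[OF w]])
        with pos show False by simp
      qed
    next
      assume "w \<in> U"
      then obtain e where e: "e > 0" "\<And>v. v \<in> cadlag_paths {l..r} \<Longrightarrow> path_dist w v < e \<Longrightarrow> v \<in> U"
        using openin_skorohod_path_dist[OF U] by blast
      have "e \<le> \<psi> w" unfolding \<psi>_def
      proof (rule cINF_greatest[OF False])
        fix v assume "v \<in> C"
        then show "e \<le> 0 + 1 * path_dist v w"
          using e(2)[of v] unfolding C_def by (cases "path_dist w v < e") (auto simp: path_dist_commute[of v w])
      qed
      with e(1) show "\<psi> w > 0" by simp
    qed
    then have "Z -` U \<inter> space M = {\<omega> \<in> space M. 0 < \<psi> (Z \<omega>)}" using Z by auto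
    also have "\<dots> \<in> sets M" using meas[OF lip bd] by measurable
    finally show ?thesis .
  qed
qed

text \<open>For continuous bounded \<phi> a one-sided bound suffices, since it applies to -\<phi>
  too. It comes from Lipschitz minorants: their expectations converge by assumption, and their limit
  under Z' is as close to that of \<phi> as desired by dominated convergence.\<close>

lemma converges_in_law_skorohodI:
  fixes M :: "nat \<Rightarrow> 'b measure" and M' :: "'a measure"
  assumes M: "\<And>n. n \<ge> n0 \<Longrightarrow> prob_space (M n)" and M': "prob_space M'"
    and Z: "\<And>n \<omega>. n \<ge> n0 \<Longrightarrow> \<omega> \<in> space (M n) \<Longrightarrow> Z n \<omega> \<in> cadlag_paths {l..r}"
    and Z': "\<And>\<omega>. \<omega> \<in> space M' \<Longrightarrow> Z' \<omega> \<in> cadlag_paths {l..r}"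
    and meas: "\<And>n L B \<psi>. n \<ge> n0 \<Longrightarrow> path_lipschitz l r L \<psi> \<Longrightarrow>
      (\<And>w. w \<in> cadlag_paths {l..r} \<Longrightarrow> \<bar>\<psi> w\<bar> \<le> B) \<Longrightarrow> (\<lambda>\<omega>. \<psi> (Z n \<omega>)) \<in> borel_measurable (M n)"
    and meas': "\<And>L B \<psi>. path_lipschitz l r L \<psi> \<Longrightarrow>
      (\<And>w. w \<in> cadlag_paths {l..r} \<Longrightarrow> \<bar>\<psi> w\<bar> \<le> B) \<Longrightarrow> (\<lambda>\<omega>. \<psi> (Z' \<omega>)) \<in> borel_measurable M'"
    and conv: "\<And>L B \<psi>. path_lipschitz l r L \<psi> \<Longrightarrow>
      (\<And>w. w \<in> cadlag_paths {l..r} \<Longrightarrow> \<bar>\<psi> w\<bar> \<le> B) \<Longrightarrow>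
      (\<lambda>n. \<integral>\<omega>. \<psi> (Z n \<omega>) \<partial>M n) \<longlonglongrightarrow> (\<integral>\<omega>. \<psi> (Z' \<omega>) \<partial>M')"
  shows "converges_in_law n0 (skorohod_topology {l..r}) M Z M' Z'"
proof -
  let ?T = "skorohod_topology {l..r}"
  have mZ: "Z n \<in> M n \<rightarrow>\<^sub>M borel_sigma ?T" if "n \<ge> n0" for n
    by (rule measurable_skorohodI) (use Z meas that in auto)
  have mZ': "Z' \<in> M' \<rightarrow>\<^sub>M borel_sigma ?T"
    by (rule measurable_skorohodI) (use Z' meas' in auto)
  have mphi: "\<phi> \<in> borel_measurable (borel_sigma ?T)" if c: "continuous_map ?T euclideanreal \<phi>" for \<phi>
  proof (rule borel_measurableI)
    fix S :: "real set" assume S: "open S"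
    have sp: "space (borel_sigma ?T) = topspace ?T"
      unfolding borel_sigma_def using openin_subset by (subst space_measure_of) auto
    have "openin ?T {x \<in> topspace ?T. \<phi> x \<in> S}"
      using c S by (intro openin_continuous_map_preimage[of _ euclideanreal]) auto
    moreover have "\<phi> -` S \<inter> space (borel_sigma ?T) = {x \<in> topspace ?T. \<phi> x \<in> S}"
      unfolding sp by auto
    ultimately show "\<phi> -` S \<inter> space (borel_sigma ?T) \<in> sets (borel_sigma ?T)"
      unfolding borel_sigma_def using openin_subset[of ?T]
      by (subst sets_measure_of) (blast, metis mem_Collect_eq sigma_sets.Basic)
  qed
  \<comment> \<open>Continuous functions are increasing limits of their Lipschitz inf-convolutions.\<close>
  have lower: "\<forall>\<^sub>F n in sequentially. (\<integral>\<omega>. \<phi> (Z n \<omega>) \<partial>M n) > (\<integral>\<omega>. \<phi> (Z' \<omega>) \<partial>M') - \<epsilon>"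
    if c: "continuous_map ?T euclideanreal \<phi>" and bdd: "\<And>w. w \<in> cadlag_paths {l..r} \<Longrightarrow> \<bar>\<phi> w\<bar> \<le> B"
      and eps: "\<epsilon> > 0" for \<phi> B \<epsilon>
  \<comment> \<open>Again an empty infimum; here it would force the probability space
    \<open>M'\<close> to be empty.\<close>
  proof (cases "cadlag_paths {l..r} = {}")
    case True
    then have "space M' = {}" using Z' by auto
    then show ?thesis using prob_space.not_empty[OF M'] by simp
  next
    case False
    define \<psi> where "\<psi> k w = (INF v\<in>cadlag_paths {l..r}. \<phi> v + real k * path_dist v w)" for k w
    have bd: "bdd_below ((\<lambda>v. \<phi> v + real k * path_dist v w) ` cadlag_paths {l..r})"
      if w: "w \<in> cadlag_paths {l..r}" for k w
    proof (rule bdd_belowI2[where m = "- B"])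
      fix v assume v: "v \<in> cadlag_paths {l..r}"
      have "0 \<le> real k * path_dist v w" using v w by (intro mult_nonneg_nonneg path_dist_nonneg) auto
      then show "- B \<le> \<phi> v + real k * path_dist v w" using bdd[OF v] by linarith
    qed
    have le: "\<psi> k w \<le> \<phi> w" if w: "w \<in> cadlag_paths {l..r}" for k w
      using cINF_lower[OF bd[OF w, of k] w] unfolding \<psi>_def by simp
    have ge: "- B \<le> \<psi> k w" if w: "w \<in> cadlag_paths {l..r}" for k w
      unfolding \<psi>_def
    proof (rule cINF_greatest[OF False])
      fix v assume v: "v \<in> cadlag_paths {l..r}"
      have "0 \<le> real k * path_dist v w" using v w by (intro mult_nonneg_nonneg path_dist_nonneg) auto
      then show "- B \<le> \<phi> v + real k * path_dist v w" using bdd[OF v] by linarith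
    qed
    have abs: "\<bar>\<psi> k w\<bar> \<le> B" if w: "w \<in> cadlag_paths {l..r}" for k w
      using le[OF w, of k] ge[OF w, of k] bdd[OF w] by linarith
    have lip: "path_lipschitz l r (real k) (\<psi> k)" for k
      unfolding \<psi>_def
    proof (rule path_lipschitz_infconv[where m = "-B"])
      fix v assume v: "v \<in> cadlag_paths {l..r}"
      show "- B \<le> \<phi> v" using bdd[OF v] by linarith
    qed (use False in auto)
    have lim: "(\<lambda>k. \<psi> k w) \<longlonglongrightarrow> \<phi> w" if w: "w \<in> cadlag_paths {l..r}" for w
    proof (rule LIMSEQ_I)
      fix e :: real assume e: "e > 0"
      have "openin ?T {x \<in> topspace ?T. \<phi> x \<in> {\<phi> w - e/2<..}}"
        using c by (intro openin_continuous_map_preimage[of _ euclideanreal]) auto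
      then obtain d where d: "d > 0" and dd: "\<And>v. v \<in> cadlag_paths {l..r} \<Longrightarrow> path_dist w v < d \<Longrightarrow> \<phi> v > \<phi> w - e/2"
        by (rule openin_skorohod_path_dist[of l r _ w]) (use w e in \<open>auto simp: topspace_skorohod_topology\<close>)
      obtain k0 :: nat where k0: "real k0 > 2 * B / d" using reals_Archimedean2 by blast
      have "norm (\<psi> k w - \<phi> w) < e" if k: "k \<ge> k0" for k
      proof -
        have "\<phi> w - e/2 \<le> \<psi> k w"
          unfolding \<psi>_def
        proof (rule cINF_greatest[OF False])
          fix v assume v: "v \<in> cadlag_paths {l..r}"
          have p: "0 \<le> path_dist v w" by (rule path_dist_nonneg[OF v w])
          show "\<phi> w - e / 2 \<le> \<phi> v + real k * path_dist v w"
          proof (cases "path_dist w v < d")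
            case True
            have "0 \<le> real k * path_dist v w" using p by simp
            then show ?thesis using dd[OF v True] e by linarith
          next
            case False
            have "2 * B \<le> real k0 * d" using k0 d by (simp add: field_simps)
            also have "\<dots> \<le> real k * path_dist v w"
              using False k d p by (intro mult_mono) (auto simp: path_dist_commute[of v w])
            finally show ?thesis using bdd[OF v] bdd[OF w] e by linarith
          qed
        qed
        then show ?thesis using le[OF w, of k] e by (auto simp: abs_if)
      qed
      then show "\<exists>no. \<forall>k\<ge>no. norm (\<psi> k w - \<phi> w) < e" by blast
    qed
    have "(\<lambda>k. \<integral>\<omega>. \<psi> k (Z' \<omega>) \<partial>M') \<longlonglongrightarrow> (\<integral>\<omega>. \<phi> (Z' \<omega>) \<partial>M')"
    proof (rule integral_dominated_convergence[where w = "\<lambda>_. B"])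
      show "(\<lambda>\<omega>. \<phi> (Z' \<omega>)) \<in> borel_measurable M'" using mphi[OF c] mZ' by measurable
      show "(\<lambda>\<omega>. \<psi> k (Z' \<omega>)) \<in> borel_measurable M'" for k by (rule meas'[OF lip abs])
      show "integrable M' (\<lambda>_. B)" using M' by (simp add: prob_space.finite_measure finite_measure.integrable_const)
      show "AE \<omega> in M'. (\<lambda>k. \<psi> k (Z' \<omega>)) \<longlonglongrightarrow> \<phi> (Z' \<omega>)" using lim Z' by auto
      show "AE \<omega> in M'. norm (\<psi> k (Z' \<omega>)) \<le> B" for k using abs Z' by auto
    qed
    from order_tendstoD(1)[OF this, of "(\<integral>\<omega>. \<phi> (Z' \<omega>) \<partial>M') - \<epsilon>"] eps
    obtain k where k: "(\<integral>\<omega>. \<psi> k (Z' \<omega>) \<partial>M') > (\<integral>\<omega>. \<phi> (Z' \<omega>) \<partial>M') - \<epsilon>"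
      by (auto simp: eventually_sequentially)
    from order_tendstoD(1)[OF conv[OF lip abs] k]
    have "\<forall>\<^sub>F n in sequentially. (\<integral>\<omega>. \<psi> k (Z n \<omega>) \<partial>M n) > (\<integral>\<omega>. \<phi> (Z' \<omega>) \<partial>M') - \<epsilon>" .
    moreover have "\<forall>\<^sub>F n in sequentially. n \<ge> n0" by (rule eventually_ge_at_top)
    ultimately show ?thesis
    proof eventually_elim
      case (elim n)
      interpret prob_space "M n" by (rule M[OF elim(2)])
      have "(\<integral>\<omega>. \<psi> k (Z n \<omega>) \<partial>M n) \<le> (\<integral>\<omega>. \<phi> (Z n \<omega>) \<partial>M n)"
      proof (rule integral_mono)
        show "integrable (M n) (\<lambda>\<omega>. \<psi> k (Z n \<omega>))"
          by (rule integrable_const_bound[where B = B]) (use abs Z elim meas[OF _ lip abs] in auto)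
        have "(\<lambda>\<omega>. \<phi> (Z n \<omega>)) \<in> borel_measurable (M n)"
          using mphi[OF c] mZ[OF elim(2)] by measurable
        then show "integrable (M n) (\<lambda>\<omega>. \<phi> (Z n \<omega>))"
          by (intro integrable_const_bound[where B = B]) (use bdd Z elim in auto)
        show "\<psi> k (Z n \<omega>) \<le> \<phi> (Z n \<omega>)" if "\<omega> \<in> space (M n)" for \<omega>
          by (rule le) (use Z elim that in auto)
      qed
      then show ?case using elim(1) by linarith
    qed
  qed
  have "(\<lambda>n. \<integral>\<omega>. \<phi> (Z n \<omega>) \<partial>M n) \<longlonglongrightarrow> (\<integral>\<omega>. \<phi> (Z' \<omega>) \<partial>M')"
    if c: "continuous_map ?T euclideanreal \<phi>" and b: "bounded (\<phi> ` topspace ?T)" for \<phi>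
  proof -
    from b obtain B where B: "\<And>w. w \<in> cadlag_paths {l..r} \<Longrightarrow> \<bar>\<phi> w\<bar> \<le> B"
      by (auto simp: bounded_iff topspace_skorohod_topology)
    show ?thesis
    proof (rule tendstoI)
      fix e :: real assume e: "e > 0"
      have c': "continuous_map ?T euclideanreal (\<lambda>w. - \<phi> w)" using c by (intro continuous_intros)
      have "\<forall>\<^sub>F n in sequentially. (\<integral>\<omega>. - \<phi> (Z n \<omega>) \<partial>M n) > (\<integral>\<omega>. - \<phi> (Z' \<omega>) \<partial>M') - e"
        by (rule lower[OF c' _ e, of B]) (use B in auto)
      moreover have "\<forall>\<^sub>F n in sequentially. (\<integral>\<omega>. \<phi> (Z n \<omega>) \<partial>M n) > (\<integral>\<omega>. \<phi> (Z' \<omega>) \<partial>M') - e"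
        by (rule lower[OF c _ e, of B]) (use B in auto)
      ultimately show "\<forall>\<^sub>F n in sequentially. dist (\<integral>\<omega>. \<phi> (Z n \<omega>) \<partial>M n) (\<integral>\<omega>. \<phi> (Z' \<omega>) \<partial>M') < e"
        by eventually_elim (simp add: dist_real_def abs_less_iff)
    qed
  qed
  then show ?thesis
    unfolding converges_in_law_def using M M' mZ mZ' by auto
qed

section \<open>Step functions and continuous functions as cadlag paths\<close>

definition step_path :: "(nat \<Rightarrow> real) \<Rightarrow> real \<Rightarrow> real \<Rightarrow> real" where
  "step_path a h = (\<lambda>t\<in>{0..}. a (nat \<lfloor>t / h\<rfloor>))"

lemma step_path_mem_cadlag_paths:
  assumes h: "h > 0" and a: "\<And>k. a k \<in> E"
  shows "step_path a h \<in> cadlag_paths E"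
proof -
  have "(step_path a h \<longlongrightarrow> step_path a h t) (at_right t)" if t: "t \<ge> 0" for t
  proof (rule tendsto_eventually)
    let ?k = "\<lfloor>t / h\<rfloor>"
    have "t / h < of_int ?k + 1" by linarith
    then have "t < (of_int ?k + 1) * h" using h by (simp add: field_simps)
    then have "\<forall>\<^sub>F s in at_right t. s \<in> {t<..<(of_int ?k + 1) * h}"
      by (rule eventually_at_right_real)
    then show "\<forall>\<^sub>F s in at_right t. step_path a h s = step_path a h t"
    proof eventually_elim
      case (elim s)
      have "of_int ?k \<le> t / h" by linarith
      also have "t / h \<le> s / h" using elim h by (simp add: divide_right_mono)
      finally have "of_int ?k \<le> s / h" .
      moreover have "s / h < of_int ?k + 1" using elim h by (simp add: field_simps)
      ultimately have "\<lfloor>s / h\<rfloor> = ?k" by linarith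
      then show ?case using t elim by (simp add: step_path_def)
    qed
  qed
  moreover have "\<exists>L. (step_path a h \<longlongrightarrow> L) (at_left t)" if t: "t > 0" for t
  proof (intro exI tendsto_eventually)
    \<comment> \<open>At a multiple of h the left limit is the value on the preceding interval,
      hence ceiling minus one and not the floor.\<close>
    let ?k = "\<lceil>t / h\<rceil> - 1"
    have "of_int ?k < t / h" by linarith
    then have "of_int ?k * h < t" using h by (simp add: field_simps)
    with t have "max 0 (of_int ?k * h) < t" by auto
    then have "\<forall>\<^sub>F s in at_left t. s \<in> {max 0 (of_int ?k * h)<..<t}"
      by (rule eventually_at_left_real)
    then show "\<forall>\<^sub>F s in at_left t. step_path a h s = a (nat ?k)"
    proof eventually_elim
      case (elim s)
      have "s / h < t / h" using elim h by (simp add: divide_strict_right_mono)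
      also have "t / h \<le> of_int ?k + 1" by linarith
      finally have "s / h < of_int ?k + 1" .
      moreover have "of_int ?k \<le> s / h" using elim h by (simp add: field_simps)
      ultimately have "\<lfloor>s / h\<rfloor> = ?k" by linarith
      then show ?case using elim by (simp add: step_path_def)
    qed
  qed
  ultimately show ?thesis
    unfolding cadlag_paths_def cadlag_def using a by (auto simp: step_path_def PiE_iff)
qed

lemma path_of_interpolated_chain:
  "path_of (interpolated_chain l r b n X) \<omega> = step_path (\<lambda>k. grid l r n (X k \<omega>)) (time_step l r b n)"
  by (simp add: path_of_def step_path_def interpolated_chain_def fun_eq_iff)

lemma continuous_paths_subset_cadlag_paths: "continuous_paths l r \<subseteq> cadlag_paths {l..r}"
proof
  fix w assume w: "w \<in> continuous_paths l r"
  then have c: "continuous_on {0..} w" by (simp add: continuous_paths_def)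
  have "(w \<longlongrightarrow> w t) (at_right t)" if "t \<ge> 0" for t
  proof -
    have "(w \<longlongrightarrow> w t) (at t within {0..})" using c that by (auto simp: continuous_on)
    then show ?thesis by (rule tendsto_mono[rotated]) (use that in \<open>auto intro!: at_le\<close>)
  qed
  moreover have "(w \<longlongrightarrow> w t) (at_left t)" if "t > 0" for t
  proof -
    have "isCont w t" using continuous_on_interior[OF c, of t] that by simp
    then show ?thesis by (simp add: isCont_def filterlim_at_split)
  qed
  ultimately show "w \<in> cadlag_paths {l..r}"
    using w unfolding cadlag_paths_def continuous_paths_def cadlag_def by auto
qed

subsection \<open>The Feller semigroup\<close>

lemma space_path_space: "space (path_space l r) = continuous_paths l r"
  by (auto simp: path_space_def space_restrict_space space_PiM continuous_paths_def PiE_def)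

lemma continuous_paths_bounds: "w \<in> continuous_paths l r \<Longrightarrow> t \<ge> 0 \<Longrightarrow> w t \<in> {l..r}"
  by (auto simp: continuous_paths_def PiE_iff)

lemma measurable_path_eval:
  assumes "t \<ge> 0"
  shows "(\<lambda>w. w t) \<in> path_space l r \<rightarrow>\<^sub>M restrict_space borel {l..r}"
proof (rule measurable_restrict_space2)
  show "(\<lambda>w. w t) \<in> space (path_space l r) \<rightarrow> {l..r}"
    using assms continuous_paths_bounds by (auto simp: space_path_space)
  show "(\<lambda>w. w t) \<in> borel_measurable (path_space l r)"
    unfolding path_space_def using assms
    by (intro measurable_restrict_space1 measurable_component_singleton) auto
qed

lemma borel_measurable_path_eval:
  assumes "continuous_on {l..r} f" "t \<ge> 0"
  shows "(\<lambda>w. f (w t) :: real) \<in> borel_measurable (path_space l r)"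
  by (rule measurable_compose[OF measurable_path_eval[OF assms(2)] borel_measurable_continuous_on_restrict[OF assms(1)]])

lemma shift_path_mem:
  assumes "w \<in> continuous_paths l r" "s \<ge> 0"
  shows "shift_path s w \<in> continuous_paths l r"
proof -
  have "continuous_on {0..} (\<lambda>t. w (s + t))"
  proof (rule continuous_on_compose2[where g = w and f = "\<lambda>t. s + t" and t = "{0..}"])
    show "continuous_on {0..} w" using assms by (simp add: continuous_paths_def)
    show "continuous_on {0..} (\<lambda>t. s + t)" by (intro continuous_intros)
    show "(\<lambda>t. s + t) ` {0..} \<subseteq> {0..}" using assms by auto
  qed
  then have "continuous_on {0..} (shift_path s w)"
    by (rule continuous_on_eq) (simp add: shift_path_def)
  moreover have "shift_path s w \<in> {0..} \<rightarrow>\<^sub>E {l..r}"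
    using assms continuous_paths_bounds[OF assms(1)] by (simp add: shift_path_def PiE_iff)
  ultimately show ?thesis by (simp add: continuous_paths_def)
qed

lemma measurable_shift_path:
  assumes "s \<ge> 0"
  shows "shift_path s \<in> path_space l r \<rightarrow>\<^sub>M path_space l r"
  unfolding path_space_def[of l r]
proof (rule measurable_restrict_space2)
  show "shift_path s \<in> space (restrict_space (Pi\<^sub>M {0..} (\<lambda>t. borel)) (continuous_paths l r)) \<rightarrow> continuous_paths l r"
    using shift_path_mem[OF _ assms] by (auto simp: space_path_space[unfolded path_space_def])
  have "(\<lambda>w. w (s + t)) \<in> borel_measurable (path_space l r)" if "t \<ge> 0" for t
    using borel_measurable_path_eval[of l r "\<lambda>x. x" "s + t"] that assms by simp
  then show "shift_path s \<in> restrict_space (Pi\<^sub>M {0..} (\<lambda>t. borel)) (continuous_paths l r) \<rightarrow>\<^sub>M Pi\<^sub>M {0..} (\<lambda>t. borel)"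
    unfolding shift_path_def path_space_def[symmetric] by (intro measurable_restrict) auto
qed

lemma continuous_on_interval_bounded:
  fixes l r :: real
  assumes "continuous_on {l..r} f"
  obtains B :: real where "\<And>x. x \<in> {l..r} \<Longrightarrow> \<bar>f x :: real\<bar> \<le> B"
proof -
  have "bounded (f ` {l..r})"
    by (intro compact_imp_bounded compact_continuous_image assms) auto
  then obtain B where "\<forall>y\<in>f ` {l..r}. norm y \<le> B" unfolding bounded_iff by blast
  then show thesis by (intro that[of B]) auto
qed

locale reflecting_diffusion =
  fixes l r :: real and b :: "real \<Rightarrow> real" and P :: "real \<Rightarrow> (real \<Rightarrow> real) measure"
  assumes l_less_r: "l < r"
    and continuous_b: "continuous_on {l..r} b"
    and b_bounded_below: "\<exists>\<delta>>0. \<forall>y\<in>{l..r}. b y \<ge> \<delta>"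
    and diffusion: "diffusion l r P"
    and feller: "feller l r P"
    and generator_eq: "generator l r P = reflecting_operator l r b"
begin

lemma measurable_P: "P \<in> restrict_space borel {l..r} \<rightarrow>\<^sub>M prob_algebra (path_space l r)"
  using diffusion by (simp add: diffusion_def)

lemma
  assumes "x \<in> {l..r}"
  shows prob_space_P: "prob_space (P x)" and sets_P: "sets (P x) = sets (path_space l r)"
    and space_P: "space (P x) = continuous_paths l r"
proof -
  have "P x \<in> space (prob_algebra (path_space l r))"
    using measurable_space[OF measurable_P] assms by (auto simp: space_restrict_space)
  then show "prob_space (P x)" and s: "sets (P x) = sets (path_space l r)"
    by (auto simp: space_prob_algebra)
  show "space (P x) = continuous_paths l r"
    using sets_eq_imp_space_eq[OF s] by (simp add: space_path_space)
qed

lemma AE_start: "x \<in> {l..r} \<Longrightarrow> AE w in P x. w 0 = x"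
  using diffusion by (simp add: diffusion_def)

lemma measurable_P_iff: "x \<in> {l..r} \<Longrightarrow> G \<in> borel_measurable (P x) \<longleftrightarrow> G \<in> borel_measurable (path_space l r)"
  using sets_P by (simp cong: measurable_cong_sets)

lemma integrable_P:
  fixes G :: "(real \<Rightarrow> real) \<Rightarrow> real"
  assumes "x \<in> {l..r}" "G \<in> borel_measurable (path_space l r)"
    and "\<And>w. w \<in> continuous_paths l r \<Longrightarrow> \<bar>G w\<bar> \<le> B"
  shows "integrable (P x) G"
proof -
  interpret prob_space "P x" by (rule prob_space_P[OF assms(1)])
  show ?thesis
    using assms by (intro integrable_const_bound[where B = B]) (auto simp: space_P measurable_P_iff)
qed

text \<open>The strong Markov property at the constant time s, with A the whole path space. As an
  identity of measures it extends from events B to bounded measurable functionals.\<close>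

lemma distr_shift_path:
  assumes x: "x \<in> {l..r}" and s: "s \<ge> 0"
  shows "distr (P x) (path_space l r) (shift_path s) = P x \<bind> (\<lambda>w. P (w s))"
proof (rule measure_eqI)
  interpret prob_space "P x" by (rule prob_space_P[OF x])
  have ker: "(\<lambda>w. P (w s)) \<in> P x \<rightarrow>\<^sub>M prob_algebra (path_space l r)"
    using measurable_compose[OF measurable_path_eval[OF s] measurable_P] sets_P[OF x]
    by (simp cong: measurable_cong_sets)
  then have ker': "(\<lambda>w. P (w s)) \<in> P x \<rightarrow>\<^sub>M subprob_algebra (path_space l r)"
    by (rule measurable_prob_algebraD)
  show sets_eq: "sets (distr (P x) (path_space l r) (shift_path s)) = sets (P x \<bind> (\<lambda>w. P (w s)))"
    by (subst sets_bind[OF _ not_empty, of _ "path_space l r"])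
       (use ker' in \<open>auto dest!: measurable_space simp: space_subprob_algebra\<close>)
  fix B assume "B \<in> sets (distr (P x) (path_space l r) (shift_path s))"
  then have B: "B \<in> sets (path_space l r)" by simp
  let ?\<tau> = "\<lambda>_::real \<Rightarrow> real. ennreal s"
  interpret F: filtration "continuous_paths l r" "path_filtration l r" by (rule filtration_path_filtration)
  have st: "stopping_time (path_filtration l r) ?\<tau>" by (rule stopping_time_const)
  have "continuous_paths l r \<in> sets (F.pre_sigma ?\<tau>)"
    using sets.top[of "F.pre_sigma ?\<tau>"] by (simp add: F.space_pre_sigma)
  then have eq: "measure (P x) {w\<in>continuous_paths l r. ?\<tau> w < \<top> \<and> shift_path (enn2real (?\<tau> w)) w \<in> B} =
           (LINT w:{w\<in>continuous_paths l r. ?\<tau> w < \<top>}|P x. measure (P (w (enn2real (?\<tau> w)))) B)"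
    using diffusion x st B unfolding diffusion_def by blast
  have "measure (P x) (shift_path s -` B \<inter> space (P x)) = (\<integral>w. measure (P (w s)) B \<partial>P x)"
  proof -
    have "shift_path s -` B \<inter> space (P x) = {w\<in>continuous_paths l r. ?\<tau> w < \<top> \<and> shift_path (enn2real (?\<tau> w)) w \<in> B}"
      using s by (auto simp: space_P[OF x])
    moreover have "(LINT w:{w\<in>continuous_paths l r. ?\<tau> w < \<top>}|P x. measure (P (w (enn2real (?\<tau> w)))) B)
      = (\<integral>w. measure (P (w s)) B \<partial>P x)"
      unfolding set_lebesgue_integral_def using s
      by (intro Bochner_Integration.integral_cong) (auto simp: space_P[OF x])
    ultimately show ?thesis using eq by simp
  qed
  have shift: "shift_path s \<in> P x \<rightarrow>\<^sub>M path_space l r"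
    using measurable_shift_path[OF s] sets_P[OF x] by (simp cong: measurable_cong_sets)
  have mB: "(\<lambda>w. measure (P (w s)) B) \<in> borel_measurable (P x)"
    by (rule measurable_compose[OF ker' measurable_measure_subprob_algebra[OF B]])
  have pw: "prob_space (P (w s))" if "w \<in> space (P x)" for w
    using that s continuous_paths_bounds[of w l r s] by (intro prob_space_P) (auto simp: space_P[OF x])
  have "emeasure (P x \<bind> (\<lambda>w. P (w s))) B = (\<integral>\<^sup>+w. emeasure (P (w s)) B \<partial>P x)"
    by (rule emeasure_bind[OF not_empty ker' B])
  also have "\<dots> = (\<integral>\<^sup>+w. ennreal (measure (P (w s)) B) \<partial>P x)"
    by (intro nn_integral_cong) (simp add: finite_measure.emeasure_eq_measure prob_space.finite_measure pw)
  also have "\<dots> = ennreal (\<integral>w. measure (P (w s)) B \<partial>P x)"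
    by (intro nn_integral_eq_integral integrable_const_bound[where B = 1] mB)
       (auto intro!: prob_space.prob_le_1 pw AE_I2)
  also have "\<dots> = ennreal (measure (P x) (shift_path s -` B \<inter> space (P x)))"
    using \<open>measure (P x) (shift_path s -` B \<inter> space (P x)) = (\<integral>w. measure (P (w s)) B \<partial>P x)\<close> by simp
  also have "\<dots> = emeasure (distr (P x) (path_space l r) (shift_path s)) B"
    using shift B by (simp add: emeasure_distr emeasure_eq_measure)
  finally show "emeasure (distr (P x) (path_space l r) (shift_path s)) B = emeasure (P x \<bind> (\<lambda>w. P (w s))) B" ..
qed

lemma markov_property:
  fixes G :: "(real \<Rightarrow> real) \<Rightarrow> real"
  assumes x: "x \<in> {l..r}" and s: "s \<ge> 0" and G: "G \<in> borel_measurable (path_space l r)"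
    and bd: "\<And>w. w \<in> continuous_paths l r \<Longrightarrow> \<bar>G w\<bar> \<le> B"
  shows "(\<integral>w. G (shift_path s w) \<partial>P x) = (\<integral>w. (\<integral>v. G v \<partial>P (w s)) \<partial>P x)"
proof -
  interpret prob_space "P x" by (rule prob_space_P[OF x])
  have ker: "(\<lambda>w. P (w s)) \<in> P x \<rightarrow>\<^sub>M subprob_algebra (path_space l r)"
    using measurable_compose[OF measurable_path_eval[OF s] measurable_prob_algebraD[OF measurable_P]] sets_P[OF x]
    by (simp cong: measurable_cong_sets)
  have shift: "shift_path s \<in> P x \<rightarrow>\<^sub>M path_space l r"
    using measurable_shift_path[OF s] sets_P[OF x] by (simp cong: measurable_cong_sets)
  have pw: "prob_space (P (w s))" if "w \<in> space (P x)" for w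
    using that s continuous_paths_bounds[of w l r s] by (intro prob_space_P) (auto simp: space_P[OF x])
  have "(\<integral>w. G (shift_path s w) \<partial>P x) = (\<integral>w. G w \<partial>(P x \<bind> (\<lambda>w. P (w s))))"
    unfolding distr_shift_path[OF x s, symmetric] by (rule integral_distr[OF shift G, symmetric])
  also have "\<dots> = (\<integral>w. (\<integral>v. G v \<partial>P (w s)) \<partial>P x)"
  proof (rule integral_bind[OF G _ ker finite_measure_axioms, where B' = 1])
    show "\<bar>G w\<bar> \<le> B" if "w \<in> space (path_space l r)" for w using bd that by (simp add: space_path_space)
    show "AE w in P x. emeasure (P (w s)) (space (P (w s))) \<le> ennreal 1"
      by (intro AE_I2) (simp add: prob_space.emeasure_space_1 pw)
  qed
  finally show ?thesis .
qed

section \<open>Semigroup, generator and orbits\<close>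

abbreviation T :: "real \<Rightarrow> (real \<Rightarrow> real) \<Rightarrow> real \<Rightarrow> real" where "T \<equiv> semigroup P"

lemma continuous_T: "continuous_on {l..r} f \<Longrightarrow> t \<ge> 0 \<Longrightarrow> continuous_on {l..r} (T t f)"
  using feller by (simp add: feller_def)

lemma integrable_eval:
  assumes "x \<in> {l..r}" "continuous_on {l..r} f" "t \<ge> 0"
  shows "integrable (P x) (\<lambda>w. f (w t) :: real)"
proof -
  obtain B where B: "\<And>x. x \<in> {l..r} \<Longrightarrow> \<bar>f x\<bar> \<le> B"
    using continuous_on_interval_bounded[OF assms(2)] by blast
  show ?thesis
    using assms B continuous_paths_bounds
    by (intro integrable_P[where B = B] borel_measurable_path_eval) auto
qed

lemma T_contraction:
  assumes x: "x \<in> {l..r}" and f: "continuous_on {l..r} f" and g: "continuous_on {l..r} g" and t: "t \<ge> 0"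
    and le: "\<And>y. y \<in> {l..r} \<Longrightarrow> \<bar>f y - g y\<bar> \<le> c"
  shows "\<bar>T t f x - T t g x\<bar> \<le> c"
proof -
  interpret prob_space "P x" by (rule prob_space_P[OF x])
  have "T t f x - T t g x = (\<integral>w. f (w t) - g (w t) \<partial>P x)"
    unfolding semigroup_def using integrable_eval[OF x f t] integrable_eval[OF x g t] by simp
  also have "\<bar>\<dots>\<bar> \<le> (\<integral>w. \<bar>f (w t) - g (w t)\<bar> \<partial>P x)" by (rule integral_abs_bound)
  also have "\<dots> \<le> (\<integral>w. c \<partial>P x)"
    using integrable_eval[OF x f t] integrable_eval[OF x g t]
    by (intro integral_mono) (auto intro!: le continuous_paths_bounds[OF _ t] simp: space_P[OF x])
  also have "\<dots> = c" by (simp add: prob_space)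
  finally show ?thesis .
qed

lemma T_0:
  assumes x: "x \<in> {l..r}" and f: "continuous_on {l..r} f"
  shows "T 0 f x = f x"
proof -
  interpret prob_space "P x" by (rule prob_space_P[OF x])
  have "T 0 f x = (\<integral>w. f x \<partial>P x)"
    unfolding semigroup_def
    using AE_start[OF x] integrable_eval[OF x f order_refl]
    by (intro integral_cong_AE) auto
  then show ?thesis by (simp add: prob_space)
qed

lemma T_add:
  assumes x: "x \<in> {l..r}" and f: "continuous_on {l..r} f" and s: "s \<ge> 0" and t: "t \<ge> 0"
  shows "T (s + t) f x = T s (T t f) x"
proof -
  obtain B where B: "\<And>x. x \<in> {l..r} \<Longrightarrow> \<bar>f x\<bar> \<le> B"
    using continuous_on_interval_bounded[OF f] by blast
  have "T (s + t) f x = (\<integral>w. f (shift_path s w t) \<partial>P x)"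
    unfolding semigroup_def using t by (simp add: shift_path_def)
  also have "\<dots> = T s (T t f) x"
    unfolding semigroup_def
    using B continuous_paths_bounds[OF _ t]
    by (intro markov_property[OF x s borel_measurable_path_eval[OF f t], where B = B]) auto
  finally show ?thesis .
qed

lemma T_linear:
  assumes x: "x \<in> {l..r}" and f: "continuous_on {l..r} f" and g: "continuous_on {l..r} g" and t: "t \<ge> 0"
  shows "T t (\<lambda>y. (f y - g y) / c) x = (T t f x - T t g x) / c"
  unfolding semigroup_def using integrable_eval[OF x f t] integrable_eval[OF x g t] by simp

text \<open>T_s commutes with the difference quotients and contracts the uniform norm, so it passes
  through the uniform limit. Consequently every point T_s f of the orbit admits the Taylor expansion
  that holds on the domain.\<close>

lemma generator_T:
  assumes fg: "(f, g) \<in> generator l r P" and s: "s \<ge> 0"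
  shows "(T s f, T s g) \<in> generator l r P"
proof -
  have f: "continuous_on {l..r} f" and g: "continuous_on {l..r} g"
    and ul: "uniform_limit {l..r} (\<lambda>t x. (T t f x - f x) / t) g (at_right 0)"
    using fg by (auto simp: generator_def)
  have "uniform_limit {l..r} (\<lambda>t x. (T t (T s f) x - T s f x) / t) (T s g) (at_right 0)"
  proof (rule uniform_limitI)
    fix e :: real assume "e > 0"
    then have "\<forall>\<^sub>F t in at_right 0. \<forall>x\<in>{l..r}. dist ((T t f x - f x) / t) (g x) < e / 2"
      by (intro uniform_limitD[OF ul]) auto
    moreover have "\<forall>\<^sub>F t in at_right (0::real). t > 0" by (simp add: eventually_at_right_less)
    ultimately show "\<forall>\<^sub>F t in at_right 0. \<forall>x\<in>{l..r}. dist ((T t (T s f) x - T s f x) / t) (T s g x) < e"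
    proof eventually_elim
      case (elim t)
      show ?case
      proof
        fix x assume x: "x \<in> {l..r}"
        have Tf: "continuous_on {l..r} (T t f)" using elim by (intro continuous_T f) auto
        have "(T t (T s f) x - T s f x) / t = (T s (T t f) x - T s f x) / t"
          using T_add[OF x f s, of t] T_add[OF x f, of t s] elim s by (simp add: add.commute)
        also have "\<dots> = T s (\<lambda>y. (T t f y - f y) / t) x"
          by (rule T_linear[OF x Tf f s, symmetric])
        finally have eq: "(T t (T s f) x - T s f x) / t = T s (\<lambda>y. (T t f y - f y) / t) x" .
        have "\<bar>T s (\<lambda>y. (T t f y - f y) / t) x - T s g x\<bar> \<le> e / 2"
          using elim by (intro T_contraction x g s continuous_intros Tf f) (auto simp: dist_real_def less_imp_le)
        then show "dist ((T t (T s f) x - T s f x) / t) (T s g x) < e"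
          using \<open>e > 0\<close> unfolding eq dist_real_def by linarith
      qed
    qed
  qed
  then show ?thesis using f g s by (auto simp: generator_def intro: continuous_T)
qed

text \<open>Telescoping over a partition of \<open>[0,h]\<close> whose mesh tends to \<open>0\<close> replaces the integral
  formula \<open>T\<^sub>h f - f = \<integral>\<^sub>0\<^sup>h T\<^sub>u g du\<close>.\<close>

lemma generator_increment:
  assumes fg: "(f, g) \<in> generator l r P" and h: "h \<ge> 0" and x: "x \<in> {l..r}"
    and le: "\<And>u y. 0 \<le> u \<Longrightarrow> u \<le> h \<Longrightarrow> y \<in> {l..r} \<Longrightarrow> \<bar>T u g y - g y\<bar> \<le> \<epsilon>"
  shows "\<bar>T h f x - f x - h * g x\<bar> \<le> h * \<epsilon>"
proof (cases "h = 0")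
  case True
  then show ?thesis using fg x by (simp add: generator_def T_0)
next
  case False
  with h have hp: "h > 0" by simp
  have f: "continuous_on {l..r} f" and g: "continuous_on {l..r} g"
    and ul: "uniform_limit {l..r} (\<lambda>t x. (T t f x - f x) / t) g (at_right 0)"
    using fg by (auto simp: generator_def)
  show ?thesis
  proof (rule field_le_epsilon)
    fix e :: real assume e: "e > 0"
    \<comment> \<open>Over m steps of total length h the tolerance e / h accumulates to e.\<close>
    have "\<forall>\<^sub>F t in at_right 0. \<forall>y\<in>{l..r}. dist ((T t f y - f y) / t) (g y) < e / h"
      by (rule uniform_limitD[OF ul]) (use e hp in simp)
    then obtain d where d: "d > 0" and dd: "\<And>t y. 0 < t \<Longrightarrow> t < d \<Longrightarrow> y \<in> {l..r} \<Longrightarrow> \<bar>(T t f y - f y) / t - g y\<bar> < e / h"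
      unfolding eventually_at_right_field dist_real_def by blast
    obtain m :: nat where m: "h / d < real m" using reals_Archimedean2 by blast
    have m0: "real m > 0" using m divide_pos_pos[OF hp d] by linarith
    define t where "t = h / real m"
    have t: "0 < t" "t < d" using hp m0 m d by (auto simp: t_def field_simps)
    have mt: "real m * t = h" using m0 by (simp add: t_def)
    have step: "\<bar>T (real j * t) f x - f x - (real j * t) * g x\<bar> \<le> real j * t * (e / h + \<epsilon>)" if "j \<le> m" for j
      using that
    proof (induction j)
      case 0
      then show ?case using x f by (simp add: T_0)
    next
      case (Suc j)
      let ?u = "real j * t"
      have u: "0 \<le> ?u" "?u \<le> h" using Suc.prems t mt mult_right_mono[of "real j" "real m" t] by auto
      have Tf: "continuous_on {l..r} (T t f)" using t by (intro continuous_T f) auto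
      have "T (real (Suc j) * t) f x = T ?u (T t f) x"
        using T_add[OF x f u(1), of t] t by (simp add: algebra_simps)
      moreover have "\<bar>T ?u (\<lambda>y. (T t f y - f y) / t) x - T ?u g x\<bar> \<le> e / h"
        using dd[OF t] u t by (intro T_contraction x g continuous_intros Tf f) (auto simp: less_imp_le)
      moreover have "\<bar>T ?u g x - g x\<bar> \<le> \<epsilon>" by (rule le[OF u x])
      ultimately have "\<bar>(T (real (Suc j) * t) f x - T ?u f x) / t - g x\<bar> \<le> e / h + \<epsilon>"
        using T_linear[OF x Tf f u(1), of t] by simp
      then have "t * \<bar>(T (real (Suc j) * t) f x - T ?u f x) / t - g x\<bar> \<le> t * (e / h + \<epsilon>)"
        using t by (intro mult_left_mono) auto
      also have "t * \<bar>(T (real (Suc j) * t) f x - T ?u f x) / t - g x\<bar>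
         = \<bar>t * ((T (real (Suc j) * t) f x - T ?u f x) / t - g x)\<bar>" using t by (simp add: abs_mult)
      also have "t * ((T (real (Suc j) * t) f x - T ?u f x) / t - g x) = T (real (Suc j) * t) f x - T ?u f x - t * g x"
        using t by (simp add: field_simps)
      finally have "\<bar>T (real (Suc j) * t) f x - T ?u f x - t * g x\<bar> \<le> t * (e / h + \<epsilon>)" .
      then show ?case using Suc by (simp add: algebra_simps abs_le_iff)
    qed
    from step[of m] show "\<bar>T h f x - f x - h * g x\<bar> \<le> h * \<epsilon> + e"
      using hp by (simp add: mt distrib_left)
  qed
qed

text \<open>The chain rule produces a factor sin(\<kappa> (x - l)), which vanishes at l and at r
  because \<kappa> (r - l) = pi; so the Neumann condition holds for every polynomial. Continuity of
  b up to the boundary makes b f'' / 2 continuous there.\<close>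

lemma cos_polynomial_in_domain:
  assumes "real_polynomial_function p"
  defines "\<kappa> \<equiv> pi / (r - l)"
  shows "\<exists>g. (\<lambda>x. p (cos (\<kappa> * (x - l))), g) \<in> generator l r P"
proof -
  obtain p' where p': "real_polynomial_function p'" "\<And>x. (p has_real_derivative p' x) (at x)"
    using has_real_derivative_polynomial_function[OF assms(1)] by blast
  obtain p'' where p'': "real_polynomial_function p''" "\<And>x. (p' has_real_derivative p'' x) (at x)"
    using has_real_derivative_polynomial_function[OF p'(1)] by blast
  have cont: "continuous_on S (\<lambda>x. q (cos (\<kappa> * (x - l))))" if "real_polynomial_function q" for q S
  proof -
    have "continuous_on UNIV q"
      using that by (simp add: continuous_on_polymonial_function flip: real_polynomial_function_eq)
    then show ?thesis
      by (rule continuous_on_compose2) (auto intro!: continuous_intros)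
  qed
  define f' where "f' x = p' (cos (\<kappa> * (x - l))) * (- sin (\<kappa> * (x - l)) * \<kappa>)" for x
  define f'' where "f'' x = p'' (cos (\<kappa> * (x - l))) * (- sin (\<kappa> * (x - l)) * \<kappa>) * (- sin (\<kappa> * (x - l)) * \<kappa>)
    + (- cos (\<kappa> * (x - l)) * \<kappa> * \<kappa>) * p' (cos (\<kappa> * (x - l)))" for x
  have d1: "((\<lambda>x. p (cos (\<kappa> * (x - l)))) has_real_derivative f' x) (at x)" for x
    unfolding f'_def by (rule DERIV_chain2[OF p'(2)]) (auto intro!: derivative_eq_intros)
  have d2: "(f' has_real_derivative f'' x) (at x)" for x
    unfolding f'_def f''_def
    by (rule DERIV_mult[OF DERIV_chain2[OF p''(2)]]) (auto intro!: derivative_eq_intros)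
  have cf'': "continuous_on S f''" for S
    unfolding f''_def by (intro continuous_intros cont p' p'')
  have cf': "isCont f' x" for x using d2 by (rule DERIV_isCont)
  have z: "f' l = 0" "f' r = 0" using l_less_r by (auto simp: f'_def \<kappa>_def)
  have "(f' \<longlongrightarrow> 0) (at_right l)" "(f' \<longlongrightarrow> 0) (at_left r)"
    using cf'[of l] cf'[of r] z by (auto simp: isCont_def filterlim_at_split)
  then have "(\<lambda>x. p (cos (\<kappa> * (x - l))), \<lambda>x. 1 / 2 * b x * f'' x) \<in> reflecting_operator l r b"
    unfolding reflecting_operator_def mem_Collect_eq case_prod_conv using d1 d2
    by (intro conjI exI[of _ f'] exI[of _ f''] cont assms(1) continuous_intros continuous_b cf'' ballI refl)
  then show ?thesis unfolding generator_eq by blast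
qed

text \<open>The map x to cos(\<kappa> (x - l)) is a homeomorphism onto [-1,1], so the Weierstrass
  theorem can be applied to f read in this coordinate.\<close>

lemma generator_domain_dense:
  assumes f: "continuous_on {l..r} f" and e: "\<epsilon> > 0"
  obtains F G where "(F, G) \<in> generator l r P" "\<And>x. x \<in> {l..r} \<Longrightarrow> \<bar>f x - F x\<bar> \<le> \<epsilon>"
proof -
  define \<kappa> where "\<kappa> = pi / (r - l)"
  have k: "\<kappa> > 0" using l_less_r by (simp add: \<kappa>_def)
  have "continuous_on {-1..1} (\<lambda>u. f (l + arccos u / \<kappa>))"
  proof (rule continuous_on_compose2[OF f])
    show "continuous_on {-1..1} (\<lambda>u. l + arccos u / \<kappa>)"
      using k by (intro continuous_intros) auto
    show "(\<lambda>u. l + arccos u / \<kappa>) ` {-1..1} \<subseteq> {l..r}"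
    proof safe
      fix u :: real assume u: "u \<in> {-1..1}"
      then have "0 \<le> arccos u" "arccos u \<le> pi" by (auto intro: arccos_lbound arccos_ubound)
      then have "0 \<le> arccos u / \<kappa>" "arccos u / \<kappa> \<le> pi / \<kappa>"
        using k by (auto intro!: divide_right_mono)
      moreover have "pi / \<kappa> = r - l" by (simp add: \<kappa>_def)
      ultimately show "l + arccos u / \<kappa> \<in> {l..r}" by simp
    qed
  qed
  then obtain p where p: "real_polynomial_function p" "\<And>u. u \<in> {-1..1} \<Longrightarrow> \<bar>f (l + arccos u / \<kappa>) - p u\<bar> < \<epsilon>"
    using Stone_Weierstrass_real_polynomial_function[of "{-1..1}" "\<lambda>u. f (l + arccos u / \<kappa>)" \<epsilon>] e by blast
  obtain G where G: "(\<lambda>x. p (cos (\<kappa> * (x - l))), G) \<in> generator l r P"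
    using cos_polynomial_in_domain[OF p(1)] unfolding \<kappa>_def by blast
  show thesis
  proof (rule that[OF G])
    fix x assume x: "x \<in> {l..r}"
    have "0 \<le> \<kappa> * (x - l)" "\<kappa> * (x - l) \<le> pi" using x l_less_r by (auto simp: \<kappa>_def field_simps)
    then have "l + arccos (cos (\<kappa> * (x - l))) / \<kappa> = x" using k by (simp add: arccos_cos)
    then show "\<bar>f x - p (cos (\<kappa> * (x - l)))\<bar> \<le> \<epsilon>"
      using p(2)[of "cos (\<kappa> * (x - l))"] by (auto simp: less_imp_le)
  qed
qed

text \<open>For F in the domain, T_t F - F is of order t, since the difference quotients are close
  to the bounded function G. Density of the domain and contraction carry the continuity at 0 over to
  f.\<close>

lemma strong_continuity:
  assumes f: "continuous_on {l..r} f" and e: "\<epsilon> > 0"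
  obtains \<delta> where "\<delta> > 0" "\<And>t x. 0 \<le> t \<Longrightarrow> t \<le> \<delta> \<Longrightarrow> x \<in> {l..r} \<Longrightarrow> \<bar>T t f x - f x\<bar> \<le> \<epsilon>"
proof -
  obtain F G where FG: "(F, G) \<in> generator l r P" and ap: "\<And>x. x \<in> {l..r} \<Longrightarrow> \<bar>f x - F x\<bar> \<le> \<epsilon> / 3"
    using generator_domain_dense[OF f, of "\<epsilon> / 3"] e by auto
  have F: "continuous_on {l..r} F" and G: "continuous_on {l..r} G"
    and ul: "uniform_limit {l..r} (\<lambda>t x. (T t F x - F x) / t) G (at_right 0)"
    using FG by (auto simp: generator_def)
  obtain B where B: "\<And>x. x \<in> {l..r} \<Longrightarrow> \<bar>G x\<bar> \<le> B"
    using continuous_on_interval_bounded[OF G] by blast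
  have B0: "B \<ge> 0" using B[of l] l_less_r by auto
  have "\<forall>\<^sub>F t in at_right 0. \<forall>y\<in>{l..r}. dist ((T t F y - F y) / t) (G y) < 1"
    by (rule uniform_limitD[OF ul]) simp
  then obtain d where d: "d > 0" and dd: "\<And>t y. 0 < t \<Longrightarrow> t < d \<Longrightarrow> y \<in> {l..r} \<Longrightarrow> \<bar>(T t F y - F y) / t - G y\<bar> < 1"
    unfolding eventually_at_right_field dist_real_def by blast
  define \<delta> where "\<delta> = min (d / 2) (\<epsilon> / (3 * (B + 1)))"
  show thesis
  proof (rule that)
    show "\<delta> > 0" using d e B0 by (simp add: \<delta>_def)
    fix t x assume t: "0 \<le> t" "t \<le> \<delta>" and x: "x \<in> {l..r}"
    have "\<bar>T t F x - F x\<bar> \<le> \<epsilon> / 3"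
    proof (cases "t = 0")
      case True
      then show ?thesis using T_0[OF x F] e by simp
    next
      case False
      with t have tp: "t > 0" by simp
      have "\<bar>(T t F x - F x) / t\<bar> \<le> B + 1"
        using dd[of t x] B[OF x] x t tp d by (auto simp: \<delta>_def)
      then have "\<bar>T t F x - F x\<bar> \<le> t * (B + 1)" using tp by (simp add: field_simps)
      also have "\<dots> \<le> \<epsilon> / (3 * (B + 1)) * (B + 1)"
        using t B0 by (intro mult_right_mono) (auto simp: \<delta>_def)
      also have "\<dots> = \<epsilon> / 3" using B0 by (simp add: field_simps)
      finally show ?thesis .
    qed
    moreover have "\<bar>T t f x - T t F x\<bar> \<le> \<epsilon> / 3" by (rule T_contraction[OF x f F t(1) ap])
    ultimately show "\<bar>T t f x - f x\<bar> \<le> \<epsilon>" using ap[OF x] by linarith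
  qed
qed

text \<open>By the semigroup law and contraction, an increment of the orbit is no larger than the
  one of equal length starting at time 0.\<close>

lemma T_time_increment:
  assumes f: "continuous_on {l..r} f" and x: "x \<in> {l..r}" and s: "0 \<le> s" "s \<le> t"
    and le: "\<And>y. y \<in> {l..r} \<Longrightarrow> \<bar>T (t - s) f y - f y\<bar> \<le> \<epsilon>"
  shows "\<bar>T t f x - T s f x\<bar> \<le> \<epsilon>"
proof -
  have "T t f x = T s (T (t - s) f) x" using T_add[OF x f s(1), of "t - s"] s by simp
  then show ?thesis
    using T_contraction[OF x continuous_T[OF f] f s(1) le] s by simp
qed

text \<open>Compactness of [0,S] made explicit: at the finitely many times j \<delta> uniform
  continuity holds separately, and strong continuity bridges the gaps. The factor c will be 2 / b:
  then c * T_s g is the second derivative of T_s f for (f, g) in the generator.\<close>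

lemma equicontinuous_orbit:
  assumes f: "continuous_on {l..r} f" and c: "continuous_on {l..r} c" and e: "\<epsilon> > 0"
  obtains \<eta> where "\<eta> > 0"
    "\<And>s x y. 0 \<le> s \<Longrightarrow> s \<le> S \<Longrightarrow> x \<in> {l..r} \<Longrightarrow> y \<in> {l..r} \<Longrightarrow> \<bar>x - y\<bar> < \<eta> \<Longrightarrow>
      \<bar>c x * T s f x - c y * T s f y\<bar> \<le> \<epsilon>"
proof -
  obtain C where C: "\<And>x. x \<in> {l..r} \<Longrightarrow> \<bar>c x\<bar> \<le> C"
    using continuous_on_interval_bounded[OF c] by blast
  have C0: "C \<ge> 0" using C[of l] l_less_r by auto
  obtain \<delta> where d: "\<delta> > 0" and dd: "\<And>t x. 0 \<le> t \<Longrightarrow> t \<le> \<delta> \<Longrightarrow> x \<in> {l..r} \<Longrightarrow> \<bar>T t f x - f x\<bar> \<le> \<epsilon> / (3 * (C + 1))"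
    using strong_continuity[OF f, of "\<epsilon> / (3 * (C + 1))"] e C0 by auto
  have "\<exists>\<eta>>0. \<forall>x\<in>{l..r}. \<forall>y\<in>{l..r}. \<bar>x - y\<bar> < \<eta> \<longrightarrow> \<bar>c x * T (real j * \<delta>) f x - c y * T (real j * \<delta>) f y\<bar> < \<epsilon> / 3" for j :: nat
  proof -
    have "uniformly_continuous_on {l..r} (\<lambda>x. c x * T (real j * \<delta>) f x)"
      using d by (intro compact_uniformly_continuous continuous_intros c continuous_T f) auto
    then show ?thesis
      unfolding uniformly_continuous_on_def dist_real_def using e
      by (elim allE[of _ "\<epsilon> / 3"]) (auto simp: abs_minus_commute)
  qed
  then obtain H where H: "\<And>j. H j > 0" "\<And>j x y. x \<in> {l..r} \<Longrightarrow> y \<in> {l..r} \<Longrightarrow> \<bar>x - y\<bar> < H j \<Longrightarrow>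
    \<bar>c x * T (real j * \<delta>) f x - c y * T (real j * \<delta>) f y\<bar> < \<epsilon> / 3" for j :: nat
    by metis
  define m where "m = nat \<lfloor>S / \<delta>\<rfloor>"
  show thesis
  proof (rule that)
    show "Min (H ` {..m}) > 0" using H(1) by (subst Min_gr_iff) auto
    fix s x y assume s: "0 \<le> s" "s \<le> S" and x: "x \<in> {l..r}" and y: "y \<in> {l..r}" and xy: "\<bar>x - y\<bar> < Min (H ` {..m})"
    define j where "j = nat \<lfloor>s / \<delta>\<rfloor>"
    have jm: "j \<le> m" unfolding j_def m_def using s d by (intro nat_mono floor_mono divide_right_mono) auto
    have "real j \<le> s / \<delta>" "s / \<delta> < real j + 1" using s d unfolding j_def by (auto simp: of_nat_floor)
    then have j: "real j * \<delta> \<le> s" "s - real j * \<delta> \<le> \<delta>" using d by (auto simp: field_simps)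
    have close: "\<bar>c z * T s f z - c z * T (real j * \<delta>) f z\<bar> \<le> \<epsilon> / 3" if z: "z \<in> {l..r}" for z
    proof -
      have "\<bar>T s f z - T (real j * \<delta>) f z\<bar> \<le> \<epsilon> / (3 * (C + 1))"
        using j d by (intro T_time_increment f z dd) auto
      then have "\<bar>c z\<bar> * \<bar>T s f z - T (real j * \<delta>) f z\<bar> \<le> (C + 1) * (\<epsilon> / (3 * (C + 1)))"
        using C[OF z] C0 e by (intro mult_mono) auto
      also have "\<dots> = \<epsilon> / 3" using C0 by (simp add: field_simps)
      finally show ?thesis by (simp add: abs_mult flip: right_diff_distrib)
    qed
    have "\<bar>x - y\<bar> < H j" using xy jm by (auto simp: Min_gr_iff)
    from H(2)[OF x y this] close[OF x] close[OF y]
    show "\<bar>c x * T s f x - c y * T s f y\<bar> \<le> \<epsilon>" by linarith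
  qed
qed

end

subsection \<open>Convergence of the discrete semigroups\<close>

text \<open>A mean value inequality on either side of x. The derivative is required only in the open
  interval, so x and y may be end points.\<close>

lemma abs_increment_le:
  fixes \<phi> \<phi>' :: "real \<Rightarrow> real"
  assumes c: "continuous_on {l..r} \<phi>" and x: "x \<in> {l..r}" and y: "y \<in> {l..r}"
    and d: "\<And>z. z \<in> {l<..<r} \<Longrightarrow> (\<phi> has_real_derivative \<phi>' z) (at z)"
    and le: "\<And>z. z \<in> {l<..<r} \<Longrightarrow> \<bar>z - x\<bar> \<le> \<bar>y - x\<bar> \<Longrightarrow> \<bar>\<phi>' z\<bar> \<le> c"
  shows "\<bar>\<phi> y - \<phi> x\<bar> \<le> c * \<bar>y - x\<bar>"
proof -
  have *: "\<exists>z. u < z \<and> z < v \<and> \<phi> v - \<phi> u = (v - u) * \<phi>' z" if uv: "u < v" "u \<in> {l..r}" "v \<in> {l..r}" for u v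
  proof -
    have "\<exists>m z. u < z \<and> z < v \<and> DERIV \<phi> z :> m \<and> \<phi> v - \<phi> u = (v - u) * m"
    proof (rule MVT[OF uv(1)])
      show "continuous_on {u..v} \<phi>" using uv by (intro continuous_on_subset[OF c]) auto
      show "\<phi> differentiable (at z)" if "u < z" "z < v" for z
        using d[of z] that uv by (auto simp: real_differentiable_def)
    qed
    then obtain m z where z: "u < z" "z < v" "DERIV \<phi> z :> m" "\<phi> v - \<phi> u = (v - u) * m" by blast
    moreover have "m = \<phi>' z" using d[of z] z uv by (intro DERIV_unique[OF z(3)]) auto
    ultimately show ?thesis by blast
  qed
  consider "x = y" | "x < y" | "y < x" by linarith
  then show ?thesis
  proof cases
    case 1
    then show ?thesis by simp
  next
    case 2
    then obtain z where z: "x < z" "z < y" "\<phi> y - \<phi> x = (y - x) * \<phi>' z" using *[OF 2 x y] by blast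
    have "\<bar>\<phi>' z\<bar> \<le> c" using z x y by (intro le) auto
    then show ?thesis unfolding z(3) by (simp add: abs_mult mult.commute[of c] mult_left_mono)
  next
    case 3
    then obtain z where z: "y < z" "z < x" "\<phi> x - \<phi> y = (x - y) * \<phi>' z" using *[OF 3 y x] by blast
    have "\<bar>\<phi>' z\<bar> \<le> c" using z x y by (intro le) auto
    moreover have "\<phi> y - \<phi> x = (y - x) * \<phi>' z" using z(3) by (simp add: algebra_simps)
    ultimately show ?thesis by (simp add: abs_mult mult.commute[of c] mult_left_mono)
  qed
qed

context reflecting_diffusion
begin

abbreviation "\<tau> n \<equiv> time_step l r b n"
abbreviation "Q n \<equiv> transition_matrix l r b n"

lemma b_pos: "y \<in> {l..r} \<Longrightarrow> b y > 0"
  using b_bounded_below by fastforce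

definition sup_b :: real where "sup_b = (SUP y\<in>{l..r}. b y)"

lemma b_le_sup: "y \<in> {l..r} \<Longrightarrow> b y \<le> sup_b"
proof -
  obtain B where "\<And>x. x \<in> {l..r} \<Longrightarrow> \<bar>b x\<bar> \<le> B"
    using continuous_on_interval_bounded[OF continuous_b] by blast
  then have "bdd_above (b ` {l..r})" by (intro bdd_aboveI2[where M = B]) (auto simp: abs_le_iff)
  then show "y \<in> {l..r} \<Longrightarrow> b y \<le> sup_b" unfolding sup_b_def by (rule cSUP_upper[rotated])
qed

lemma sup_b_pos: "sup_b > 0"
  using b_pos[of l] b_le_sup[of l] l_less_r by auto

text \<open>The coefficient g / b is f'' / 2 in the interior and still makes sense at the end
  points, where the operator gives no second derivative. Since f'' is merely continuous, the
  remainder is measured by the oscillation of 2 g / b between x and its mirror image at distance |y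
  - x|. The function F stands for f'; what the sequel needs of it is that it vanishes at both
  ends.\<close>

lemma reflecting_taylor:
  assumes fg: "(f, g) \<in> reflecting_operator l r b"
  obtains F where "F l = 0" "F r = 0"
    "\<And>x y \<epsilon>. x \<in> {l..r} \<Longrightarrow> y \<in> {l..r} \<Longrightarrow>
      (\<And>z. z \<in> {l..r} \<Longrightarrow> \<bar>z - x\<bar> \<le> \<bar>y - x\<bar> \<Longrightarrow> \<bar>2 / b z * g z - 2 / b x * g x\<bar> \<le> \<epsilon>) \<Longrightarrow>
      \<bar>f y - f x - F x * (y - x) - g x / b x * (y - x)\<^sup>2\<bar> \<le> \<epsilon> * (y - x)\<^sup>2"
proof -
  from fg obtain f' f'' where f: "continuous_on {l..r} f" and g: "continuous_on {l..r} g"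
    and f': "\<And>y. y \<in> {l<..<r} \<Longrightarrow> (f has_real_derivative f' y) (at y)"
    and f'': "\<And>y. y \<in> {l<..<r} \<Longrightarrow> (f' has_real_derivative f'' y) (at y)"
    and geq: "\<And>y. y \<in> {l<..<r} \<Longrightarrow> g y = 1/2 * b y * f'' y"
    and lim: "(f' \<longlongrightarrow> 0) (at_right l)" "(f' \<longlongrightarrow> 0) (at_left r)"
    unfolding reflecting_operator_def by blast
  \<comment> \<open>Only the one-sided limits of f' at the ends are prescribed; the value 0 there
    makes F continuous on the closed interval.\<close>
  define F where "F x = (if x \<in> {l<..<r} then f' x else 0)" for x
  have ev: "\<forall>\<^sub>F z in at z0. f' z = F z" if "z0 \<in> {l<..<r}" for z0
    using that by (intro eventually_at_in_open'[of "{l<..<r}", THEN eventually_mono]) (auto simp: F_def)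
  have F': "(F has_real_derivative f'' z) (at z)" if "z \<in> {l<..<r}" for z
  proof -
    have "f' z = F z" using that by (simp add: F_def)
    from has_field_derivative_cong_eventually[OF ev[OF that] this] f''[OF that] show ?thesis by simp
  qed
  have F: "continuous_on {l..r} F"
  proof (rule continuous_on_IccI)
    have "\<forall>\<^sub>F z in at_right l. f' z = F z"
      using eventually_at_right_real[OF l_less_r] by eventually_elim (simp add: F_def)
    then show "(F \<longlongrightarrow> F l) (at_right l)"
      using lim(1) tendsto_cong by (fastforce simp: F_def)
    have "\<forall>\<^sub>F z in at_left r. f' z = F z"
      using eventually_at_left_real[OF l_less_r] by eventually_elim (simp add: F_def)
    then show "(F \<longlongrightarrow> F r) (at_left r)"
      using lim(2) tendsto_cong by (fastforce simp: F_def)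
    show "F \<midarrow>z\<rightarrow> F z" if "l < z" "z < r" for z
      using DERIV_isCont[OF F'[of z]] that by (simp add: isCont_def)
  qed (rule l_less_r)
  have geq': "f'' z = 2 / b z * g z" if "z \<in> {l<..<r}" for z
    using geq[OF that] b_pos[of z] that by (simp add: field_simps)
  show thesis
  proof (rule that[of F])
    show "F l = 0" "F r = 0" by (auto simp: F_def)
    fix x y \<epsilon>
    assume x: "x \<in> {l..r}" and y: "y \<in> {l..r}"
      and le: "\<And>z. z \<in> {l..r} \<Longrightarrow> \<bar>z - x\<bar> \<le> \<bar>y - x\<bar> \<Longrightarrow> \<bar>2 / b z * g z - 2 / b x * g x\<bar> \<le> \<epsilon>"
    let ?k = "2 / b x * g x"
    \<comment> \<open>Up to constants these are the remainders of F to first and of f to second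
      order. The derivative of the second is the increment of the first, so two mean value
      inequalities give (y - x)^2.\<close>
    let ?\<psi> = "\<lambda>z. F z - ?k * (z - x)"
    let ?\<phi> = "\<lambda>z. f z - F x * (z - x) - ?k / 2 * (z - x)\<^sup>2"
    have e0: "0 \<le> \<epsilon>" using le[OF x] by simp
    have psi: "\<bar>?\<psi> z - ?\<psi> x\<bar> \<le> \<epsilon> * \<bar>z - x\<bar>" if z: "z \<in> {l..r}" "\<bar>z - x\<bar> \<le> \<bar>y - x\<bar>" for z
    proof (rule abs_increment_le[where l = l and r = r])
      show "continuous_on {l..r} ?\<psi>" by (intro continuous_intros F)
      show "(?\<psi> has_real_derivative f'' u - ?k) (at u)" if "u \<in> {l<..<r}" for u
        using F'[OF that] b_pos[OF x] by (auto intro!: derivative_eq_intros)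
      show "\<bar>f'' u - ?k\<bar> \<le> \<epsilon>" if "u \<in> {l<..<r}" "\<bar>u - x\<bar> \<le> \<bar>z - x\<bar>" for u
        using le[of u] that z by (simp add: geq')
    qed (use x z in auto)
    have "\<bar>?\<phi> y - ?\<phi> x\<bar> \<le> (\<epsilon> * \<bar>y - x\<bar>) * \<bar>y - x\<bar>"
    proof (rule abs_increment_le[where l = l and r = r])
      show "continuous_on {l..r} ?\<phi>" by (intro continuous_intros f)
      show "(?\<phi> has_real_derivative (f' u - F x - ?k * (u - x))) (at u)" if "u \<in> {l<..<r}" for u
        using f'[OF that] b_pos[OF x] by (auto intro!: derivative_eq_intros)
      show "\<bar>f' u - F x - ?k * (u - x)\<bar> \<le> \<epsilon> * \<bar>y - x\<bar>" if u: "u \<in> {l<..<r}" "\<bar>u - x\<bar> \<le> \<bar>y - x\<bar>" for u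
      proof -
        have "\<bar>f' u - F x - ?k * (u - x)\<bar> \<le> \<epsilon> * \<bar>u - x\<bar>"
          using psi[of u] u by (auto simp: F_def)
        also have "\<dots> \<le> \<epsilon> * \<bar>y - x\<bar>" using u e0 by (intro mult_left_mono) auto
        finally show ?thesis .
      qed
    qed (use x y in auto)
    then show "\<bar>f y - f x - F x * (y - x) - g x / b x * (y - x)\<^sup>2\<bar> \<le> \<epsilon> * (y - x)\<^sup>2"
      by (simp add: power2_eq_square algebra_simps flip: abs_mult)
  qed
qed

section \<open>The grid and one step of the chain\<close>

lemma mesh_pos: "n \<ge> 1 \<Longrightarrow> mesh l r n > 0"
  using l_less_r by (simp add: mesh_def)

lemma time_step_pos: "n \<ge> 1 \<Longrightarrow> \<tau> n > 0"
  using mesh_pos[of n] sup_b_pos unfolding time_step_def sup_b_def[symmetric] by simp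

lemma mesh_tendsto_0: "(\<lambda>n. mesh l r n) \<longlonglongrightarrow> 0"
  unfolding mesh_def by (rule lim_const_over_n)

lemma time_step_tendsto_0: "(\<lambda>n. \<tau> n) \<longlonglongrightarrow> 0"
  unfolding time_step_def using tendsto_divide[OF tendsto_power[OF mesh_tendsto_0, of 2] tendsto_const, of "2 * sup_b"] sup_b_pos
  by (simp add: sup_b_def)

lemma grid_0 [simp]: "grid l r n 0 = l"
  by (simp add: grid_def)

lemma grid_n [simp]: "n \<ge> 1 \<Longrightarrow> grid l r n n = r"
  by (simp add: grid_def mesh_def)

lemma grid_Suc: "grid l r n (Suc i) = grid l r n i + mesh l r n"
  by (simp add: grid_def algebra_simps)

lemma grid_mem:
  assumes "n \<ge> 1" "i \<le> n"
  shows "grid l r n i \<in> {l..r}"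
proof -
  have "real i * mesh l r n \<le> real n * mesh l r n"
    using assms mesh_pos[of n] by (intro mult_right_mono) auto
  also have "\<dots> = r - l" using assms by (simp add: mesh_def)
  finally show ?thesis using assms mesh_pos[of n] by (simp add: grid_def)
qed

text \<open>The total jump probability out of state i, see
  \<open>sum_jump_prob_eq_rate\<close>.\<close>

definition rate :: "nat \<Rightarrow> nat \<Rightarrow> real" where
  "rate n i = b (grid l r n i) * \<tau> n / (mesh l r n)\<^sup>2"

lemma rate_mult_mesh: "n \<ge> 1 \<Longrightarrow> rate n i * (mesh l r n)\<^sup>2 = b (grid l r n i) * \<tau> n"
  using mesh_pos[of n] by (simp add: rate_def)

text \<open>The factor 2 sup b in the time step keeps jumping at most as likely as staying, so the
  diagonal entries of the matrix are nonnegative.\<close>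

lemma rate_bounds:
  assumes "n \<ge> 1" "i \<le> n"
  shows "0 < rate n i" "rate n i \<le> 1 / 2"
proof -
  show "0 < rate n i"
    using b_pos[OF grid_mem[OF assms]] mesh_pos[OF assms(1)] time_step_pos[OF assms(1)]
    by (simp add: rate_def)
  have "rate n i = b (grid l r n i) / (2 * sup_b)"
    using mesh_pos[of n] assms by (simp add: rate_def time_step_def sup_b_def)
  also have "\<dots> \<le> sup_b / (2 * sup_b)"
    using b_le_sup[OF grid_mem[OF assms]] sup_b_pos by (intro divide_right_mono) auto
  finally show "rate n i \<le> 1 / 2" using sup_b_pos by simp
qed

lemma sum_jump_prob:
  assumes n: "n \<ge> 2" and i: "i \<le> n"
  shows "(\<Sum>j\<in>{0..n} - {i}. jump_prob l r b n i j * F j) =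
    (if i = 0 then rate n i * F 1 else if i = n then rate n i * F (n - 1)
     else rate n i / 2 * (F (i + 1) + F (i - 1)))"
proof -
  consider "i = 0" | "i = n" | "0 < i" "i < n" using i by linarith
  then show ?thesis
  proof cases
    case 1
    have "(\<Sum>j\<in>{0..n} - {i}. jump_prob l r b n i j * F j) = (\<Sum>j\<in>{1}. jump_prob l r b n i j * F j)"
      using n 1 by (intro sum.mono_neutral_right) (auto simp: jump_prob_def)
    then show ?thesis using 1 n by (simp add: jump_prob_def rate_def)
  next
    case 2
    have "(\<Sum>j\<in>{0..n} - {i}. jump_prob l r b n i j * F j) = (\<Sum>j\<in>{n - 1}. jump_prob l r b n i j * F j)"
      using n 2 by (intro sum.mono_neutral_right) (auto simp: jump_prob_def)
    then show ?thesis using 2 n by (simp add: jump_prob_def rate_def)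
  next
    case 3
    have "(\<Sum>j\<in>{0..n} - {i}. jump_prob l r b n i j * F j) = (\<Sum>j\<in>{i + 1, i - 1}. jump_prob l r b n i j * F j)"
      using n 3 by (intro sum.mono_neutral_right) (auto simp: jump_prob_def Let_def)
    also have "\<dots> = rate n i / 2 * (F (i + 1) + F (i - 1))"
      using 3 by (simp add: jump_prob_def Let_def distrib_left flip: rate_def)
    finally show ?thesis using 3 by simp
  qed
qed

lemma jump_prob_nonneg: "n \<ge> 2 \<Longrightarrow> i \<le> n \<Longrightarrow> 0 \<le> jump_prob l r b n i j"
  using rate_bounds[of n i] by (auto simp: jump_prob_def Let_def rate_def less_imp_le)

lemma sum_jump_prob_eq_rate:
  assumes "n \<ge> 2" "i \<le> n"
  shows "(\<Sum>j\<in>{0..n} - {i}. jump_prob l r b n i j) = rate n i"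
  using sum_jump_prob[OF assms, of "\<lambda>_. 1"] by simp

definition step_op :: "nat \<Rightarrow> (nat \<Rightarrow> real) \<Rightarrow> nat \<Rightarrow> real" where
  "step_op n f i = (\<Sum>j\<in>{0..n}. Q n i j * f j)"

text \<open>The discrete generator. At an end point it is the interior formula for a grid function
  mirrored there, because both neighbours would then coincide.\<close>

lemma step_op_eq:
  assumes n: "n \<ge> 2" and i: "i \<le> n"
  shows "step_op n f i - f i =
    (if i = 0 then rate n i * (f 1 - f 0) else if i = n then rate n i * (f (n - 1) - f n)
     else rate n i / 2 * (f (i + 1) + f (i - 1) - 2 * f i))"
proof -
  have "step_op n f i = Q n i i * f i
      + (\<Sum>j\<in>{0..n} - {i}. Q n i j * f j)"
    unfolding step_op_def using i by (intro sum.remove) auto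
  also have "(\<Sum>j\<in>{0..n} - {i}. Q n i j * f j) = (\<Sum>j\<in>{0..n} - {i}. jump_prob l r b n i j * f j)"
    by (intro sum.cong) (auto simp: transition_matrix_def)
  also have "Q n i i = 1 - rate n i"
    by (simp add: transition_matrix_def sum_jump_prob_eq_rate[OF assms])
  finally have "step_op n f i - f i = (\<Sum>j\<in>{0..n} - {i}. jump_prob l r b n i j * f j) - rate n i * f i"
    by (simp add: algebra_simps)
  then show ?thesis unfolding sum_jump_prob[OF assms] by (auto simp: algebra_simps)
qed

lemma transition_matrix_nonneg: "n \<ge> 2 \<Longrightarrow> i \<le> n \<Longrightarrow> 0 \<le> Q n i j"
  using rate_bounds[of n i] jump_prob_nonneg[of n i j]
  by (auto simp: transition_matrix_def sum_jump_prob_eq_rate)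

lemma sum_transition_matrix: "n \<ge> 2 \<Longrightarrow> i \<le> n \<Longrightarrow> (\<Sum>j\<in>{0..n}. Q n i j) = 1"
  using step_op_eq[of n i "\<lambda>_. 1"] by (simp add: step_op_def split: if_splits)

lemma step_op_contraction:
  assumes n: "n \<ge> 2" and i: "i \<le> n" and le: "\<And>j. j \<le> n \<Longrightarrow> \<bar>f j - g j\<bar> \<le> c"
  shows "\<bar>step_op n f i - step_op n g i\<bar> \<le> c"
proof -
  have "step_op n f i - step_op n g i = (\<Sum>j\<in>{0..n}. Q n i j * (f j - g j))"
    by (simp add: step_op_def right_diff_distrib sum_subtractf)
  also have "\<bar>\<dots>\<bar> \<le> (\<Sum>j\<in>{0..n}. Q n i j * c)"
    using transition_matrix_nonneg[OF n i] le
    by (intro order_trans[OF sum_abs] sum_mono) (auto simp: abs_mult intro!: mult_left_mono)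
  also have "\<dots> = c" by (simp add: sum_transition_matrix[OF n i] flip: sum_distrib_right)
  finally show ?thesis .
qed

lemma step_op_pow_contraction:
  assumes n: "n \<ge> 2" and i: "i \<le> n" and le: "\<And>j. j \<le> n \<Longrightarrow> \<bar>f j - g j\<bar> \<le> c"
  shows "\<bar>(step_op n ^^ k) f i - (step_op n ^^ k) g i\<bar> \<le> c"
  using i by (induction k arbitrary: i) (auto intro!: le step_op_contraction[OF n])

text \<open>In the interior the first-order terms of the two neighbours cancel. At an end point
  there is one neighbour and nothing to cancel with; a first-order term of the size of the mesh
  would dominate the time step, which is of the order of its square. There the vanishing of F is
  decisive.\<close>

lemma step_op_consistency:
  assumes fg: "(f, g) \<in> generator l r P" and n: "n \<ge> 2" and i: "i \<le> n"
    and le: "\<And>x y. x \<in> {l..r} \<Longrightarrow> y \<in> {l..r} \<Longrightarrow> \<bar>x - y\<bar> \<le> mesh l r n \<Longrightarrow>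
      \<bar>2 / b x * g x - 2 / b y * g y\<bar> \<le> \<epsilon>"
  shows "\<bar>step_op n (\<lambda>j. f (grid l r n j)) i - f (grid l r n i) - \<tau> n * g (grid l r n i)\<bar>
    \<le> \<tau> n * (sup_b * \<epsilon>)"
proof -
  from fg have "(f, g) \<in> reflecting_operator l r b" by (simp add: generator_eq)
  then obtain F where F0: "F l = 0" "F r = 0" and
    tay: "\<And>x y \<epsilon>. x \<in> {l..r} \<Longrightarrow> y \<in> {l..r} \<Longrightarrow>
      (\<And>z. z \<in> {l..r} \<Longrightarrow> \<bar>z - x\<bar> \<le> \<bar>y - x\<bar> \<Longrightarrow> \<bar>2 / b z * g z - 2 / b x * g x\<bar> \<le> \<epsilon>) \<Longrightarrow>
      \<bar>f y - f x - F x * (y - x) - g x / b x * (y - x)\<^sup>2\<bar> \<le> \<epsilon> * (y - x)\<^sup>2"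
    using reflecting_taylor by blast
  define \<Delta> where "\<Delta> = mesh l r n"
  define q where "q = rate n i"
  let ?x = "grid l r n i"
  have \<Delta>: "\<Delta> > 0" using mesh_pos[of n] n by (simp add: \<Delta>_def)
  have q: "q > 0" using rate_bounds[of n i] n i by (simp add: q_def)
  have x: "?x \<in> {l..r}" using grid_mem[of n i] n i by simp
  have bx: "b ?x > 0" by (rule b_pos[OF x])
  have qd: "q * \<Delta>\<^sup>2 = b ?x * \<tau> n"
    using rate_mult_mesh[of n i] n by (simp add: \<Delta>_def q_def)
  have "\<epsilon> \<ge> 0" using le[OF x x] \<Delta> by (simp add: \<Delta>_def)
  have up: "\<bar>f (?x + d) - f ?x - F ?x * d - g ?x / b ?x * \<Delta>\<^sup>2\<bar> \<le> \<epsilon> * \<Delta>\<^sup>2"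
    if "?x + d \<in> {l..r}" "\<bar>d\<bar> = \<Delta>" for d
  proof -
    have "d\<^sup>2 = \<Delta>\<^sup>2" using that(2) by (metis power2_abs)
    then show ?thesis
      using tay[OF x that(1), of \<epsilon>] le[OF _ x] that(2) by (simp add: \<Delta>_def)
  qed
  \<comment> \<open>All three cases lead to this form; q * \<Delta>^2 = b * \<open>\<tau> n\<close>
    turns its leading part into exactly \<open>\<tau> n\<close> * g.\<close>
  have main: "\<bar>q * (g ?x / b ?x * \<Delta>\<^sup>2 + e) - \<tau> n * g ?x\<bar> \<le> \<tau> n * (sup_b * \<epsilon>)"
    if e: "\<bar>e\<bar> \<le> \<epsilon> * \<Delta>\<^sup>2" for e
  proof -
    have "q * (g ?x / b ?x * \<Delta>\<^sup>2) = (q * \<Delta>\<^sup>2) * g ?x / b ?x" by simp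
    also have "\<dots> = \<tau> n * g ?x" unfolding qd using bx by simp
    finally have "q * (g ?x / b ?x * \<Delta>\<^sup>2 + e) - \<tau> n * g ?x = q * e"
      by (simp add: distrib_left)
    also have "\<bar>q * e\<bar> \<le> q * (\<epsilon> * \<Delta>\<^sup>2)" using q e by (simp add: abs_mult)
    also have "\<dots> = (b ?x * \<epsilon>) * \<tau> n" using qd by (simp add: algebra_simps)
    also have "\<dots> \<le> (sup_b * \<epsilon>) * \<tau> n"
      using b_le_sup[OF x] \<open>\<epsilon> \<ge> 0\<close> time_step_pos[of n] n by (intro mult_right_mono) auto
    finally show ?thesis by (simp add: mult.commute)
  qed
  let ?f = "\<lambda>j. f (grid l r n j)"
  consider "i = 0" | "i = n" | "0 < i" "i < n" using i by linarith
  then show ?thesis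
  proof cases
    case 1
    have g1: "grid l r n 1 = ?x + \<Delta>" using grid_Suc[of n 0] 1 by (simp add: \<Delta>_def)
    have "?x + \<Delta> \<in> {l..r}" using grid_mem[of n 1] n g1 by simp
    then have e: "\<bar>f (?x + \<Delta>) - f ?x - g ?x / b ?x * \<Delta>\<^sup>2\<bar> \<le> \<epsilon> * \<Delta>\<^sup>2"
      using up[of \<Delta>] \<Delta> F0 1 by simp
    have "step_op n ?f i - f ?x = q * (f (?x + \<Delta>) - f ?x)"
      using step_op_eq[OF n i, of ?f] 1 g1 by (simp add: q_def)
    then show ?thesis using main[OF e] by simp
  next
    case 2
    have g1: "grid l r n (n - 1) = ?x - \<Delta>" using grid_Suc[of n "n - 1"] 2 n by (simp add: \<Delta>_def)
    have "?x - \<Delta> \<in> {l..r}" using grid_mem[of n "n - 1"] n g1 by simp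
    then have e: "\<bar>f (?x - \<Delta>) - f ?x - g ?x / b ?x * \<Delta>\<^sup>2\<bar> \<le> \<epsilon> * \<Delta>\<^sup>2"
      using up[of "- \<Delta>"] \<Delta> F0 2 n by simp
    have "step_op n ?f i - f ?x = q * (f (?x - \<Delta>) - f ?x)"
      using step_op_eq[OF n i, of ?f] 2 n g1 by (simp add: q_def)
    then show ?thesis using main[OF e] by simp
  next
    case 3
    have g1: "grid l r n (i - 1) = ?x - \<Delta>" using grid_Suc[of n "i - 1"] 3 by (simp add: \<Delta>_def)
    have g2: "grid l r n (i + 1) = ?x + \<Delta>" using grid_Suc[of n i] by (simp add: \<Delta>_def)
    have "?x - \<Delta> \<in> {l..r}" using grid_mem[of n "i - 1"] n i g1 by simp
    from up[OF this[unfolded diff_conv_add_uminus]] \<Delta>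
    have dn: "\<bar>f (?x - \<Delta>) - f ?x + F ?x * \<Delta> - g ?x / b ?x * \<Delta>\<^sup>2\<bar> \<le> \<epsilon> * \<Delta>\<^sup>2" by simp
    have "?x + \<Delta> \<in> {l..r}" using grid_mem[of n "i + 1"] n 3 g2 by simp
    from up[OF this] \<Delta>
    have "\<bar>f (?x + \<Delta>) - f ?x - F ?x * \<Delta> - g ?x / b ?x * \<Delta>\<^sup>2\<bar> \<le> \<epsilon> * \<Delta>\<^sup>2" by simp
    note up = this
    have average: "\<bar>(u + v) / 2\<bar> \<le> c" if "\<bar>u\<bar> \<le> c" "\<bar>v\<bar> \<le> c" for u v c :: real
      using that by (simp add: abs_le_iff)
    note average[OF up dn]
    moreover define e where "e = (f (?x + \<Delta>) + f (?x - \<Delta>) - 2 * f ?x) / 2 - g ?x / b ?x * \<Delta>\<^sup>2"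
    ultimately have e: "\<bar>e\<bar> \<le> \<epsilon> * \<Delta>\<^sup>2" by (simp add: field_simps)
    have "step_op n ?f i - f ?x = q * (g ?x / b ?x * \<Delta>\<^sup>2 + e)"
      using step_op_eq[OF n i, of ?f] 3 g1 g2 by (simp add: q_def e_def)
    then show ?thesis using main[OF e] by simp
  qed
qed

text \<open>Consistency plus stability: each step compares one application of the matrix to T_s f
  with T_(s+h) f, and contraction of the matrix does not amplify errors made before. Consistency has
  to be uniform over the orbit up to time S.\<close>

lemma step_op_pow_generator:
  assumes fg: "(f, g) \<in> generator l r P" and S: "S \<ge> 0" and e: "\<epsilon> > 0"
  shows "\<forall>\<^sub>F n in sequentially. \<forall>k i. real k * \<tau> n \<le> S \<longrightarrow> i \<le> n \<longrightarrow>
    \<bar>(step_op n ^^ k) (\<lambda>j. f (grid l r n j)) i - T (real k * \<tau> n) f (grid l r n i)\<bar> \<le> \<epsilon>"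
proof -
  have f: "continuous_on {l..r} f" and g: "continuous_on {l..r} g" using fg by (auto simp: generator_def)
  \<comment> \<open>There are at most S / h steps, each contributing h * (sup_b * c + c); the sum is
    at most \<epsilon>.\<close>
  define c where "c = \<epsilon> / ((S + 1) * (sup_b + 1))"
  have c: "c > 0" using e S sup_b_pos by (simp add: c_def)
  have "continuous_on {l..r} (\<lambda>x. 2 / b x)"
    using b_pos by (intro continuous_intros continuous_b) fastforce
  then obtain \<eta> where \<eta>: "\<eta> > 0"
    "\<And>s x y. 0 \<le> s \<Longrightarrow> s \<le> S \<Longrightarrow> x \<in> {l..r} \<Longrightarrow> y \<in> {l..r} \<Longrightarrow> \<bar>x - y\<bar> < \<eta> \<Longrightarrow>
      \<bar>2 / b x * T s g x - 2 / b y * T s g y\<bar> \<le> c"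
    using equicontinuous_orbit[OF g _ c] by blast
  obtain \<delta> where \<delta>: "\<delta> > 0" "\<And>t x. 0 \<le> t \<Longrightarrow> t \<le> \<delta> \<Longrightarrow> x \<in> {l..r} \<Longrightarrow> \<bar>T t g x - g x\<bar> \<le> c"
    using strong_continuity[OF g c] by blast
  have "\<forall>\<^sub>F n in sequentially. mesh l r n < \<eta>"
    by (rule order_tendstoD(2)[OF mesh_tendsto_0 \<eta>(1)])
  moreover have "\<forall>\<^sub>F n in sequentially. \<tau> n < \<delta>"
    by (rule order_tendstoD(2)[OF time_step_tendsto_0 \<delta>(1)])
  moreover have "\<forall>\<^sub>F n in sequentially. n \<ge> (2::nat)" by (rule eventually_ge_at_top)
  ultimately show ?thesis
  proof eventually_elim
    case (elim n)
    define h where "h = \<tau> n"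
    have h: "0 < h" "h < \<delta>" using elim time_step_pos[of n] by (auto simp: h_def)
    let ?\<pi> = "\<lambda>u j. u (grid l r n j)"
    have "\<bar>(step_op n ^^ k) (?\<pi> f) i - T (real k * h) f (grid l r n i)\<bar> \<le> real k * h * (sup_b * c + c)"
      if "real k * h \<le> S" "i \<le> n" for k i
      using that
    proof (induction k arbitrary: i)
      case 0
      then show ?case using T_0[OF grid_mem f] elim by simp
    next
      case (Suc k)
      let ?s = "real k * h" and ?x = "grid l r n i"
      have s: "0 \<le> ?s" "?s \<le> S" using Suc.prems h by (auto simp: algebra_simps)
      have x: "?x \<in> {l..r}" using elim Suc.prems by (intro grid_mem) auto
      have gen: "(T ?s f, T ?s g) \<in> generator l r P" by (rule generator_T[OF fg s(1)])
      \<comment> \<open>Three errors: the inherited one, and the deviations of the discrete and of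
        the continuous step from the common increment h * T_s g.\<close>
      have 1: "\<bar>step_op n ((step_op n ^^ k) (?\<pi> f)) i - step_op n (?\<pi> (T ?s f)) i\<bar> \<le> ?s * (sup_b * c + c)"
        using Suc.IH s(2) elim Suc.prems by (intro step_op_contraction) auto
      have 2: "\<bar>step_op n (?\<pi> (T ?s f)) i - T ?s f ?x - h * T ?s g ?x\<bar> \<le> h * (sup_b * c)"
        unfolding h_def
        using s elim Suc.prems by (intro step_op_consistency[OF gen[unfolded h_def]] \<eta>(2)[unfolded h_def]) (auto simp: h_def)
      have 3: "\<bar>T h (T ?s f) ?x - T ?s f ?x - h * T ?s g ?x\<bar> \<le> h * c"
      proof (rule generator_increment[OF gen _ x])
        fix u y assume u: "0 \<le> u" "u \<le> h" and y: "y \<in> {l..r}"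
        have "T u (T ?s g) y = T (?s + u) g y"
          using T_add[OF y g u(1) s(1)] by (simp add: add.commute)
        moreover have "\<bar>T (?s + u) g y - T ?s g y\<bar> \<le> c"
          using u h s by (intro T_time_increment[OF g y] \<delta>(2)) auto
        ultimately show "\<bar>T u (T ?s g) y - T ?s g y\<bar> \<le> c" by simp
      qed (use h in simp)
      have "T (real (Suc k) * h) f ?x = T h (T ?s f) ?x"
        using T_add[OF x f, of h ?s] h s by (simp add: algebra_simps)
      then show ?case using 1 2 3 by (simp add: algebra_simps abs_le_iff)
    qed
    moreover have "real k * h * (sup_b * c + c) \<le> \<epsilon>" if "real k * h \<le> S" for k
    proof -
      have "real k * h * (sup_b * c + c) \<le> (S + 1) * (sup_b * c + c)"
        using that c sup_b_pos by (intro mult_right_mono) auto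
      also have "\<dots> = (S + 1) * (sup_b + 1) * c" by (simp add: algebra_simps)
      also have "\<dots> = \<epsilon>" using S sup_b_pos by (simp add: c_def)
      finally show ?thesis .
    qed
    ultimately show ?case unfolding h_def by (meson order_trans)
  qed
qed

text \<open>Functions on different state spaces are compared through restriction to the grid,
  uniformly over its points, as in approximation theorems of Trotter-Kurtz type.\<close>

definition grid_converges :: "(nat \<Rightarrow> nat \<Rightarrow> real) \<Rightarrow> (real \<Rightarrow> real) \<Rightarrow> bool" where
  "grid_converges u f \<longleftrightarrow> (\<forall>\<epsilon>>0. \<forall>\<^sub>F n in sequentially. \<forall>i\<le>n. \<bar>u n i - f (grid l r n i)\<bar> \<le> \<epsilon>)"

text \<open>Two kinds of slack are built in: the input is only close to f on the grid, since it will
  itself be the output of an earlier application, and the elapsed chain time is only close to s,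
  since it is rounded to whole steps.\<close>

lemma grid_converges_T:
  assumes u: "grid_converges u f" and f: "continuous_on {l..r} f" and s: "s \<ge> 0"
    and k: "(\<lambda>n. real (k n) * \<tau> n) \<longlonglongrightarrow> s"
  shows "grid_converges (\<lambda>n. (step_op n ^^ k n) (u n)) (T s f)"
  unfolding grid_converges_def
proof (intro allI impI)
  fix \<epsilon> :: real assume e: "\<epsilon> > 0"
  \<comment> \<open>Two fifths pay for replacing \<open>u n\<close> by F, one each for the discrete
    semigroup on F, for the return from F to f, and for the difference of the times.\<close>
  have e5: "\<epsilon> / 5 > 0" using e by simp
  obtain F G where FG: "(F, G) \<in> generator l r P" and ap: "\<And>x. x \<in> {l..r} \<Longrightarrow> \<bar>f x - F x\<bar> \<le> \<epsilon> / 5"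
    using generator_domain_dense[OF f e5] by blast
  have F: "continuous_on {l..r} F" using FG by (auto simp: generator_def)
  obtain \<delta> where \<delta>: "\<delta> > 0" "\<And>t x. 0 \<le> t \<Longrightarrow> t \<le> \<delta> \<Longrightarrow> x \<in> {l..r} \<Longrightarrow> \<bar>T t f x - f x\<bar> \<le> \<epsilon> / 5"
    using strong_continuity[OF f e5] by blast
  have "\<forall>\<^sub>F n in sequentially. \<forall>i\<le>n. \<bar>u n i - f (grid l r n i)\<bar> \<le> \<epsilon> / 5"
    using u e5 unfolding grid_converges_def by blast
  moreover have "\<forall>\<^sub>F n in sequentially. dist (real (k n) * \<tau> n) s < min \<delta> 1"
    using k \<delta>(1) by (intro tendstoD) auto
  moreover have "\<forall>\<^sub>F n in sequentially. \<forall>k i. real k * \<tau> n \<le> s + 1 \<longrightarrow> i \<le> n \<longrightarrow>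
    \<bar>(step_op n ^^ k) (\<lambda>j. F (grid l r n j)) i - T (real k * \<tau> n) F (grid l r n i)\<bar> \<le> \<epsilon> / 5"
    using s e5 by (intro step_op_pow_generator[OF FG]) auto
  moreover have "\<forall>\<^sub>F n in sequentially. n \<ge> (2::nat)" by (rule eventually_ge_at_top)
  ultimately show "\<forall>\<^sub>F n in sequentially. \<forall>i\<le>n. \<bar>(step_op n ^^ k n) (u n) i - T s f (grid l r n i)\<bar> \<le> \<epsilon>"
  proof eventually_elim
    case (elim n)
    show ?case
    proof (intro allI impI)
      fix i assume i: "i \<le> n"
      let ?x = "grid l r n i" and ?s = "real (k n) * \<tau> n"
      have x: "?x \<in> {l..r}" using elim i by (intro grid_mem) auto
      have s': "?s \<ge> 0" using time_step_pos[of n] elim by auto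
      have 1: "\<bar>(step_op n ^^ k n) (u n) i - (step_op n ^^ k n) (\<lambda>j. F (grid l r n j)) i\<bar> \<le> \<epsilon> / 5 + \<epsilon> / 5"
      proof (rule step_op_pow_contraction[OF _ i])
        fix j assume j: "j \<le> n"
        have "\<bar>f (grid l r n j) - F (grid l r n j)\<bar> \<le> \<epsilon> / 5" using elim j by (intro ap grid_mem) auto
        moreover have "\<bar>u n j - f (grid l r n j)\<bar> \<le> \<epsilon> / 5" using elim(1) j by blast
        ultimately show "\<bar>u n j - F (grid l r n j)\<bar> \<le> \<epsilon> / 5 + \<epsilon> / 5" by linarith
      qed (use elim in auto)
      have 2: "\<bar>(step_op n ^^ k n) (\<lambda>j. F (grid l r n j)) i - T ?s F ?x\<bar> \<le> \<epsilon> / 5"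
        using elim i by (auto simp: dist_real_def abs_less_iff)
      have 3: "\<bar>T ?s f ?x - T ?s F ?x\<bar> \<le> \<epsilon> / 5" by (rule T_contraction[OF x f F s' ap])
      have 4: "\<bar>T ?s f ?x - T s f ?x\<bar> \<le> \<epsilon> / 5"
      proof (cases "?s \<le> s")
        case True
        then have "\<bar>T s f ?x - T ?s f ?x\<bar> \<le> \<epsilon> / 5"
          using elim(2) s' by (intro T_time_increment[OF f x] \<delta>(2)) (auto simp: dist_real_def abs_less_iff)
        then show ?thesis by linarith
      next
        case False
        then show ?thesis
          using elim(2) s by (intro T_time_increment[OF f x] \<delta>(2)) (auto simp: dist_real_def abs_less_iff)
      qed
      from 1 2 3 4 show "\<bar>(step_op n ^^ k n) (u n) i - T s f ?x\<bar> \<le> \<epsilon>" by linarith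
    qed
  qed
qed

lemma grid_converges_mult:
  assumes f: "continuous_on {l..r} f" and u: "grid_converges u g" and g: "continuous_on {l..r} g"
  shows "grid_converges (\<lambda>n i. f (grid l r n i) * u n i) (\<lambda>x. f x * g x)"
  unfolding grid_converges_def
proof (intro allI impI)
  fix \<epsilon> :: real assume e: "\<epsilon> > 0"
  obtain B where B: "\<And>x. x \<in> {l..r} \<Longrightarrow> \<bar>f x\<bar> \<le> B"
    using continuous_on_interval_bounded[OF f] by blast
  have B0: "B \<ge> 0" using B[of l] l_less_r by auto
  have "\<forall>\<^sub>F n in sequentially. \<forall>i\<le>n. \<bar>u n i - g (grid l r n i)\<bar> \<le> \<epsilon> / (B + 1)"
    using u e B0 by (simp add: grid_converges_def)
  moreover have "\<forall>\<^sub>F n in sequentially. n \<ge> (1::nat)" by (rule eventually_ge_at_top)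
  ultimately show "\<forall>\<^sub>F n in sequentially. \<forall>i\<le>n. \<bar>f (grid l r n i) * u n i - f (grid l r n i) * g (grid l r n i)\<bar> \<le> \<epsilon>"
  proof eventually_elim
    case (elim n)
    show ?case
    proof (intro allI impI)
      fix i assume i: "i \<le> n"
      have "\<bar>f (grid l r n i)\<bar> * \<bar>u n i - g (grid l r n i)\<bar> \<le> (B + 1) * (\<epsilon> / (B + 1))"
        using elim i B[OF grid_mem[OF elim(2) i]] B0 by (intro mult_mono) auto
      also have "\<dots> = \<epsilon>" using B0 by simp
      finally show "\<bar>f (grid l r n i) * u n i - f (grid l r n i) * g (grid l r n i)\<bar> \<le> \<epsilon>"
        by (simp add: abs_mult flip: right_diff_distrib)
    qed
  qed
qed

end

subsection \<open>Finite Markov chains\<close>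

definition chain_op :: "'s set \<Rightarrow> ('s \<Rightarrow> 's \<Rightarrow> real) \<Rightarrow> ('s \<Rightarrow> real) \<Rightarrow> 's \<Rightarrow> real" where
  "chain_op E Q f i = (\<Sum>j\<in>E. Q i j * f j)"

text \<open>For monotone k this is the conditional expectation, given \<open>X (k 0)\<close> = i, of
  the product of the \<open>f j (X (k j))\<close> with j \<le> K, computed backwards from the last
  time; see \<open>expectation_product\<close>.\<close>

fun chain_product :: "'s set \<Rightarrow> ('s \<Rightarrow> 's \<Rightarrow> real) \<Rightarrow> nat \<Rightarrow> (nat \<Rightarrow> nat) \<Rightarrow> (nat \<Rightarrow> 's \<Rightarrow> real) \<Rightarrow> 's \<Rightarrow> real" where
  "chain_product E Q 0 k f i = f 0 i"
| "chain_product E Q (Suc K) k f i =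
     f 0 i * (chain_op E Q ^^ (k 1 - k 0)) (chain_product E Q K (\<lambda>j. k (Suc j)) (\<lambda>j. f (Suc j))) i"

text \<open>Plays the role of measurability with respect to the history up to time k. Over a finite
  state space such functionals are finite sums over cylinders, so no conditional expectations are
  required.\<close>

definition depends_upto :: "nat \<Rightarrow> ((nat \<Rightarrow> 's) \<Rightarrow> real) \<Rightarrow> bool" where
  "depends_upto k \<Phi> \<longleftrightarrow> (\<forall>p p'. (\<forall>m\<le>k. p m = p' m) \<longrightarrow> \<Phi> p = \<Phi> p')"

lemma depends_uptoD: "depends_upto k \<Phi> \<Longrightarrow> (\<And>m. m \<le> k \<Longrightarrow> p m = p' m) \<Longrightarrow> \<Phi> p = \<Phi> p'"
  by (simp add: depends_upto_def)

lemma depends_upto_mono: "depends_upto k \<Phi> \<Longrightarrow> k \<le> k' \<Longrightarrow> depends_upto k' \<Phi>"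
  unfolding depends_upto_def by auto

locale finite_chain =
  fixes M :: "'b measure" and E :: "'s set" and \<pi> :: "'s pmf" and Q :: "'s \<Rightarrow> 's \<Rightarrow> real"
    and X :: "nat \<Rightarrow> 'b \<Rightarrow> 's"
  assumes markov: "markov_chain M E \<pi> Q X" and finite_E: "finite E"
begin

abbreviation "traj \<omega> \<equiv> (\<lambda>m. X m \<omega>)"

sublocale prob_space M
  using markov unfolding markov_chain_def by blast

lemma measurable_X: "X k \<in> M \<rightarrow>\<^sub>M count_space E"
  using markov unfolding markov_chain_def by blast

lemma X_mem: "\<omega> \<in> space M \<Longrightarrow> X k \<omega> \<in> E"
  using measurable_space[OF measurable_X[of k], of \<omega>] unfolding space_count_space .

definition cylinder :: "nat \<Rightarrow> (nat \<Rightarrow> 's) \<Rightarrow> 'b set" where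
  "cylinder k p = {\<omega>\<in>space M. \<forall>m\<le>k. X m \<omega> = p m}"

lemma X_eq_sets: "{\<omega>\<in>space M. X k \<omega> = y} \<in> sets M"
proof -
  have "X k -` ({y} \<inter> E) \<inter> space M \<in> sets M"
    by (rule measurable_sets[OF measurable_X]) simp
  moreover have "X k -` ({y} \<inter> E) \<inter> space M = {\<omega>\<in>space M. X k \<omega> = y}"
    using X_mem by blast
  ultimately show ?thesis by simp
qed

lemma cylinder_sets: "cylinder k p \<in> sets M"
proof -
  have "{\<omega>\<in>space M. \<forall>m\<in>{..k}. X m \<omega> = p m} \<in> sets M"
    by (rule sets.sets_Collect_finite_All) (simp_all add: X_eq_sets)
  moreover have "{\<omega>\<in>space M. \<forall>m\<in>{..k}. X m \<omega> = p m} = cylinder k p"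
    unfolding cylinder_def by blast
  ultimately show ?thesis by simp
qed

abbreviation paths :: "nat \<Rightarrow> (nat \<Rightarrow> 's) set" where
  "paths k \<equiv> PiE {..k} (\<lambda>_. E)"

lemma finite_paths: "finite (paths k)"
  by (intro finite_PiE finite_E) auto

text \<open>Among the extensional paths on {..k}, exactly one, the restricted trajectory, has a
  cylinder containing \<omega>.\<close>

lemma functional_eq_sum:
  assumes d: "depends_upto k \<Phi>" and w: "\<omega> \<in> space M"
  shows "\<Phi> (traj \<omega>) = (\<Sum>p\<in>paths k. \<Phi> p * indicator (cylinder k p) \<omega>)"
proof -
  let ?p = "restrict (traj \<omega>) {..k}"
  have p: "?p \<in> paths k" using X_mem[OF w] by auto
  have "(\<Sum>p\<in>paths k. \<Phi> p * indicator (cylinder k p) \<omega>) = (\<Sum>p\<in>{?p}. \<Phi> p * indicator (cylinder k p) \<omega>)"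
  proof (rule sum.mono_neutral_right[OF finite_paths])
    show "\<forall>p\<in>paths k - {?p}. \<Phi> p * indicator (cylinder k p) \<omega> = 0"
    proof
      fix p assume p: "p \<in> paths k - {?p}"
      have "\<omega> \<notin> cylinder k p"
      proof
        assume "\<omega> \<in> cylinder k p"
        then have "p = ?p" using p by (intro PiE_ext[of p "{..k}" "\<lambda>_. E" ?p]) (auto simp: cylinder_def X_mem w)
        with p show False by simp
      qed
      then show "\<Phi> p * indicator (cylinder k p) \<omega> = 0" by simp
    qed
  qed (use p in auto)
  also have "\<dots> = \<Phi> ?p" using w by (simp add: cylinder_def)
  also have "\<dots> = \<Phi> (traj \<omega>)" by (rule depends_uptoD[OF d]) simp
  finally show ?thesis ..
qed

lemma functional_measurable:
  assumes "depends_upto k \<Phi>"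
  shows "(\<lambda>\<omega>. \<Phi> (traj \<omega>)) \<in> borel_measurable M"
proof -
  have "(\<lambda>\<omega>. \<Sum>p\<in>paths k. \<Phi> p * indicator (cylinder k p) \<omega>) \<in> borel_measurable M"
    using cylinder_sets by measurable
  then show ?thesis using functional_eq_sum[OF assms] by (simp cong: measurable_cong)
qed

lemma functional_integrable:
  assumes d: "depends_upto k \<Phi>"
  shows "integrable M (\<lambda>\<omega>. \<Phi> (traj \<omega>))"
proof -
  have "integrable M (\<lambda>\<omega>. \<Sum>p\<in>paths k. \<Phi> p * indicator (cylinder k p) \<omega>)"
    using cylinder_sets by (intro Bochner_Integration.integrable_sum integrable_mult_right integrable_real_indicator)
      (auto simp: emeasure_eq_measure)
  then show ?thesis
    using functional_eq_sum[OF d] by (simp cong: Bochner_Integration.integrable_cong)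
qed

lemma expectation_functional:
  assumes d: "depends_upto k \<Phi>"
  shows "expectation (\<lambda>\<omega>. \<Phi> (traj \<omega>)) = (\<Sum>p\<in>paths k. \<Phi> p * measure M (cylinder k p))"
proof -
  have "expectation (\<lambda>\<omega>. \<Phi> (traj \<omega>)) = expectation (\<lambda>\<omega>. \<Sum>p\<in>paths k. \<Phi> p * indicator (cylinder k p) \<omega>)"
    using functional_eq_sum[OF d] by (intro Bochner_Integration.integral_cong) auto
  also have "\<dots> = (\<Sum>p\<in>paths k. expectation (\<lambda>\<omega>. \<Phi> p * indicator (cylinder k p) \<omega>))"
    by (rule Bochner_Integration.integral_sum)
      (simp add: integrable_real_indicator cylinder_sets emeasure_eq_measure)
  also have "\<dots> = (\<Sum>p\<in>paths k. \<Phi> p * measure M (cylinder k p))"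
  proof (intro sum.cong refl)
    fix p
    have "cylinder k p \<inter> space M = cylinder k p" unfolding cylinder_def by blast
    then show "expectation (\<lambda>\<omega>. \<Phi> p * indicator (cylinder k p) \<omega>) = \<Phi> p * measure M (cylinder k p)"
      by simp
  qed
  finally show ?thesis .
qed

text \<open>The Markov property in integrated form. Both sides are sums over cylinders, and a path
  up to time k + 1 is a path up to time k together with a last state j.\<close>

lemma one_step:
  assumes d: "depends_upto (Suc k) \<Phi>"
  shows "expectation (\<lambda>\<omega>. \<Phi> (traj \<omega>))
    = expectation (\<lambda>\<omega>. \<Sum>j\<in>E. Q (X k \<omega>) j * \<Phi> ((traj \<omega>)(Suc k := j)))"
proof -
  let ?\<Psi> = "\<lambda>p. \<Sum>j\<in>E. Q (p k) j * \<Phi> (p(Suc k := j))"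
  have dPsi: "depends_upto k ?\<Psi>"
    unfolding depends_upto_def
  proof (intro allI impI sum.cong refl)
    fix p p' :: "nat \<Rightarrow> 's" and j assume eq: "\<forall>m\<le>k. p m = p' m"
    have "\<Phi> (p(Suc k := j)) = \<Phi> (p'(Suc k := j))" by (rule depends_uptoD[OF d]) (use eq in auto)
    then show "Q (p k) j * \<Phi> (p(Suc k := j)) = Q (p' k) j * \<Phi> (p'(Suc k := j))" using eq by simp
  qed
  have cyl: "measure M (cylinder (Suc k) p) = measure M (cylinder k p) * Q (p k) (p (Suc k))"
    if "p \<in> paths (Suc k)" for p
  proof -
    have "\<forall>m\<le>Suc k. p m \<in> E" using that by (auto simp: PiE_iff)
    then show ?thesis using markov unfolding markov_chain_def cylinder_def by blast
  qed
  have ins: "{..Suc k} = insert (Suc k) {..k}" by auto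
  have inj: "inj_on (\<lambda>(y, g). g(Suc k := y)) (E \<times> paths k)"
    using inj_combinator[of "Suc k" "{..k}" "\<lambda>_. E"] by simp
  have cyl_upd: "cylinder k (p(Suc k := j)) = cylinder k p" for p j
    unfolding cylinder_def by auto
  have "expectation (\<lambda>\<omega>. \<Phi> (traj \<omega>)) = (\<Sum>p\<in>paths (Suc k). \<Phi> p * measure M (cylinder (Suc k) p))"
    by (rule expectation_functional[OF d])
  also have "\<dots> = (\<Sum>p\<in>paths (Suc k). \<Phi> p * (measure M (cylinder k p) * Q (p k) (p (Suc k))))"
    by (intro sum.cong refl) (simp add: cyl)
  also have "\<dots> = (\<Sum>(j, p)\<in>E \<times> paths k. \<Phi> (p(Suc k := j)) * (measure M (cylinder k p) * Q (p k) j))"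
    unfolding ins PiE_insert_eq by (subst sum.reindex[OF inj]) (auto simp: cyl_upd intro!: sum.cong)
  also have "\<dots> = (\<Sum>p\<in>paths k. \<Sum>j\<in>E. \<Phi> (p(Suc k := j)) * (measure M (cylinder k p) * Q (p k) j))"
    by (subst sum.swap) (simp add: sum.cartesian_product)
  also have "\<dots> = (\<Sum>p\<in>paths k. ?\<Psi> p * measure M (cylinder k p))"
    unfolding sum_distrib_right by (intro sum.cong refl) (simp add: mult_ac)
  also have "\<dots> = expectation (\<lambda>\<omega>. ?\<Psi> (traj \<omega>))"
    by (rule expectation_functional[OF dPsi, symmetric])
  finally show ?thesis .
qed

lemma multi_step:
  assumes d: "depends_upto k \<Phi>"
  shows "expectation (\<lambda>\<omega>. \<Phi> (traj \<omega>) * f (X (k + d) \<omega>))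
    = expectation (\<lambda>\<omega>. \<Phi> (traj \<omega>) * (chain_op E Q ^^ d) f (X k \<omega>))"
proof (induction d arbitrary: f)
  case 0
  then show ?case by simp
next
  case (Suc d)
  let ?\<Phi> = "\<lambda>p. \<Phi> p * f (p (Suc (k + d)))"
  have dep: "depends_upto (Suc (k + d)) ?\<Phi>"
    using depends_uptoD[OF depends_upto_mono[OF d, of "Suc (k + d)"]] unfolding depends_upto_def by fastforce
  have upd: "\<Phi> (p(Suc (k + d) := j)) = \<Phi> p" for p j by (rule depends_uptoD[OF d]) auto
  have "expectation (\<lambda>\<omega>. \<Phi> (traj \<omega>) * f (X (k + Suc d) \<omega>))
     = expectation (\<lambda>\<omega>. \<Phi> (traj \<omega>) * chain_op E Q f (X (k + d) \<omega>))"
    using one_step[OF dep] by (simp add: upd chain_op_def sum_distrib_left mult_ac)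
  also have "\<dots> = expectation (\<lambda>\<omega>. \<Phi> (traj \<omega>) * (chain_op E Q ^^ Suc d) f (X k \<omega>))"
    using Suc.IH[of "chain_op E Q f"] by (simp add: funpow_swap1)
  finally show ?case .
qed

text \<open>The history functional \<Phi> is there for the induction: it absorbs the factor at time
  k 0, the hypothesis handles the remaining times, and \<open>multi_step\<close> brings the result
  from time k 1 back to k 0.\<close>

lemma expectation_product:
  assumes "mono k" and "depends_upto (k 0) \<Phi>"
  shows "expectation (\<lambda>\<omega>. \<Phi> (traj \<omega>) * (\<Prod>i\<le>K. f i (X (k i) \<omega>)))
    = expectation (\<lambda>\<omega>. \<Phi> (traj \<omega>) * chain_product E Q K k f (X (k 0) \<omega>))"
  using assms
proof (induction K arbitrary: \<Phi> k f)
  case 0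
  then show ?case by simp
next
  case (Suc K)
  let ?\<Phi> = "\<lambda>p. \<Phi> p * f 0 (p (k 0))"
  have dep: "depends_upto (k 0) ?\<Phi>"
    using depends_uptoD[OF Suc.prems(2)] unfolding depends_upto_def by fastforce
  have le: "k 0 \<le> k 1" using Suc.prems(1) by (simp add: monoD)
  have mono: "mono (\<lambda>j. k (Suc j))" using Suc.prems(1) by (simp add: mono_def)
  let ?G = "chain_product E Q K (\<lambda>j. k (Suc j)) (\<lambda>j. f (Suc j))"
  have "expectation (\<lambda>\<omega>. \<Phi> (traj \<omega>) * (\<Prod>i\<le>Suc K. f i (X (k i) \<omega>)))
    = expectation (\<lambda>\<omega>. ?\<Phi> (traj \<omega>) * (\<Prod>i\<le>K. f (Suc i) (X (k (Suc i)) \<omega>)))"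
    by (simp add: prod.atMost_Suc_shift mult.assoc del: prod.atMost_Suc)
  also have "\<dots> = expectation (\<lambda>\<omega>. ?\<Phi> (traj \<omega>) * ?G (X (k (Suc 0)) \<omega>))"
    using le by (intro Suc.IH[OF mono] depends_upto_mono[OF dep]) auto
  also have "\<dots> = expectation (\<lambda>\<omega>. ?\<Phi> (traj \<omega>) * (chain_op E Q ^^ (k 1 - k 0)) ?G (X (k 0) \<omega>))"
    using multi_step[OF dep, of ?G "k 1 - k 0"] le by simp
  also have "\<dots> = expectation (\<lambda>\<omega>. \<Phi> (traj \<omega>) * chain_product E Q (Suc K) k f (X (k 0) \<omega>))"
    by (simp add: mult.assoc)
  finally show ?case .
qed

section \<open>A maximal inequality for the finite chain\<close>

lemma event_sets:
  assumes R: "\<And>p p'. (\<And>m. m \<le> k \<Longrightarrow> p m = p' m) \<Longrightarrow> R p = R p'"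
  shows "{\<omega>\<in>space M. R (traj \<omega>)} \<in> sets M"
proof -
  have "depends_upto k (\<lambda>p. of_bool (R p))"
    unfolding depends_upto_def
  proof (intro allI impI)
    fix p p' :: "nat \<Rightarrow> 's" assume "\<forall>m\<le>k. p m = p' m"
    then have "R p = R p'" by (intro R) blast
    then show "of_bool (R p) = (of_bool (R p') :: real)" by simp
  qed
  from functional_measurable[OF this]
  have "{\<omega>\<in>space M. (of_bool (R (traj \<omega>)) :: real) = 1} \<in> sets M" by measurable
  then show ?thesis by simp
qed

text \<open>Doob's argument: \<open>W d\<close> is the supermartingale \<open>\<rho>\<^sup>-\<^sup>k V (X j0) (X (j0 + k))\<close>, scaled by \<open>\<rho>\<^sup>N / a\<close> and
  replaced by \<open>1\<close> from the first passage of \<open>V\<close> above \<open>a\<close> on.\<close>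

lemma maximal_inequality:
  fixes V :: "'s \<Rightarrow> 's \<Rightarrow> real"
  assumes Q: "\<And>i j. i \<in> E \<Longrightarrow> j \<in> E \<Longrightarrow> Q i j \<ge> 0" "\<And>i. i \<in> E \<Longrightarrow> (\<Sum>j\<in>E. Q i j) = 1"
    and V: "\<And>z y. V z y \<ge> 0" "\<And>z. V z z = 1"
    and super: "\<And>z y. z \<in> E \<Longrightarrow> y \<in> E \<Longrightarrow> chain_op E Q (V z) y \<le> \<rho> * V z y"
    and \<rho>: "\<rho> \<ge> 1" and a: "a > 0"
  shows "measure M {\<omega>\<in>space M. \<exists>k\<le>N. V (X j0 \<omega>) (X (j0 + k) \<omega>) \<ge> a} \<le> \<rho> ^ N / a"
proof -
  define bad where "bad d p \<longleftrightarrow> (\<exists>k\<le>d. V (p j0) (p (j0 + k)) \<ge> a)" for d and p :: "nat \<Rightarrow> 's"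
  define W where "W d p = (if bad d p then 1 else \<rho> ^ (N - d) * V (p j0) (p (j0 + d)) / a)" for d p
  have dep: "depends_upto (j0 + d) (W d)" for d
    unfolding depends_upto_def
  proof (intro allI impI)
    fix p p' :: "nat \<Rightarrow> 's" assume eq: "\<forall>m\<le>j0 + d. p m = p' m"
    then have pp: "p j0 = p' j0" "\<And>k. k \<le> d \<Longrightarrow> p (j0 + k) = p' (j0 + k)" by auto
    then have "bad d p = bad d p'" by (simp add: bad_def cong: conj_cong)
    then show "W d p = W d p'" unfolding W_def using eq by simp
  qed
  have dec: "expectation (\<lambda>\<omega>. W (Suc d) (traj \<omega>)) \<le> expectation (\<lambda>\<omega>. W d (traj \<omega>))"
    if "d < N" for d
  proof -
    let ?\<Psi> = "\<lambda>p. \<Sum>j\<in>E. Q (p (j0 + d)) j * W (Suc d) (p(Suc (j0 + d) := j))"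
    have "depends_upto (j0 + d) ?\<Psi>"
      unfolding depends_upto_def
    proof (intro allI impI sum.cong refl)
      fix p p' :: "nat \<Rightarrow> 's" and j assume eq: "\<forall>m\<le>j0 + d. p m = p' m"
      have "W (Suc d) (p(Suc (j0 + d) := j)) = W (Suc d) (p'(Suc (j0 + d) := j))"
        by (rule depends_uptoD[OF dep[of "Suc d"]]) (use eq in auto)
      then show "Q (p (j0 + d)) j * W (Suc d) (p(Suc (j0 + d) := j)) = Q (p' (j0 + d)) j * W (Suc d) (p'(Suc (j0 + d) := j))"
        using eq by simp
    qed
    note int = functional_integrable[OF this]
    have le: "?\<Psi> p \<le> W d p" if p: "\<And>m. p m \<in> E" for p
    proof (cases "bad d p")
      case True
      have "bad (Suc d) (p(Suc (j0 + d) := j))" for j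
      proof -
        obtain k where k: "k \<le> d" "V (p j0) (p (j0 + k)) \<ge> a" using True unfolding bad_def by blast
        then have "V ((p(Suc (j0 + d) := j)) j0) ((p(Suc (j0 + d) := j)) (j0 + k)) \<ge> a" by simp
        with k(1) show ?thesis unfolding bad_def by (meson le_SucI)
      qed
      then show ?thesis using True Q(2)[OF p] by (simp add: W_def)
    next
      case False
      then have Wd: "W d p = \<rho> ^ (N - d) * V (p j0) (p (j0 + d)) / a" by (simp add: W_def)
      \<comment> \<open>If the first passage occurs just now, then V \<ge> a and \<rho> \<ge> 1 make
        the right side at least 1; so the unstopped expression dominates in either case.\<close>
      have "W (Suc d) (p(Suc (j0 + d) := j)) \<le> \<rho> ^ (N - Suc d) * V (p j0) j / a" for j
      proof (cases "bad (Suc d) (p(Suc (j0 + d) := j))")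
        case True
        then obtain k where k: "k \<le> Suc d" "V ((p(Suc (j0 + d) := j)) j0) ((p(Suc (j0 + d) := j)) (j0 + k)) \<ge> a"
          unfolding bad_def by blast
        have "k = Suc d"
        proof (rule ccontr)
          assume "k \<noteq> Suc d"
          then have "k \<le> d" "V (p j0) (p (j0 + k)) \<ge> a" using k by auto
          then show False using False unfolding bad_def by blast
        qed
        then have "1 \<le> V (p j0) j / a" using k a by simp
        moreover have "1 \<le> \<rho> ^ (N - Suc d)" using \<rho> by simp
        ultimately have "1 * 1 \<le> \<rho> ^ (N - Suc d) * (V (p j0) j / a)" by (intro mult_mono) auto
        then show ?thesis using True by (simp add: W_def)
      next
        case False
        then show ?thesis by (simp add: W_def)
      qed
      then have "?\<Psi> p \<le> (\<Sum>j\<in>E. Q (p (j0 + d)) j * (\<rho> ^ (N - Suc d) * V (p j0) j / a))"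
        using Q(1) p by (intro sum_mono mult_left_mono) auto
      also have "\<dots> = \<rho> ^ (N - Suc d) / a * chain_op E Q (V (p j0)) (p (j0 + d))"
        by (simp add: chain_op_def sum_distrib_left algebra_simps)
      also have "\<dots> \<le> \<rho> ^ (N - Suc d) / a * (\<rho> * V (p j0) (p (j0 + d)))"
        using \<rho> a p by (intro mult_left_mono super) auto
      also have "\<dots> = \<rho> ^ (Suc (N - Suc d)) * V (p j0) (p (j0 + d)) / a" by simp
      also have "Suc (N - Suc d) = N - d" using \<open>d < N\<close> by simp
      finally show ?thesis unfolding Wd .
    qed
    have "expectation (\<lambda>\<omega>. W (Suc d) (traj \<omega>)) = expectation (\<lambda>\<omega>. ?\<Psi> (traj \<omega>))"
      using one_step[of "j0 + d" "W (Suc d)"] dep[of "Suc d"] by simp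
    also have "\<dots> \<le> expectation (\<lambda>\<omega>. W d (traj \<omega>))"
      by (rule integral_mono[OF int functional_integrable[OF dep] le]) (rule X_mem)
    finally show ?thesis .
  qed
  have "expectation (\<lambda>\<omega>. W d (traj \<omega>)) \<le> expectation (\<lambda>\<omega>. W 0 (traj \<omega>))" if "d \<le> N" for d
    using that
  proof (induction d)
    case (Suc d)
    then show ?case using dec[of d] by simp
  qed simp
  then have "expectation (\<lambda>\<omega>. W N (traj \<omega>)) \<le> expectation (\<lambda>\<omega>. W 0 (traj \<omega>))" by blast
  also have "\<dots> \<le> expectation (\<lambda>\<omega>. \<rho> ^ N / a)"
  proof (rule integral_mono[OF functional_integrable[OF dep] integrable_const])
    fix \<omega>
    \<comment> \<open>Because V z z = 1, a passage at time 0 means a \<le> 1.\<close>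
    have "1 \<le> \<rho> ^ N" using \<rho> by simp
    then have "1 \<le> \<rho> ^ N / a" if "a \<le> 1" using that a by (simp add: field_simps)
    then show "W 0 (traj \<omega>) \<le> \<rho> ^ N / a" by (auto simp: W_def bad_def V(2))
  qed
  also have "\<dots> = \<rho> ^ N / a" by (simp add: prob_space)
  finally have upper: "expectation (\<lambda>\<omega>. W N (traj \<omega>)) \<le> \<rho> ^ N / a" .
  have "depends_upto (j0 + N) (\<lambda>p. of_bool (bad N p))"
    unfolding depends_upto_def
  proof (intro allI impI)
    fix p p' :: "nat \<Rightarrow> 's" assume eq: "\<forall>m\<le>j0 + N. p m = p' m"
    then have pp: "p j0 = p' j0" "\<And>k. k \<le> N \<Longrightarrow> p (j0 + k) = p' (j0 + k)" by auto
    then have "bad N p = bad N p'" by (simp add: bad_def cong: conj_cong)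
    then show "of_bool (bad N p) = (of_bool (bad N p') :: real)" by simp
  qed
  note ind = functional_integrable[OF this]
  have S: "{\<omega>\<in>space M. bad N (traj \<omega>)} \<in> sets M"
    by (rule event_sets[of "j0 + N"]) (simp add: bad_def cong: conj_cong)
  have "measure M {\<omega>\<in>space M. bad N (traj \<omega>)} = expectation (indicator {\<omega>\<in>space M. bad N (traj \<omega>)})"
    using S by (simp add: Int_absorb2 subset_iff)
  also have "\<dots> = expectation (\<lambda>\<omega>. of_bool (bad N (traj \<omega>)))"
    by (intro Bochner_Integration.integral_cong) (auto simp: indicator_def)
  also have "\<dots> \<le> expectation (\<lambda>\<omega>. W N (traj \<omega>))"
    using \<rho> a V(1) by (intro integral_mono[OF ind functional_integrable[OF dep]]) (auto simp: W_def)
  finally show ?thesis using upper by (simp add: bad_def)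
qed

end

subsection \<open>Oscillation of the chains and finite-dimensional distributions\<close>

lemma exp_le_quadratic:
  assumes "\<bar>x\<bar> \<le> (1::real)"
  shows "exp x \<le> 1 + x + x\<^sup>2"
proof (cases "x \<ge> 0")
  case True
  then show ?thesis using exp_bound[of x] assms by simp
next
  case False
  define y where "y = - x"
  have y: "y > 0" using False by (simp add: y_def)
  have "exp x = 1 / exp y" by (simp add: y_def exp_minus inverse_eq_divide)
  also have "\<dots> \<le> 1 / (1 + y)" using y exp_ge_add_one_self[of y] by (intro divide_left_mono) auto
  also have "\<dots> \<le> 1 - y + y\<^sup>2"
  proof -
    have "(1 - y + y\<^sup>2) * (1 + y) = 1 + y ^ 3" by (simp add: algebra_simps power2_eq_square power3_eq_cube)
    then have "1 \<le> (1 - y + y\<^sup>2) * (1 + y)" using y by simp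
    then show ?thesis using y by (simp add: divide_le_eq)
  qed
  finally show ?thesis by (simp add: y_def)
qed

lemma one_minus_cos_le: "1 - cos x \<le> x\<^sup>2 / (2::real)"
proof -
  have "1 - cos x = 2 * (sin (x / 2))\<^sup>2" using cos_double_sin[of "x / 2"] by simp
  also have "(sin (x / 2))\<^sup>2 \<le> (x / 2)\<^sup>2"
    using abs_sin_x_le_abs_x[of "x / 2"] by (metis abs_le_square_iff)
  finally show ?thesis by (simp add: power2_eq_square)
qed

lemma abs_cos_diff_le: "\<bar>cos x - cos y\<bar> \<le> \<bar>x - y :: real\<bar>"
proof -
  have "\<bar>cos x - cos y\<bar> = 2 * \<bar>sin ((x + y) / 2)\<bar> * \<bar>sin ((y - x) / 2)\<bar>"
    by (simp add: cos_diff_cos abs_mult)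
  also have "\<dots> \<le> 2 * 1 * \<bar>(y - x) / 2\<bar>"
    by (intro mult_mono abs_sin_x_le_abs_x) auto
  finally show ?thesis by simp
qed

context reflecting_diffusion
begin

definition cos_coord :: "nat \<Rightarrow> nat \<Rightarrow> real" where
  "cos_coord n i = cos (real i * (pi / real n))"

text \<open>Converts angle into time: the squared angular step (pi / n)^2 is this constant times the
  time step, see \<open>angle_sq\<close>.\<close>

definition drift_const :: real where
  "drift_const = 2 * pi\<^sup>2 * sup_b / (r - l)\<^sup>2"

lemma drift_const_pos: "drift_const > 0"
  using sup_b_pos l_less_r by (simp add: drift_const_def)

lemma angle_sq: "n \<ge> 1 \<Longrightarrow> (pi / real n)\<^sup>2 = drift_const * \<tau> n"
  using l_less_r sup_b_pos
  by (simp add: drift_const_def time_step_def mesh_def sup_b_def[symmetric] power_divide field_simps)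

text \<open>In the coordinate \<open>cos (pi (y - l) / (r - l))\<close> reflection is unfolded: the mean increment of the
  chain is \<open>rate n i * (cos (pi / n) - 1)\<close> times the current value, also at the end points.\<close>

lemma step_op_exp_cos_coord:
  assumes n: "n \<ge> 2" and i: "i \<le> n" and \<gamma>: "\<bar>\<gamma>\<bar> * (pi / real n) \<le> 1"
  shows "step_op n (\<lambda>j. exp (\<gamma> * cos_coord n j)) i
    \<le> exp (drift_const * (\<bar>\<gamma>\<bar> + \<gamma>\<^sup>2) * \<tau> n) * exp (\<gamma> * cos_coord n i)"
proof -
  define \<theta> where "\<theta> = pi / real n"
  define q where "q = rate n i"
  let ?c = "cos_coord n"
  have \<theta>: "\<theta> > 0" using n by (simp add: \<theta>_def)
  have q: "0 < q" "q \<le> 1 / 2" using rate_bounds[of n i] n i by (auto simp: q_def)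
  have lam: "\<bar>\<gamma>\<bar> * \<theta> \<le> 1" using \<gamma> by (simp add: \<theta>_def)
  have c_eq: "?c j = cos (real j * \<theta>)" for j by (simp add: cos_coord_def \<theta>_def)
  \<comment> \<open>One step moves the angle by at most \<theta>, hence the cosine by at most
    \<theta>; with |\<gamma>| \<theta> \<le> 1 the quadratic bound on exp applies.\<close>
  have inc: "exp (\<gamma> * ?c j) - exp (\<gamma> * ?c i) \<le> exp (\<gamma> * ?c i) * (\<gamma> * (?c j - ?c i) + \<gamma>\<^sup>2 * \<theta>\<^sup>2)"
    if j: "\<bar>real j - real i\<bar> \<le> 1" for j
  proof -
    have "\<bar>?c j - ?c i\<bar> \<le> \<bar>(real j - real i) * \<theta>\<bar>"
      unfolding c_eq using abs_cos_diff_le[of "real j * \<theta>" "real i * \<theta>"] by (simp add: left_diff_distrib)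
    also have "\<dots> \<le> 1 * \<theta>" using j \<theta> by (simp add: abs_mult)
    finally have d: "\<bar>?c j - ?c i\<bar> \<le> \<theta>" by simp
    have "\<bar>\<gamma> * (?c j - ?c i)\<bar> \<le> \<bar>\<gamma>\<bar> * \<theta>" using d by (simp add: abs_mult mult_left_mono)
    then have "exp (\<gamma> * (?c j - ?c i)) \<le> 1 + \<gamma> * (?c j - ?c i) + (\<gamma> * (?c j - ?c i))\<^sup>2"
      using lam by (intro exp_le_quadratic) linarith
    also have "(\<gamma> * (?c j - ?c i))\<^sup>2 \<le> \<gamma>\<^sup>2 * \<theta>\<^sup>2"
      using power_mono[OF d, of 2] by (simp add: power_mult_distrib mult_left_mono)
    finally have "exp (\<gamma> * (?c j - ?c i)) - 1 \<le> \<gamma> * (?c j - ?c i) + \<gamma>\<^sup>2 * \<theta>\<^sup>2" by simp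
    then have "exp (\<gamma> * ?c i) * (exp (\<gamma> * (?c j - ?c i)) - 1) \<le> exp (\<gamma> * ?c i) * (\<gamma> * (?c j - ?c i) + \<gamma>\<^sup>2 * \<theta>\<^sup>2)"
      by (intro mult_left_mono) auto
    then show ?thesis by (simp add: right_diff_distrib flip: exp_add)
  qed
  have drift: "\<gamma> * ((cos \<theta> - 1) * ?c i) \<le> \<bar>\<gamma>\<bar> * (\<theta>\<^sup>2 / 2)"
  proof -
    have "\<bar>(cos \<theta> - 1) * ?c i\<bar> \<le> (\<theta>\<^sup>2 / 2) * 1"
      unfolding abs_mult using one_minus_cos_le[of \<theta>] by (intro mult_mono) (auto simp: c_eq)
    then have "\<bar>\<gamma> * ((cos \<theta> - 1) * ?c i)\<bar> \<le> \<bar>\<gamma>\<bar> * (\<theta>\<^sup>2 / 2)"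
      unfolding abs_mult[of \<gamma>] by (intro mult_left_mono) auto
    then show ?thesis by linarith
  qed
  let ?R = "\<bar>\<gamma>\<bar> * (\<theta>\<^sup>2 / 2) + \<gamma>\<^sup>2 * \<theta>\<^sup>2"
  let ?e = "\<lambda>j. exp (\<gamma> * ?c j)"
  have bound: "q * (?e i * (\<gamma> * ((cos \<theta> - 1) * ?c i) + \<gamma>\<^sup>2 * \<theta>\<^sup>2)) \<le> q * (?e i * ?R)"
    using q drift by (intro mult_left_mono add_right_mono) auto
  have "step_op n ?e i - ?e i \<le> q * (?e i * ?R)"
  proof -
    consider "i = 0" | "i = n" | "0 < i" "i < n" using i by linarith
    then show ?thesis
    proof cases
      case 1
      have "step_op n ?e i - ?e i = q * (?e 1 - ?e i)"
        using step_op_eq[OF n i, of ?e] 1 by (simp add: q_def)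
      also have "\<dots> \<le> q * (?e i * (\<gamma> * (?c 1 - ?c i) + \<gamma>\<^sup>2 * \<theta>\<^sup>2))"
        using q 1 by (intro mult_left_mono inc) auto
      also have "?c 1 - ?c i = (cos \<theta> - 1) * ?c i" using 1 by (simp add: c_eq)
      also note bound
      finally show ?thesis .
    next
      case 2
      have "step_op n ?e i - ?e i = q * (?e (n - 1) - ?e i)"
        using step_op_eq[OF n i, of ?e] 2 n by (simp add: q_def)
      also have "\<dots> \<le> q * (?e i * (\<gamma> * (?c (n - 1) - ?c i) + \<gamma>\<^sup>2 * \<theta>\<^sup>2))"
        using q 2 n by (intro mult_left_mono inc) auto
      \<comment> \<open>At the right end the angle is pi: the cosine there is -1, and at its
        neighbour -cos \<theta>.\<close>
      also have "?c (n - 1) - ?c i = (cos \<theta> - 1) * ?c i"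
      proof -
        have "real n * \<theta> = pi" using n by (simp add: \<theta>_def)
        moreover have "real (n - 1) * \<theta> = real n * \<theta> - \<theta>" using n by (simp add: left_diff_distrib of_nat_diff)
        ultimately show ?thesis using 2 by (simp add: c_eq)
      qed
      also note bound
      finally show ?thesis .
    next
      case 3
      have "step_op n ?e i - ?e i = q / 2 * ((?e (i + 1) - ?e i) + (?e (i - 1) - ?e i))"
        using step_op_eq[OF n i, of ?e] 3 by (simp add: q_def)
      also have "\<dots> \<le> q / 2 * (?e i * (\<gamma> * (?c (i + 1) - ?c i) + \<gamma>\<^sup>2 * \<theta>\<^sup>2) + ?e i * (\<gamma> * (?c (i - 1) - ?c i) + \<gamma>\<^sup>2 * \<theta>\<^sup>2))"
        using q 3 by (intro mult_left_mono add_mono inc) auto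
      also have "\<dots> = q * (?e i * (\<gamma> * ((?c (i + 1) + ?c (i - 1) - 2 * ?c i) / 2) + \<gamma>\<^sup>2 * \<theta>\<^sup>2))"
        by (simp add: field_simps)
      \<comment> \<open>By the addition theorem the cosine is an eigenfunction of the second
        difference.\<close>
      also have "(?c (i + 1) + ?c (i - 1) - 2 * ?c i) / 2 = (cos \<theta> - 1) * ?c i"
      proof -
        have "real (i + 1) * \<theta> = real i * \<theta> + \<theta>" "real (i - 1) * \<theta> = real i * \<theta> - \<theta>"
          using 3 by (auto simp: algebra_simps of_nat_diff)
        then have "?c (i + 1) + ?c (i - 1) = 2 * cos \<theta> * ?c i"
          unfolding c_eq by (simp add: cos_add cos_diff)
        then show ?thesis by (simp add: left_diff_distrib)
      qed
      also note bound
      finally show ?thesis .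
    qed
  qed
  also have "q * (?e i * ?R) \<le> 1 * (?e i * ?R)" using q by (intro mult_right_mono) auto
  finally have "step_op n ?e i \<le> (1 + ?R) * ?e i" by (simp add: algebra_simps)
  also have "\<dots> \<le> (1 + (\<bar>\<gamma>\<bar> + \<gamma>\<^sup>2) * \<theta>\<^sup>2) * ?e i"
    by (intro mult_right_mono) (auto simp: distrib_right)
  also have "\<dots> \<le> exp ((\<bar>\<gamma>\<bar> + \<gamma>\<^sup>2) * \<theta>\<^sup>2) * ?e i"
    using exp_ge_add_one_self by (intro mult_right_mono) auto
  also have "\<theta>\<^sup>2 = drift_const * \<tau> n" using angle_sq[of n] n by (simp add: \<theta>_def)
  finally show ?thesis by (simp add: mult_ac)
qed

lemma step_op_eq_chain_op: "step_op n = chain_op {0..n} (Q n)"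
  by (simp add: step_op_def chain_op_def fun_eq_iff)

text \<open>The maximal inequality with V z y = exp(\<gamma> (c y - c z)) at level exp(\<beta>
  \<eta>). Taking \<gamma> = \<beta> and \<gamma> = -\<beta> covers upward and downward deviations,
  whence the factor 2.\<close>

lemma chain_oscillation:
  assumes mc: "markov_chain M {0..n} \<pi>0 (Q n) X" and n: "n \<ge> 2"
    and \<beta>: "\<beta> \<ge> 0" "\<beta> * (pi / real n) \<le> 1"
  shows "measure M {\<omega>\<in>space M. \<exists>k\<le>N. \<bar>cos_coord n (X (j0 + k) \<omega>) - cos_coord n (X j0 \<omega>)\<bar> \<ge> \<eta>}
    \<le> 2 * exp (drift_const * (\<beta> + \<beta>\<^sup>2) * (real N * \<tau> n) - \<beta> * \<eta>)"
proof -
  interpret finite_chain M "{0..n}" \<pi>0 "Q n" X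
    by standard (use mc in auto)
  let ?h = "\<tau> n" and ?c = "cos_coord n"
  let ?\<rho> = "exp (drift_const * (\<beta> + \<beta>\<^sup>2) * ?h)"
  have h: "?h > 0" using time_step_pos[of n] n by simp
  have one: "measure M {\<omega>\<in>space M. \<exists>k\<le>N. exp (\<gamma> * ?c (X (j0 + k) \<omega>) - \<gamma> * ?c (X j0 \<omega>)) \<ge> exp (\<beta> * \<eta>)}
      \<le> exp (drift_const * (\<beta> + \<beta>\<^sup>2) * (real N * ?h) - \<beta> * \<eta>)" if \<gamma>: "\<bar>\<gamma>\<bar> = \<beta>" for \<gamma>
  proof -
    have "measure M {\<omega>\<in>space M. \<exists>k\<le>N. exp (\<gamma> * ?c (X (j0 + k) \<omega>) - \<gamma> * ?c (X j0 \<omega>)) \<ge> exp (\<beta> * \<eta>)}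
      \<le> ?\<rho> ^ N / exp (\<beta> * \<eta>)"
    proof (rule maximal_inequality[where V = "\<lambda>z y. exp (\<gamma> * ?c y - \<gamma> * ?c z)"])
      fix z y assume y: "y \<in> {0..n}"
      have "chain_op {0..n} (Q n) (\<lambda>y. exp (\<gamma> * ?c y - \<gamma> * ?c z)) y
        = step_op n (\<lambda>j. exp (\<gamma> * ?c j)) y / exp (\<gamma> * ?c z)"
        by (simp add: chain_op_def step_op_def exp_diff sum_divide_distrib)
      also have "\<dots> \<le> ?\<rho> * exp (\<gamma> * ?c y) / exp (\<gamma> * ?c z)"
      proof (rule divide_right_mono)
        have "\<gamma>\<^sup>2 = \<beta>\<^sup>2" unfolding \<gamma>[symmetric] by simp
        then show "step_op n (\<lambda>j. exp (\<gamma> * ?c j)) y \<le> ?\<rho> * exp (\<gamma> * ?c y)"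
          using step_op_exp_cos_coord[OF n, of y \<gamma>] y \<beta>(2) unfolding \<gamma> by simp
      qed simp
      finally show "chain_op {0..n} (Q n) (\<lambda>y. exp (\<gamma> * ?c y - \<gamma> * ?c z)) y
        \<le> ?\<rho> * exp (\<gamma> * ?c y - \<gamma> * ?c z)" by (simp add: exp_diff)
    next
      show "1 \<le> ?\<rho>"
        unfolding one_le_exp_iff using drift_const_pos \<beta>(1) h by (intro mult_nonneg_nonneg) auto
      show "0 \<le> Q n i j" if "i \<in> {0..n}" for i j
        using that by (intro transition_matrix_nonneg n) simp
      show "(\<Sum>j\<in>{0..n}. Q n i j) = 1" if "i \<in> {0..n}" for i
        using that by (intro sum_transition_matrix n) simp
    qed simp_all
    also have "?\<rho> ^ N / exp (\<beta> * \<eta>) = exp (drift_const * (\<beta> + \<beta>\<^sup>2) * (real N * ?h) - \<beta> * \<eta>)"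
    proof -
      have "?\<rho> ^ N = exp (real N * (drift_const * (\<beta> + \<beta>\<^sup>2) * ?h))" by (rule exp_of_nat_mult[symmetric])
      also have "real N * (drift_const * (\<beta> + \<beta>\<^sup>2) * ?h) = drift_const * (\<beta> + \<beta>\<^sup>2) * (real N * ?h)"
        by (simp only: mult_ac)
      finally show ?thesis by (simp only: exp_diff)
    qed
    finally show ?thesis .
  qed
  let ?A = "\<lambda>\<gamma>. {\<omega>\<in>space M. \<exists>k\<le>N. exp (\<gamma> * ?c (X (j0 + k) \<omega>) - \<gamma> * ?c (X j0 \<omega>)) \<ge> exp (\<beta> * \<eta>)}"
  have meas: "?A \<gamma> \<in> sets M" for \<gamma>
    by (rule event_sets[of "j0 + N" "\<lambda>p. \<exists>k\<le>N. exp (\<gamma> * ?c (p (j0 + k)) - \<gamma> * ?c (p j0)) \<ge> exp (\<beta> * \<eta>)"])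
       (simp cong: conj_cong del: exp_le_cancel_iff)
  have "{\<omega>\<in>space M. \<exists>k\<le>N. \<bar>?c (X (j0 + k) \<omega>) - ?c (X j0 \<omega>)\<bar> \<ge> \<eta>} \<subseteq> ?A \<beta> \<union> ?A (- \<beta>)"
  proof
    fix \<omega> assume "\<omega> \<in> {\<omega>\<in>space M. \<exists>k\<le>N. \<bar>?c (X (j0 + k) \<omega>) - ?c (X j0 \<omega>)\<bar> \<ge> \<eta>}"
    then obtain k where w: "\<omega> \<in> space M" and k: "k \<le> N" "\<bar>?c (X (j0 + k) \<omega>) - ?c (X j0 \<omega>)\<bar> \<ge> \<eta>"
      by blast
    define D where "D = ?c (X (j0 + k) \<omega>) - ?c (X j0 \<omega>)"
    have "\<beta> * \<eta> \<le> \<beta> * \<bar>D\<bar>" using k(2) \<beta>(1) unfolding D_def by (intro mult_left_mono)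
    then consider "\<beta> * \<eta> \<le> \<beta> * D" | "\<beta> * \<eta> \<le> - \<beta> * D" by (cases "D \<ge> 0") auto
    then show "\<omega> \<in> ?A \<beta> \<union> ?A (- \<beta>)"
    proof cases
      case 1
      then have "exp (\<beta> * \<eta>) \<le> exp (\<beta> * ?c (X (j0 + k) \<omega>) - \<beta> * ?c (X j0 \<omega>))"
        unfolding exp_le_cancel_iff D_def right_diff_distrib .
      with k(1) w show ?thesis by blast
    next
      case 2
      then have "exp (\<beta> * \<eta>) \<le> exp (- \<beta> * ?c (X (j0 + k) \<omega>) - - \<beta> * ?c (X j0 \<omega>))"
        unfolding exp_le_cancel_iff D_def right_diff_distrib .
      with k(1) w show ?thesis by blast
    qed
  qed
  then have "measure M {\<omega>\<in>space M. \<exists>k\<le>N. \<bar>?c (X (j0 + k) \<omega>) - ?c (X j0 \<omega>)\<bar> \<ge> \<eta>} \<le> measure M (?A \<beta> \<union> ?A (- \<beta>))"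
    by (rule finite_measure_mono) (rule sets.Un[OF meas meas])
  also have "\<dots> \<le> measure M (?A \<beta>) + measure M (?A (- \<beta>))"
    by (rule measure_Un_le[OF meas meas])
  also have "\<dots> \<le> exp (drift_const * (\<beta> + \<beta>\<^sup>2) * (real N * ?h) - \<beta> * \<eta>)
      + exp (drift_const * (\<beta> + \<beta>\<^sup>2) * (real N * ?h) - \<beta> * \<eta>)"
    using \<beta>(1) by (intro add_mono one) auto
  finally show ?thesis by (simp only: mult_2)
qed

section \<open>Product moments at equally spaced times and their approximation\<close>

fun diffusion_product :: "real \<Rightarrow> nat \<Rightarrow> (nat \<Rightarrow> real \<Rightarrow> real) \<Rightarrow> real \<Rightarrow> real" where
  "diffusion_product s 0 f x = f 0 x"
| "diffusion_product s (Suc K) f x = f 0 x * T s (diffusion_product s K (\<lambda>j. f (Suc j))) x"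

lemma continuous_diffusion_product:
  assumes "\<And>j. continuous_on {l..r} (f j)" and "s \<ge> 0"
  shows "continuous_on {l..r} (diffusion_product s K f)"
  using assms by (induction K arbitrary: f) (auto intro!: continuous_intros continuous_T)

lemma path_product_measurable_bounded:
  fixes f :: "nat \<Rightarrow> real \<Rightarrow> real" and K :: nat and s :: real
  assumes f: "\<And>j. continuous_on {l..r} (f j)" and s: "s \<ge> 0"
  defines "G \<equiv> \<lambda>w. \<Prod>i\<le>K. f i (w (real i * s))"
  shows "G \<in> borel_measurable (path_space l r)" "\<exists>B. \<forall>w\<in>continuous_paths l r. \<bar>G w\<bar> \<le> B"
proof -
  show "G \<in> borel_measurable (path_space l r)"
    unfolding G_def using s by (intro borel_measurable_prod borel_measurable_path_eval f) auto
  have "\<exists>B. \<forall>y\<in>{l..r}. \<bar>f i y\<bar> \<le> B" for i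
    using continuous_on_interval_bounded[OF f] by metis
  then obtain B where B: "\<And>i y. y \<in> {l..r} \<Longrightarrow> \<bar>f i y\<bar> \<le> B i" by metis
  have "\<bar>G w\<bar> \<le> (\<Prod>i\<le>K. B i)" if "w \<in> continuous_paths l r" for w
    unfolding G_def abs_prod using continuous_paths_bounds[OF that] s
    by (intro prod_mono conjI B) auto
  then show "\<exists>B. \<forall>w\<in>continuous_paths l r. \<bar>G w\<bar> \<le> B" by blast
qed

lemma expectation_diffusion_product:
  assumes "\<And>j. continuous_on {l..r} (f j)" and s: "s \<ge> 0" and "x \<in> {l..r}"
  shows "(\<integral>w. (\<Prod>i\<le>K. f i (w (real i * s))) \<partial>P x) = diffusion_product s K f x"
  using assms(1,3)
proof (induction K arbitrary: f x)
  case 0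
  then show ?case using T_0[of x "f 0"] by (simp add: semigroup_def)
next
  case (Suc K)
  interpret prob_space "P x" by (rule prob_space_P[OF Suc.prems(2)])
  define G where "G w = (\<Prod>i\<le>K. f (Suc i) (w (real i * s)))" for w :: "real \<Rightarrow> real"
  have G: "G \<in> borel_measurable (path_space l r)"
    unfolding G_def by (rule path_product_measurable_bounded[OF Suc.prems(1) s])
  obtain B where bd: "\<And>w. w \<in> continuous_paths l r \<Longrightarrow> \<bar>G w\<bar> \<le> B"
    unfolding G_def using path_product_measurable_bounded(2)[of "\<lambda>i. f (Suc i)", OF Suc.prems(1) s] by blast
  have Gs: "(\<lambda>w. G (shift_path s w)) \<in> borel_measurable (path_space l r)"
    by (rule measurable_compose[OF measurable_shift_path[OF s] G])
  have prod: "(\<lambda>w. \<Prod>i\<le>Suc K. f i (w (real i * s))) \<in> borel_measurable (path_space l r)"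
    by (rule path_product_measurable_bounded[OF Suc.prems(1) s])
  have "(\<integral>w. (\<Prod>i\<le>Suc K. f i (w (real i * s))) \<partial>P x) = (\<integral>w. f 0 x * G (shift_path s w) \<partial>P x)"
  \<comment> \<open>Almost surely w 0 = x, so the factor at time 0 is a constant and the others
    depend on the path shifted by s.\<close>
  proof (rule integral_cong_AE)
    show "AE w in P x. (\<Prod>i\<le>Suc K. f i (w (real i * s))) = f 0 x * G (shift_path s w)"
      using AE_start[OF Suc.prems(2)]
    proof eventually_elim
      case (elim w)
      then show ?case
        using s by (simp add: G_def prod.atMost_Suc_shift shift_path_def algebra_simps del: prod.atMost_Suc)
    qed
  qed (use prod Gs in \<open>auto simp: measurable_P_iff[OF Suc.prems(2)]\<close>)
  also have "\<dots> = f 0 x * (\<integral>w. G (shift_path s w) \<partial>P x)" by simp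
  also have "(\<integral>w. G (shift_path s w) \<partial>P x) = (\<integral>w. (\<integral>v. G v \<partial>P (w s)) \<partial>P x)"
    by (rule markov_property[OF Suc.prems(2) s G bd])
  also have "\<dots> = T s (diffusion_product s K (\<lambda>j. f (Suc j))) x"
    unfolding semigroup_def
    using continuous_paths_bounds[of _ l r s] s
    by (intro Bochner_Integration.integral_cong refl)
       (auto simp: G_def space_P[OF Suc.prems(2)] intro!: Suc.IH Suc.prems)
  finally show ?case by simp
qed

text \<open>Both recursions are unrolled together. Only increments of the time indices enter, so the
  hypothesis on k is stable under the index shift of the induction.\<close>

lemma grid_converges_product:
  assumes "\<And>j. continuous_on {l..r} (f j)" and s: "s \<ge> 0"
    and "\<And>j. (\<lambda>n. real (k n (Suc j) - k n j) * \<tau> n) \<longlonglongrightarrow> s"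
  shows "grid_converges (\<lambda>n. chain_product {0..n} (Q n) K (k n) (\<lambda>j i. f j (grid l r n i)))
    (diffusion_product s K f)"
  using assms(1,3)
proof (induction K arbitrary: f k)
  case 0
  then show ?case by (simp add: grid_converges_def)
next
  case (Suc K)
  have "grid_converges (\<lambda>n. chain_product {0..n} (Q n) K (\<lambda>j. k n (Suc j)) (\<lambda>j i. f (Suc j) (grid l r n i)))
    (diffusion_product s K (\<lambda>j. f (Suc j)))"
    by (intro Suc.IH[of "\<lambda>j. f (Suc j)" "\<lambda>n j. k n (Suc j)"] Suc.prems)
  note grid_converges_T[OF this continuous_diffusion_product[OF Suc.prems(1) s] s Suc.prems(2)[of 0]]
  from grid_converges_mult[OF Suc.prems(1)[of 0] this continuous_T[OF continuous_diffusion_product[OF Suc.prems(1) s] s]]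
  show ?case by (simp add: step_op_eq_chain_op)
qed

end

subsection \<open>Approximation of path functionals\<close>

text \<open>Tent functions of radius \<epsilon> around the points of Z, normalised to a partition of
  unity; on the interval the denominator is positive when Z is a net there.\<close>

definition bump :: "real set \<Rightarrow> real \<Rightarrow> real \<Rightarrow> real \<Rightarrow> real" where
  "bump Z \<epsilon> z y = max 0 (\<epsilon> - \<bar>y - z\<bar>) / (\<Sum>z'\<in>Z. max 0 (\<epsilon> - \<bar>y - z'\<bar>))"

definition is_net :: "real \<Rightarrow> real \<Rightarrow> real set \<Rightarrow> real \<Rightarrow> bool" where
  "is_net l r Z \<epsilon> \<longleftrightarrow> finite Z \<and> Z \<subseteq> {l..r} \<and> (\<forall>y\<in>{l..r}. \<exists>z\<in>Z. \<bar>y - z\<bar> < \<epsilon>)"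

lemma net_exists:
  assumes "\<epsilon> > 0"
  shows "\<exists>Z. is_net l r Z \<epsilon>"
proof -
  have "seq_compact {l..r}" by (simp add: compact_imp_seq_compact)
  then obtain Z where Z: "finite Z" "Z \<subseteq> {l..r}" "{l..r} \<subseteq> (\<Union>x\<in>Z. ball x \<epsilon>)"
    using seq_compact_imp_totally_bounded[of "{l..r}"] assms by blast
  have "\<exists>z\<in>Z. \<bar>y - z\<bar> < \<epsilon>" if y: "y \<in> {l..r}" for y
  proof -
    obtain z where "z \<in> Z" "y \<in> ball z \<epsilon>" using Z(3) y by blast
    then show ?thesis by (auto simp: dist_real_def abs_minus_commute)
  qed
  then show ?thesis using Z unfolding is_net_def by blast
qed

lemma
  assumes Z: "is_net l r Z \<epsilon>"
  shows continuous_bump: "continuous_on {l..r} (bump Z \<epsilon> z)"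
    and sum_bump: "\<And>y. y \<in> {l..r} \<Longrightarrow> (\<Sum>z\<in>Z. bump Z \<epsilon> z y) = 1"
proof -
  have fin: "finite Z" using Z by (simp add: is_net_def)
  have pos: "(\<Sum>z'\<in>Z. max 0 (\<epsilon> - \<bar>y - z'\<bar>)) > 0" if y: "y \<in> {l..r}" for y
  proof -
    obtain z where z: "z \<in> Z" "\<bar>y - z\<bar> < \<epsilon>" using Z y unfolding is_net_def by blast
    then show ?thesis by (intro sum_pos2[OF fin z(1)]) auto
  qed
  show "continuous_on {l..r} (bump Z \<epsilon> z)"
    unfolding bump_def using pos by (intro continuous_intros) fastforce
  show "(\<Sum>z\<in>Z. bump Z \<epsilon> z y) = 1" if "y \<in> {l..r}" for y
    unfolding bump_def sum_divide_distrib[symmetric] using pos[OF that] by simp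
qed

lemma bump_nonneg: "0 \<le> bump Z \<epsilon> z y"
  unfolding bump_def by (intro divide_nonneg_nonneg sum_nonneg) auto

lemma bump_support: "bump Z \<epsilon> z y \<noteq> 0 \<Longrightarrow> \<bar>y - z\<bar> < \<epsilon>"
  by (auto simp: bump_def max_def split: if_splits)

text \<open>One parameter m sets the time mesh 1 / m and the horizon: the indices up to m * m reach
  time m, and from there on the path is frozen.\<close>

definition net_path :: "nat \<Rightarrow> (nat \<Rightarrow> real) \<Rightarrow> real \<Rightarrow> real" where
  "net_path m p = step_path (\<lambda>i. p (min i (m * m))) (1 / real m)"

text \<open>The times are written as multiples of s = 1 / m to match the product moments of chain
  and diffusion.\<close>

definition bump_product :: "nat \<Rightarrow> real set \<Rightarrow> (nat \<Rightarrow> real) \<Rightarrow> (real \<Rightarrow> real) \<Rightarrow> real" where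
  "bump_product m Z p w = (\<Prod>i\<le>m * m. bump Z (1 / real m) (p i) (w (real i * (1 / real m))))"

text \<open>The average of \<open>\<psi>\<close> over step functions with values in the net, weighted by a partition of unity
  that looks at \<open>w\<close> only at the times \<open>i / m\<close>.\<close>

definition path_approx :: "((real \<Rightarrow> real) \<Rightarrow> real) \<Rightarrow> nat \<Rightarrow> real set \<Rightarrow> (real \<Rightarrow> real) \<Rightarrow> real" where
  "path_approx \<psi> m Z w = (\<Sum>p\<in>PiE {..m * m} (\<lambda>_. Z). \<psi> (net_path m p) * bump_product m Z p w)"

lemma bump_product_nonneg: "0 \<le> bump_product m Z p w"
  unfolding bump_product_def by (intro prod_nonneg bump_nonneg)

lemma sum_bump_product:
  assumes Z: "is_net l r Z (1 / real m)" and w: "\<And>t. t \<ge> 0 \<Longrightarrow> w t \<in> {l..r}"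
  shows "(\<Sum>p\<in>PiE {..m * m} (\<lambda>_. Z). bump_product m Z p w) = 1"
proof -
  have fin: "finite Z" using Z by (simp add: is_net_def)
  have "(\<Sum>p\<in>PiE {..m * m} (\<lambda>_. Z). bump_product m Z p w)
    = (\<Prod>i\<le>m * m. \<Sum>z\<in>Z. bump Z (1 / real m) z (w (real i * (1 / real m))))"
    unfolding bump_product_def by (rule prod_sum_PiE[symmetric]) (use fin in auto)
  also have "\<dots> = 1" using sum_bump[OF Z] w by (intro prod.neutral) simp
  finally show ?thesis .
qed

lemma net_path_mem:
  assumes "is_net l r Z (1 / real m)" "m \<ge> 1" "p \<in> PiE {..m * m} (\<lambda>_. Z)"
  shows "net_path m p \<in> cadlag_paths {l..r}"
  unfolding net_path_def
proof (rule step_path_mem_cadlag_paths)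
  fix k
  have "p (min k (m * m)) \<in> Z" using assms(3) by (rule PiE_mem) simp
  then show "p (min k (m * m)) \<in> {l..r}" using assms(1) by (auto simp: is_net_def)
qed (use assms in simp)

text \<open>The weights are nonnegative with sum 1, so only step paths of positive weight count,
  that is, those near w at all sampling times.\<close>

lemma path_approx_error_average:
  assumes Z: "is_net l r Z (1 / real m)" and w: "\<And>t. t \<ge> 0 \<Longrightarrow> w t \<in> {l..r}"
    and le: "\<And>p. p \<in> PiE {..m * m} (\<lambda>_. Z) \<Longrightarrow> bump_product m Z p w \<noteq> 0 \<Longrightarrow> \<bar>a - \<psi> (net_path m p)\<bar> \<le> c"
  shows "\<bar>a - path_approx \<psi> m Z w\<bar> \<le> c"
proof -
  let ?S = "PiE {..m * m} (\<lambda>_. Z)"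
  have "a - path_approx \<psi> m Z w = a * (\<Sum>p\<in>?S. bump_product m Z p w) - path_approx \<psi> m Z w"
    by (simp add: sum_bump_product[OF Z w])
  also have "\<dots> = (\<Sum>p\<in>?S. (a - \<psi> (net_path m p)) * bump_product m Z p w)"
    by (simp add: path_approx_def sum_distrib_left left_diff_distrib sum_subtractf)
  also have "\<bar>\<dots>\<bar> \<le> (\<Sum>p\<in>?S. c * bump_product m Z p w)"
  proof (intro order_trans[OF sum_abs] sum_mono)
    fix p assume p: "p \<in> ?S"
    show "\<bar>(a - \<psi> (net_path m p)) * bump_product m Z p w\<bar> \<le> c * bump_product m Z p w"
      using le[OF p] bump_product_nonneg[of m Z p w]
      by (cases "bump_product m Z p w = 0") (simp_all add: abs_mult mult_right_mono)
  qed
  also have "\<dots> = c" by (simp add: sum_bump_product[OF Z w] flip: sum_distrib_left)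
  finally show ?thesis .
qed

lemma abs_path_approx_le:
  assumes Z: "is_net l r Z (1 / real m)" and m: "m \<ge> 1" and w: "w \<in> cadlag_paths {l..r}"
    and B: "\<And>w. w \<in> cadlag_paths {l..r} \<Longrightarrow> \<bar>\<psi> w\<bar> \<le> B"
  shows "\<bar>path_approx \<psi> m Z w\<bar> \<le> B"
  using path_approx_error_average[OF Z, of w 0 \<psi> B] cadlag_paths_bounds[OF w] B[OF net_path_mem[OF Z m]]
  by simp

text \<open>The three terms are the width of the net, the oscillation of w since the last sampling
  time before the horizon K, and the tail after K, where the weight of \<open>path_dist\<close> is
  at most exp(-K). The condition K \<le> m places [0,K] within the sampled range.\<close>

lemma path_approx_error:
  assumes Z: "is_net l r Z (1 / real m)" and m: "m \<ge> 1" and w: "w \<in> cadlag_paths {l..r}"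
    and \<psi>: "path_lipschitz l r L \<psi>" and L: "L \<ge> 0" and K: "K \<le> m" and e: "\<epsilon> \<ge> 0" and lr: "l \<le> r"
    and osc: "\<And>t. 0 \<le> t \<Longrightarrow> t < real K \<Longrightarrow> \<bar>w t - w (real (nat \<lfloor>t * real m\<rfloor>) * (1 / real m))\<bar> \<le> \<epsilon>"
  shows "\<bar>\<psi> w - path_approx \<psi> m Z w\<bar> \<le> L * (1 / real m + \<epsilon> + (r - l) * exp (- real K))"
proof (rule path_approx_error_average[OF Z cadlag_paths_bounds[OF w]])
  fix p assume p: "p \<in> PiE {..m * m} (\<lambda>_. Z)" and nz: "bump_product m Z p w \<noteq> 0"
  have close: "\<bar>w (real i * (1 / real m)) - p i\<bar> < 1 / real m" if "i \<le> m * m" for i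
    using nz that by (intro bump_support[where Z = Z]) (auto simp: bump_product_def)
  let ?v = "net_path m p"
  have v: "?v \<in> cadlag_paths {l..r}" by (rule net_path_mem[OF Z m p])
  have "path_dist w ?v \<le> 1 / real m + \<epsilon> + (r - l) * exp (- real K)"
  proof (rule path_dist_le)
    fix t :: real assume t: "t \<ge> 0"
    show "exp (- t) * \<bar>w t - ?v t\<bar> \<le> 1 / real m + \<epsilon> + (r - l) * exp (- real K)"
    proof (cases "t < real K")
      case True
      define i where "i = nat \<lfloor>t * real m\<rfloor>"
      have "t * real m \<le> real m * real m" using True K by (intro mult_right_mono) auto
      then have "nat \<lfloor>t * real m\<rfloor> \<le> nat \<lfloor>real m * real m\<rfloor>" by (intro nat_mono floor_mono)
      also have "nat \<lfloor>real m * real m\<rfloor> = m * m" by (metis floor_of_nat nat_int of_nat_mult)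
      finally have i: "i \<le> m * m" by (simp add: i_def)
      have "?v t = p i" using t i by (simp add: net_path_def step_path_def i_def min_absorb1)
      then have "\<bar>w t - ?v t\<bar> \<le> \<epsilon> + 1 / real m"
        using osc[OF t True] close[OF i] unfolding i_def by linarith
      then have "exp (- t) * \<bar>w t - ?v t\<bar> \<le> 1 * (\<epsilon> + 1 / real m)"
        using t by (intro mult_mono) auto
      also have "\<dots> \<le> 1 / real m + \<epsilon> + (r - l) * exp (- real K)" using lr by simp
      finally show ?thesis .
    next
      case False
      have "exp (- t) * \<bar>w t - ?v t\<bar> \<le> exp (- real K) * (r - l)"
        using False cadlag_paths_diff_le[OF w v t] by (intro mult_mono) auto
      also have "\<dots> \<le> 1 / real m + \<epsilon> + (r - l) * exp (- real K)" using e by (simp add: mult.commute)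
      finally show ?thesis .
    qed
  qed
  then have "L * path_dist w ?v \<le> L * (1 / real m + \<epsilon> + (r - l) * exp (- real K))"
    using L by (intro mult_left_mono)
  moreover have "\<bar>\<psi> w - \<psi> ?v\<bar> \<le> L * path_dist w ?v"
    using \<psi> w v unfolding path_lipschitz_def by blast
  ultimately show "\<bar>\<psi> w - \<psi> ?v\<bar> \<le> L * (1 / real m + \<epsilon> + (r - l) * exp (- real K))" by linarith
qed

lemma exp_tail_small:
  assumes "\<epsilon> > 0"
  shows "\<exists>K. c * exp (- real K) < \<epsilon>"
proof -
  obtain K :: nat where K: "c / \<epsilon> < real K" using reals_Archimedean2 by blast
  also have "\<dots> < exp (real K)" using exp_ge_add_one_self[of "real K"] by linarith
  finally have "c < \<epsilon> * exp (real K)" using assms by (simp add: field_simps)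
  then have "c * exp (- real K) < \<epsilon>" by (simp add: exp_minus field_simps)
  then show ?thesis by blast
qed

text \<open>Uniform continuity of the fixed path on [0,K] supplies the oscillation bound. Besides
  the limit of expectations this yields measurability of \<open>\<psi>\<close> along the
  diffusion.\<close>

lemma path_approx_tendsto:
  assumes Z: "\<And>m. m \<ge> 1 \<Longrightarrow> is_net l r (Z m) (1 / real m)" and w: "w \<in> continuous_paths l r"
    and \<psi>: "path_lipschitz l r L \<psi>" and L: "L \<ge> 0" and lr: "l \<le> r"
  shows "(\<lambda>m. path_approx \<psi> m (Z m) w) \<longlonglongrightarrow> \<psi> w"
proof (rule LIMSEQ_I)
  fix e :: real assume e: "e > 0"
  have w': "w \<in> cadlag_paths {l..r}" using w continuous_paths_subset_cadlag_paths by blast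
  define \<epsilon> where "\<epsilon> = e / (4 * (L + 1))"
  have eps: "\<epsilon> > 0" using e L by (simp add: \<epsilon>_def)
  obtain K :: nat where K: "(r - l) * exp (- real K) < \<epsilon>"
    using exp_tail_small[OF eps] by blast
  have "uniformly_continuous_on {0..real K} w"
  proof (rule compact_uniformly_continuous)
    have "continuous_on {0..} w" using w by (simp add: continuous_paths_def)
    then show "continuous_on {0..real K} w" by (rule continuous_on_subset) auto
  qed simp
  from this[unfolded uniformly_continuous_on_def, rule_format, OF eps]
  obtain d where d: "d > 0" "\<And>s t. s \<in> {0..real K} \<Longrightarrow> t \<in> {0..real K} \<Longrightarrow> \<bar>s - t\<bar> < d \<Longrightarrow> \<bar>w s - w t\<bar> < \<epsilon>"
    unfolding dist_real_def by blast
  obtain m0 :: nat where m0: "real m0 > max (1 / d) (1 / \<epsilon>)" using reals_Archimedean2 by blast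
  have "norm (path_approx \<psi> m (Z m) w - \<psi> w) < e" if m: "m \<ge> max (max K 1) m0" for m
  proof -
    have m1: "m \<ge> 1" "K \<le> m" using m by auto
    have mp: "real m > 0" using m1 by simp
    have "real m0 \<le> real m" using m by simp
    then have "1 / d < real m" "1 / \<epsilon> < real m" using m0 by linarith+
    then have md: "1 / real m < d" "1 / real m < \<epsilon>"
      using d(1) eps mp by (simp_all add: divide_less_eq mult.commute)
    have "\<bar>\<psi> w - path_approx \<psi> m (Z m) w\<bar> \<le> L * (1 / real m + \<epsilon> + (r - l) * exp (- real K))"
    proof (rule path_approx_error[OF Z[OF m1(1)] m1(1) w' \<psi> L m1(2) _ lr])
      fix t :: real assume t: "0 \<le> t" "t < real K"
      let ?s = "real (nat \<lfloor>t * real m\<rfloor>) * (1 / real m)"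
      define k where "k = real (nat \<lfloor>t * real m\<rfloor>)"
      have "k = of_int \<lfloor>t * real m\<rfloor>" unfolding k_def using t by (intro of_nat_nat) simp
      then have "k \<le> t * real m" "t * real m < k + 1" by linarith+
      then have "k / real m \<le> t" "t < (k + 1) / real m"
        using mp by (simp_all add: divide_le_eq less_divide_eq)
      then have "?s \<le> t" "t < ?s + 1 / real m" by (simp_all add: k_def add_divide_distrib)
      moreover have "0 \<le> ?s" by simp
      ultimately have "\<bar>w t - w ?s\<bar> < \<epsilon>" using t md by (intro d(2)) auto
      then show "\<bar>w t - w ?s\<bar> \<le> \<epsilon>" by simp
    qed (use eps in simp)
    also have "\<dots> \<le> L * (3 * \<epsilon>)" using md K L by (intro mult_left_mono) auto
    also have "\<dots> \<le> (L + 1) * (3 * \<epsilon>)" using eps by (intro mult_right_mono) auto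
    also have "\<dots> = 3 / 4 * e" using L by (simp add: \<epsilon>_def field_simps)
    also have "\<dots> < e" using e by simp
    finally show ?thesis by (simp add: abs_minus_commute)
  qed
  then show "\<exists>no. \<forall>m\<ge>no. norm (path_approx \<psi> m (Z m) w - \<psi> w) < e" by blast
qed

text \<open>Oscillation is estimated in the cosine coordinate and must be read off in the space
  variable. The inverse arccos is not Lipschitz at the ends, but uniformly continuous on
  [-1,1].\<close>

lemma cos_inverse_uniform:
  fixes l r :: real
  assumes lr: "l < r" and e: "\<epsilon> > 0"
  obtains \<eta> where "\<eta> > 0" "\<And>x y. x \<in> {l..r} \<Longrightarrow> y \<in> {l..r} \<Longrightarrow>
    \<bar>cos (pi / (r - l) * (x - l)) - cos (pi / (r - l) * (y - l))\<bar> < \<eta> \<Longrightarrow> \<bar>x - y\<bar> \<le> \<epsilon>"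
proof -
  define \<kappa> where "\<kappa> = pi / (r - l)"
  have k: "\<kappa> > 0" using lr by (simp add: \<kappa>_def)
  have uc: "uniformly_continuous_on {-1..1} arccos"
    by (rule compact_uniformly_continuous) (auto intro!: continuous_intros)
  have "\<epsilon> * \<kappa> > 0" using e k by simp
  from uc[unfolded uniformly_continuous_on_def, rule_format, OF this]
  obtain \<eta> where \<eta>: "\<eta> > 0" "\<And>u v. u \<in> {-1..1} \<Longrightarrow> v \<in> {-1..1} \<Longrightarrow> \<bar>u - v\<bar> < \<eta> \<Longrightarrow> \<bar>arccos u - arccos v\<bar> < \<epsilon> * \<kappa>"
    unfolding dist_real_def by blast
  have inv: "arccos (cos (\<kappa> * (x - l))) = \<kappa> * (x - l)" if "x \<in> {l..r}" for x
  proof (rule arccos_cos)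
    show "0 \<le> \<kappa> * (x - l)" using that k by simp
    have "\<kappa> * (x - l) \<le> \<kappa> * (r - l)" using that k by (intro mult_left_mono) auto
    also have "\<dots> = pi" using lr by (simp add: \<kappa>_def)
    finally show "\<kappa> * (x - l) \<le> pi" .
  qed
  show thesis
  proof (rule that[OF \<eta>(1)])
    fix x y assume x: "x \<in> {l..r}" and y: "y \<in> {l..r}"
      and d: "\<bar>cos (pi / (r - l) * (x - l)) - cos (pi / (r - l) * (y - l))\<bar> < \<eta>"
    have "\<bar>arccos (cos (\<kappa> * (x - l))) - arccos (cos (\<kappa> * (y - l)))\<bar> < \<epsilon> * \<kappa>"
      using d by (intro \<eta>(2)) (simp_all add: \<kappa>_def)
    then have "\<bar>\<kappa> * (x - l) - \<kappa> * (y - l)\<bar> < \<epsilon> * \<kappa>" unfolding inv[OF x] inv[OF y] .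
    also have "\<kappa> * (x - l) - \<kappa> * (y - l) = (x - y) * \<kappa>" by (simp add: algebra_simps)
    finally have "\<bar>x - y\<bar> * \<kappa> < \<epsilon> * \<kappa>" using k by (simp add: abs_mult)
    then show "\<bar>x - y\<bar> \<le> \<epsilon>" using k by simp
  qed
qed

lemma path_dist_step_path_truncate:
  assumes h: "h > 0" and a: "\<And>k. a k \<in> {l..r}" and lr: "l \<le> r"
  shows "path_dist (step_path a h) (step_path (\<lambda>k. a (min k J)) h) \<le> (r - l) * exp (- (real J * h))"
proof (rule path_dist_le)
  fix t :: real assume t: "t \<ge> 0"
  show "exp (- t) * \<bar>step_path a h t - step_path (\<lambda>k. a (min k J)) h t\<bar> \<le> (r - l) * exp (- (real J * h))"
  proof (cases "t \<le> real J * h")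
    case True
    then have "t / h \<le> real J" using h by (simp add: divide_le_eq)
    then have "nat \<lfloor>t / h\<rfloor> \<le> nat \<lfloor>real J\<rfloor>" by (intro nat_mono floor_mono)
    then have "min (nat \<lfloor>t / h\<rfloor>) J = nat \<lfloor>t / h\<rfloor>" by simp
    then show ?thesis using lr t by (simp add: step_path_def)
  next
    case False
    have "\<bar>step_path a h t - step_path (\<lambda>k. a (min k J)) h t\<bar> \<le> r - l"
      using h a by (intro cadlag_paths_diff_le[OF _ _ t] step_path_mem_cadlag_paths)
    then have "exp (- t) * \<bar>step_path a h t - step_path (\<lambda>k. a (min k J)) h t\<bar> \<le> exp (- (real J * h)) * (r - l)"
      using False by (intro mult_mono) auto
    then show ?thesis by (simp add: mult.commute)
  qed
qed

context reflecting_diffusion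
begin

lemma cos_coord_eq: "n \<ge> 1 \<Longrightarrow> cos_coord n i = cos (pi / (r - l) * (grid l r n i - l))"
  using l_less_r by (simp add: cos_coord_def grid_def mesh_def mult.commute)

subsection \<open>The limit process\<close>

lemma diffusion_process_facts:
  assumes "diffusion_process l r P N Y"
  shows "prob_space N" "path_of Y \<in> N \<rightarrow>\<^sub>M path_space l r" "Y 0 \<in> N \<rightarrow>\<^sub>M restrict_space borel {l..r}"
    and "\<And>\<omega>. \<omega> \<in> space N \<Longrightarrow> path_of Y \<omega> \<in> continuous_paths l r"
proof -
  show "prob_space N" and m: "path_of Y \<in> N \<rightarrow>\<^sub>M path_space l r"
    using assms by (simp_all add: diffusion_process_def)
  show "path_of Y \<omega> \<in> continuous_paths l r" if "\<omega> \<in> space N" for \<omega>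
    using measurable_space[OF m that] by (simp add: space_path_space)
  have "(\<lambda>\<omega>. path_of Y \<omega> 0) \<in> N \<rightarrow>\<^sub>M restrict_space borel {l..r}"
    by (rule measurable_compose[OF m measurable_path_eval]) simp
  then show "Y 0 \<in> N \<rightarrow>\<^sub>M restrict_space borel {l..r}" by (simp add: path_of_def)
qed

text \<open>The law of Y is a mixture over its starting point, so the moment for a fixed start is
  integrated against the law of Y 0.\<close>

lemma diffusion_process_product:
  assumes Y: "diffusion_process l r P N Y" and f: "\<And>j. continuous_on {l..r} (f j)" and s: "s \<ge> 0"
  shows "(\<integral>\<omega>. (\<Prod>i\<le>K. f i (path_of Y \<omega> (real i * s))) \<partial>N) = (\<integral>\<omega>. diffusion_product s K f (Y 0 \<omega>) \<partial>N)"
proof -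
  note facts = diffusion_process_facts[OF Y]
  interpret N: prob_space N by (rule facts(1))
  let ?S = "restrict_space borel {l..r}"
  define G where "G w = (\<Prod>i\<le>K. f i (w (real i * s)))" for w :: "real \<Rightarrow> real"
  have G: "G \<in> borel_measurable (path_space l r)"
    unfolding G_def by (rule path_product_measurable_bounded[OF f s])
  obtain B where bd: "\<And>w. w \<in> continuous_paths l r \<Longrightarrow> \<bar>G w\<bar> \<le> B"
    unfolding G_def using path_product_measurable_bounded(2)[of f, OF f s] by blast
  interpret D: prob_space "distr N ?S (Y 0)" by (rule N.prob_space_distr[OF facts(3)])
  have ker: "P \<in> distr N ?S (Y 0) \<rightarrow>\<^sub>M subprob_algebra (path_space l r)"
    using measurable_prob_algebraD[OF measurable_P] by (simp cong: measurable_cong_sets)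
  have "(\<integral>\<omega>. G (path_of Y \<omega>) \<partial>N) = (\<integral>w. G w \<partial>distr N (path_space l r) (path_of Y))"
    by (rule integral_distr[OF facts(2) G, symmetric])
  also have "\<dots> = (\<integral>w. G w \<partial>(distr N ?S (Y 0) \<bind> P))"
    using Y by (simp add: diffusion_process_def)
  also have "\<dots> = (\<integral>x. (\<integral>w. G w \<partial>P x) \<partial>distr N ?S (Y 0))"
  proof (rule integral_bind[OF G _ ker D.finite_measure_axioms, where B' = 1])
    show "\<bar>G w\<bar> \<le> B" if "w \<in> space (path_space l r)" for w
      using bd that by (simp add: space_path_space)
    show "AE x in distr N ?S (Y 0). emeasure (P x) (space (P x)) \<le> ennreal 1"
      by (intro AE_I2) (simp add: prob_space.emeasure_space_1 prob_space_P space_restrict_space)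
  qed
  also have "\<dots> = (\<integral>x. diffusion_product s K f x \<partial>distr N ?S (Y 0))"
    using expectation_diffusion_product[of f, OF f s]
    by (intro Bochner_Integration.integral_cong refl) (simp add: G_def space_restrict_space)
  also have "\<dots> = (\<integral>\<omega>. diffusion_product s K f (Y 0 \<omega>) \<partial>N)"
    by (intro integral_distr facts(3) borel_measurable_continuous_on_restrict continuous_diffusion_product f s)
  finally show ?thesis by (simp add: G_def)
qed

lemma bump_product_measurable:
  assumes Z: "is_net l r Z (1 / real m)"
  shows "bump_product m Z p \<in> borel_measurable (path_space l r)"
  unfolding bump_product_def[abs_def]
  by (intro borel_measurable_prod borel_measurable_path_eval continuous_bump[OF Z]) simp

text \<open>\<open>\<psi>\<close> is not assumed measurable for the coordinate \<sigma>-algebra. On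
  continuous paths it is a pointwise limit of functions of finitely many coordinates, which settles
  measurability and, by boundedness, the limit of the integrals.\<close>

lemma diffusion_process_approx:
  assumes Y: "diffusion_process l r P N Y" and Z: "\<And>m. m \<ge> 1 \<Longrightarrow> is_net l r (Z m) (1 / real m)"
    and \<psi>: "path_lipschitz l r L \<psi>" and L: "L \<ge> 0"
    and B: "\<And>w. w \<in> cadlag_paths {l..r} \<Longrightarrow> \<bar>\<psi> w\<bar> \<le> B"
  shows "(\<lambda>\<omega>. \<psi> (path_of Y \<omega>)) \<in> borel_measurable N"
    and "(\<lambda>m. \<integral>\<omega>. path_approx \<psi> m (Z m) (path_of Y \<omega>) \<partial>N) \<longlonglongrightarrow> (\<integral>\<omega>. \<psi> (path_of Y \<omega>) \<partial>N)"
proof -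
  note facts = diffusion_process_facts[OF Y]
  interpret N: prob_space N by (rule facts(1))
  \<comment> \<open>The shift avoids m = 0, for which 1 / real m is 0 and no net exists.\<close>
  let ?A = "\<lambda>m \<omega>. path_approx \<psi> (Suc m) (Z (Suc m)) (path_of Y \<omega>)"
  have lim: "(\<lambda>m. ?A m \<omega>) \<longlonglongrightarrow> \<psi> (path_of Y \<omega>)" if "\<omega> \<in> space N" for \<omega>
    using path_approx_tendsto[OF Z facts(4)[OF that] \<psi> L] l_less_r by (intro LIMSEQ_Suc) simp
  have meas: "?A m \<in> borel_measurable N" for m
    unfolding path_approx_def
    by (intro borel_measurable_sum borel_measurable_times borel_measurable_const
      measurable_compose[OF facts(2)] bump_product_measurable Z) simp
  show psi: "(\<lambda>\<omega>. \<psi> (path_of Y \<omega>)) \<in> borel_measurable N"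
    by (rule borel_measurable_LIMSEQ_real[OF lim meas])
  have "(\<lambda>m. \<integral>\<omega>. ?A m \<omega> \<partial>N) \<longlonglongrightarrow> (\<integral>\<omega>. \<psi> (path_of Y \<omega>) \<partial>N)"
  proof (rule integral_dominated_convergence[where w = "\<lambda>_. B"])
    show "integrable N (\<lambda>_. B)" by simp
    show "AE \<omega> in N. (\<lambda>m. ?A m \<omega>) \<longlonglongrightarrow> \<psi> (path_of Y \<omega>)" by (intro AE_I2 lim)
    show "AE \<omega> in N. norm (?A m \<omega>) \<le> B" for m
      unfolding real_norm_def
      using facts(4) continuous_paths_subset_cadlag_paths
      by (intro AE_I2 abs_path_approx_le[OF Z _ _ B]) auto
  qed (fact psi meas)+
  then show "(\<lambda>m. \<integral>\<omega>. path_approx \<psi> m (Z m) (path_of Y \<omega>) \<partial>N) \<longlonglongrightarrow> (\<integral>\<omega>. \<psi> (path_of Y \<omega>) \<partial>N)"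
    by (rule LIMSEQ_imp_Suc)
qed

subsection \<open>The chains as random paths\<close>

definition chain_path :: "nat \<Rightarrow> (nat \<Rightarrow> nat) \<Rightarrow> real \<Rightarrow> real" where
  "chain_path n p = step_path (\<lambda>k. grid l r n (p k)) (\<tau> n)"

definition chain_index :: "nat \<Rightarrow> real \<Rightarrow> nat \<Rightarrow> nat" where
  "chain_index n s i = nat \<lfloor>real i * s / \<tau> n\<rfloor>"

lemma chain_path_eval: "s \<ge> 0 \<Longrightarrow> chain_path n p (real i * s) = grid l r n (p (chain_index n s i))"
  by (simp add: chain_path_def step_path_def chain_index_def)

lemma chain_path_mem: "n \<ge> 1 \<Longrightarrow> (\<And>k. p k \<le> n) \<Longrightarrow> chain_path n p \<in> cadlag_paths {l..r}"
  unfolding chain_path_def by (intro step_path_mem_cadlag_paths time_step_pos grid_mem)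

lemma chain_index_bounds:
  assumes "n \<ge> 1" "s \<ge> 0"
  shows "real (chain_index n s i) * \<tau> n \<le> real i * s"
    and "real i * s < (real (chain_index n s i) + 1) * \<tau> n"
proof -
  have h: "\<tau> n > 0" using time_step_pos assms by simp
  have "real (chain_index n s i) = of_int \<lfloor>real i * s / \<tau> n\<rfloor>"
    unfolding chain_index_def using assms h by (intro of_nat_nat) simp
  then have "real (chain_index n s i) \<le> real i * s / \<tau> n"
    "real i * s / \<tau> n < real (chain_index n s i) + 1" by linarith+
  then show "real (chain_index n s i) * \<tau> n \<le> real i * s"
    "real i * s < (real (chain_index n s i) + 1) * \<tau> n"
    using h by (simp_all add: le_divide_eq divide_less_eq)
qed

lemma mono_chain_index: "n \<ge> 1 \<Longrightarrow> s \<ge> 0 \<Longrightarrow> mono (chain_index n s)"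
  unfolding chain_index_def using time_step_pos[of n]
  by (intro monoI nat_mono floor_mono divide_right_mono mult_right_mono) auto

lemma chain_index_increment_tendsto:
  assumes s: "s \<ge> 0"
  shows "(\<lambda>n. real (chain_index n s (Suc j) - chain_index n s j) * \<tau> n) \<longlonglongrightarrow> s"
proof -
  have lim: "(\<lambda>n. real (chain_index n s i) * \<tau> n) \<longlonglongrightarrow> real i * s" for i
  proof (rule tendsto_sandwich)
    have ev: "\<forall>\<^sub>F n in sequentially. n \<ge> (1::nat)" by (rule eventually_ge_at_top)
    show "\<forall>\<^sub>F n in sequentially. real i * s - \<tau> n \<le> real (chain_index n s i) * \<tau> n"
      using ev
    proof eventually_elim
      case (elim n)
      then show ?case using chain_index_bounds(2)[of n s i] s by (simp add: distrib_right)
    qed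
    show "\<forall>\<^sub>F n in sequentially. real (chain_index n s i) * \<tau> n \<le> real i * s"
      using ev by eventually_elim (rule chain_index_bounds(1)[OF _ s])
    show "(\<lambda>n. real i * s - \<tau> n) \<longlonglongrightarrow> real i * s"
      using tendsto_diff[OF tendsto_const time_step_tendsto_0, of "real i * s"] by simp
  qed simp
  have "(\<lambda>n. real (chain_index n s (Suc j)) * \<tau> n - real (chain_index n s j) * \<tau> n)
    \<longlonglongrightarrow> real (Suc j) * s - real j * s"
    by (intro tendsto_diff lim)
  moreover have "\<forall>\<^sub>F n in sequentially. real (chain_index n s (Suc j)) * \<tau> n - real (chain_index n s j) * \<tau> n
      = real (chain_index n s (Suc j) - chain_index n s j) * \<tau> n"
    using eventually_ge_at_top[of "1::nat"]
  proof eventually_elim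
    case (elim n)
    \<comment> \<open>Monotonicity keeps the subtraction of natural numbers from being
      truncated.\<close>
    have "chain_index n s j \<le> chain_index n s (Suc j)"
      using mono_chain_index[OF elim s] by (simp add: monoD)
    then show ?case by (simp add: of_nat_diff left_diff_distrib)
  qed
  ultimately have "(\<lambda>n. real (chain_index n s (Suc j) - chain_index n s j) * \<tau> n)
    \<longlonglongrightarrow> real (Suc j) * s - real j * s" by (rule Lim_transform_eventually)
  then show ?thesis by (simp add: algebra_simps)
qed

text \<open>Functionals of the path frozen at step J depend on finitely many states, hence are
  measurable; the error of freezing decays geometrically in J.\<close>

lemma chain_path_functional_measurable:
  assumes mc: "markov_chain M {0..n} \<pi>0 (Q n) X" and n: "n \<ge> 2"
    and \<psi>: "path_lipschitz l r L \<psi>" and L: "L \<ge> 0"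
  shows "(\<lambda>\<omega>. \<psi> (chain_path n (\<lambda>k. X k \<omega>))) \<in> borel_measurable M"
proof -
  interpret finite_chain M "{0..n}" \<pi>0 "Q n" X
    by standard (fact mc, simp)
  have h: "\<tau> n > 0" using time_step_pos n by simp
  let ?\<Phi> = "\<lambda>J p. \<psi> (chain_path n (\<lambda>k. p (min k J)))"
  have meas: "(\<lambda>\<omega>. ?\<Phi> J (\<lambda>k. X k \<omega>)) \<in> borel_measurable M" for J
  proof (rule functional_measurable[of J])
    show "depends_upto J (?\<Phi> J)"
      unfolding depends_upto_def
    proof (intro allI impI)
      fix p p' :: "nat \<Rightarrow> nat" assume "\<forall>m\<le>J. p m = p' m"
      then have "(\<lambda>k. p (min k J)) = (\<lambda>k. p' (min k J))" by auto
      then show "?\<Phi> J p = ?\<Phi> J p'" by simp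
    qed
  qed
  have lim: "(\<lambda>J. ?\<Phi> J (\<lambda>k. X k \<omega>)) \<longlonglongrightarrow> \<psi> (chain_path n (\<lambda>k. X k \<omega>))" if w: "\<omega> \<in> space M" for \<omega>
  proof -
    have X: "X k \<omega> \<le> n" for k using X_mem[OF w, of k] by simp
    have n1: "n \<ge> 1" using n by simp
    have "\<bar>?\<Phi> J (\<lambda>k. X k \<omega>) - \<psi> (chain_path n (\<lambda>k. X k \<omega>))\<bar> \<le> L * ((r - l) * exp (- \<tau> n) ^ J)" for J
    proof -
      have "\<bar>?\<Phi> J (\<lambda>k. X k \<omega>) - \<psi> (chain_path n (\<lambda>k. X k \<omega>))\<bar>
        \<le> L * path_dist (chain_path n (\<lambda>k. X (min k J) \<omega>)) (chain_path n (\<lambda>k. X k \<omega>))"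
        using \<psi>[unfolded path_lipschitz_def] chain_path_mem[OF n1, of "\<lambda>k. X k \<omega>", OF X]
          chain_path_mem[OF n1, of "\<lambda>k. X (min k J) \<omega>", OF X] by blast
      also have "\<dots> \<le> L * ((r - l) * exp (- (real J * \<tau> n)))"
        unfolding path_dist_commute[of "chain_path n (\<lambda>k. X (min k J) \<omega>)"]
        unfolding chain_path_def using l_less_r
        by (intro mult_left_mono L path_dist_step_path_truncate[OF h] grid_mem[OF n1 X]) simp
      also have "exp (- (real J * \<tau> n)) = exp (- \<tau> n) ^ J"
        using exp_of_nat_mult[of J "- \<tau> n"] by simp
      finally show ?thesis .
    qed
    moreover have "(\<lambda>J. L * ((r - l) * exp (- \<tau> n) ^ J)) \<longlonglongrightarrow> L * ((r - l) * 0)"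
      using h by (intro tendsto_mult tendsto_const LIMSEQ_realpow_zero) auto
    moreover have "L * ((r - l) * 0) = 0" by simp
    ultimately have "(\<lambda>J. ?\<Phi> J (\<lambda>k. X k \<omega>) - \<psi> (chain_path n (\<lambda>k. X k \<omega>))) \<longlonglongrightarrow> 0"
      unfolding real_norm_def[symmetric] by (metis (no_types, lifting) Lim_null_comparison always_eventually)
    then show ?thesis by (rule LIM_zero_cancel)
  qed
  show ?thesis by (rule borel_measurable_LIMSEQ_real[OF lim meas])
qed

lemma chain_approx_measurable:
  assumes mc: "markov_chain M {0..n} \<pi>0 (Q n) X"
  shows "(\<lambda>\<omega>. bump_product m Z p (chain_path n (\<lambda>k. X k \<omega>))) \<in> borel_measurable M"
proof -
  interpret finite_chain M "{0..n}" \<pi>0 "Q n" X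
    by standard (fact mc, simp)
  have "(\<lambda>\<omega>. bump Z (1 / real m) (p i) (chain_path n (\<lambda>k. X k \<omega>) (real i * (1 / real m)))) \<in> borel_measurable M" for i
  proof -
    have "(\<lambda>\<omega>. (\<lambda>x. bump Z (1 / real m) (p i) (grid l r n x)) (X (chain_index n (1 / real m) i) \<omega>)) \<in> borel_measurable M"
      by (rule measurable_compose[OF measurable_X]) simp
    then show ?thesis by (simp add: chain_path_eval[of "1 / real m"] del: times_divide_eq_right)
  qed
  then show ?thesis unfolding bump_product_def by (rule borel_measurable_prod)
qed

text \<open>With \<open>\<beta> = sqrt m\<close> the bound of \<open>chain_oscillation\<close> over a time interval of length \<open>1 / m\<close> is
  exponentially small in \<open>sqrt m\<close>, so it survives the union over the \<open>m * K\<close> intervals.\<close>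

lemma chain_approx_error:
  assumes mc: "markov_chain M {0..n} \<pi>0 (Q n) X" and n: "n \<ge> 2"
    and \<psi>: "path_lipschitz l r L \<psi>" and L: "L \<ge> 0"
    and B: "\<And>w. w \<in> cadlag_paths {l..r} \<Longrightarrow> \<bar>\<psi> w\<bar> \<le> B"
    and m: "m \<ge> 1" and Z: "is_net l r Z (1 / real m)" and K: "K \<le> m" and e: "\<epsilon> \<ge> 0"
    and \<eta>: "\<And>x y. x \<in> {l..r} \<Longrightarrow> y \<in> {l..r} \<Longrightarrow>
      \<bar>cos (pi / (r - l) * (x - l)) - cos (pi / (r - l) * (y - l))\<bar> < \<eta> \<Longrightarrow> \<bar>x - y\<bar> \<le> \<epsilon>"
    and h: "\<tau> n \<le> 1 / real m" and \<beta>: "sqrt (real m) * (pi / real n) \<le> 1"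
  shows "\<bar>(\<integral>\<omega>. \<psi> (chain_path n (\<lambda>k. X k \<omega>)) \<partial>M) - (\<integral>\<omega>. path_approx \<psi> m Z (chain_path n (\<lambda>k. X k \<omega>)) \<partial>M)\<bar>
    \<le> L * (1 / real m + \<epsilon> + (r - l) * exp (- real K))
      + 2 * B * (real (m * K) * (2 * exp (4 * drift_const - sqrt (real m) * \<eta>)))"
proof -
  interpret finite_chain M "{0..n}" \<pi>0 "Q n" X
    by standard (fact mc, simp)
  let ?w = "\<lambda>\<omega>. chain_path n (\<lambda>k. X k \<omega>)"
  let ?h = "\<tau> n" and ?s = "1 / real m" and ?c = "cos_coord n"
  let ?E = "L * (1 / real m + \<epsilon> + (r - l) * exp (- real K))"
  let ?p = "2 * exp (4 * drift_const - sqrt (real m) * \<eta>)"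
  have hp: "?h > 0" using time_step_pos n by simp
  have mp: "real m > 0" using m by simp
  have s0: "?s \<ge> 0" by simp
  have n1: "n \<ge> 1" using n by simp
  \<comment> \<open>An upper bound for the number of chain steps between the index sampled at i / m
    and the index of any time before (i + 1) / m; the extra step accounts for rounding at the left
    end.\<close>
  define N where "N = nat \<lfloor>?s / ?h\<rfloor> + 1"
  let ?j = "chain_index n ?s"
  define bad where "bad i = {\<omega>\<in>space M. \<exists>k\<le>N. \<bar>?c (X (?j i + k) \<omega>) - ?c (X (?j i) \<omega>)\<bar> \<ge> \<eta>}" for i
  have bad_sets: "bad i \<in> sets M" for i
    unfolding bad_def
    by (rule event_sets[of "?j i + N" "\<lambda>p. \<exists>k\<le>N. \<bar>?c (p (?j i + k)) - ?c (p (?j i))\<bar> \<ge> \<eta>"])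
       (simp cong: conj_cong)
  have Nh: "real N * ?h \<le> 2 / real m"
  proof -
    have "real N = of_int \<lfloor>?s / ?h\<rfloor> + 1"
      unfolding N_def using hp by (simp add: of_nat_nat)
    then have "real N \<le> ?s / ?h + 1" by linarith
    then have "real N * ?h \<le> (?s / ?h + 1) * ?h" using hp by (intro mult_right_mono) auto
    also have "\<dots> = ?s + ?h" using hp by (simp add: distrib_right)
    finally show ?thesis using h by simp
  qed
  have bad_le: "measure M (bad i) \<le> ?p" for i
  proof -
    have "measure M (bad i) \<le> 2 * exp (drift_const * (sqrt (real m) + (sqrt (real m))\<^sup>2) * (real N * ?h) - sqrt (real m) * \<eta>)"
      unfolding bad_def by (rule chain_oscillation[OF mc n _ \<beta>]) simp
    also have "\<dots> \<le> ?p"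
    proof -
      \<comment> \<open>Origin of the constant 4: with \<beta> = sqrt m, \<beta> + \<beta>^2 is at
        most 2 m, and the elapsed time is at most 2 / m.\<close>
      have "sqrt (real m) \<le> real m" using m by (intro real_le_lsqrt) (auto simp: power2_eq_square)
      then have "sqrt (real m) + (sqrt (real m))\<^sup>2 \<le> 2 * real m" by simp
      then have "(sqrt (real m) + (sqrt (real m))\<^sup>2) * (real N * ?h) \<le> (2 * real m) * (2 / real m)"
        using Nh hp by (intro mult_mono) auto
      also have "\<dots> = 4" using mp by simp
      finally have "drift_const * ((sqrt (real m) + (sqrt (real m))\<^sup>2) * (real N * ?h)) \<le> drift_const * 4"
        using drift_const_pos by (intro mult_left_mono) auto
      then show ?thesis by (simp add: mult.assoc)
    qed
    finally show ?thesis .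
  qed
  \<comment> \<open>These m * K intervals of length 1 / m cover [0,K).\<close>
  define Bad where "Bad = (\<Union>i<m * K. bad i)"
  have Bad_sets: "Bad \<in> sets M" unfolding Bad_def using bad_sets by blast
  have Bad_le: "measure M Bad \<le> real (m * K) * ?p"
  proof -
    have "measure M Bad \<le> (\<Sum>i<m * K. measure M (bad i))"
      unfolding Bad_def by (intro finite_measure_subadditive_finite) (use bad_sets in auto)
    also have "\<dots> \<le> (\<Sum>i<m * K. ?p)" by (intro sum_mono bad_le)
    finally show ?thesis by simp
  qed
  have wmem: "?w \<omega> \<in> cadlag_paths {l..r}" if "\<omega> \<in> space M" for \<omega>
    using X_mem[OF that] by (intro chain_path_mem[OF n1]) simp
  have B0: "B \<ge> 0" if "\<omega> \<in> space M" for \<omega>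
    using B[OF wmem[OF that]] by linarith
  have good: "\<bar>\<psi> (?w \<omega>) - path_approx \<psi> m Z (?w \<omega>)\<bar> \<le> ?E" if w: "\<omega> \<in> space M" "\<omega> \<notin> Bad" for \<omega>
  proof (rule path_approx_error[OF Z m wmem[OF w(1)] \<psi> L K e])
    fix t :: real assume t: "0 \<le> t" "t < real K"
    define i where "i = nat \<lfloor>t * real m\<rfloor>"
    define q where "q = nat \<lfloor>t / ?h\<rfloor>"
    have "real i = of_int \<lfloor>t * real m\<rfloor>" unfolding i_def using t by (intro of_nat_nat) simp
    then have i: "real i \<le> t * real m" "t * real m < real i + 1" by linarith+
    have "real i < real K * real m" using i(1) t(2) mp by (smt (verit) mult_strict_right_mono)
    then have "real i < real (m * K)" by (simp add: mult.commute)
    then have iK: "i < m * K" by (simp only: of_nat_less_iff)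
    have "real q = of_int \<lfloor>t / ?h\<rfloor>" unfolding q_def using t hp by (intro of_nat_nat) simp
    then have q: "real q \<le> t / ?h" "t / ?h < real q + 1" by linarith+
    have tt: "real i * ?s \<le> t" "t < real i * ?s + ?s"
      using i mp by (simp_all add: divide_le_eq less_divide_eq flip: add_divide_distrib)
    have le: "?j i \<le> q"
      unfolding chain_index_def q_def using tt hp by (intro nat_mono floor_mono divide_right_mono) auto
    have "real q * ?h \<le> t" using q hp by (simp add: le_divide_eq)
    also have "t < real i * ?s + ?s" by (rule tt(2))
    also have "\<dots> < (real (?j i) + 1) * ?h + ?s" using chain_index_bounds(2)[OF n1 s0, of i] by simp
    finally have "real q * ?h < (real (?j i) + 1 + ?s / ?h) * ?h" using hp by (simp add: distrib_right)
    then have "real q < real (?j i) + 1 + ?s / ?h" using hp by simp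
    moreover have "?s / ?h < real N"
      unfolding N_def using hp by (simp add: of_nat_nat) linarith
    ultimately have "real q < real (?j i + 1 + N)" by simp
    then have "q - ?j i \<le> N" by linarith
    with w iK have "\<not> \<bar>?c (X (?j i + (q - ?j i)) \<omega>) - ?c (X (?j i) \<omega>)\<bar> \<ge> \<eta>"
      unfolding Bad_def bad_def by blast
    then have "\<bar>?c (X q \<omega>) - ?c (X (?j i) \<omega>)\<bar> < \<eta>" using le by simp
    then have "\<bar>grid l r n (X q \<omega>) - grid l r n (X (?j i) \<omega>)\<bar> \<le> \<epsilon>"
      using X_mem[OF w(1)] unfolding cos_coord_eq[OF n1] by (intro \<eta> grid_mem[OF n1]) simp_all
    moreover have "?w \<omega> t = grid l r n (X q \<omega>)" using t by (simp add: chain_path_def step_path_def q_def)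
    moreover have "?w \<omega> (real i * ?s) = grid l r n (X (?j i) \<omega>)" by (rule chain_path_eval[OF s0])
    ultimately show "\<bar>?w \<omega> t - ?w \<omega> (real (nat \<lfloor>t * real m\<rfloor>) * ?s)\<bar> \<le> \<epsilon>" by (simp add: i_def)
  qed (use l_less_r in simp)
  have E0: "?E \<ge> 0" using L e l_less_r by simp
  have m1: "(\<lambda>\<omega>. \<psi> (?w \<omega>)) \<in> borel_measurable M"
    by (rule chain_path_functional_measurable[OF mc n \<psi> L])
  have m2: "(\<lambda>\<omega>. path_approx \<psi> m Z (?w \<omega>)) \<in> borel_measurable M"
    unfolding path_approx_def
    by (intro borel_measurable_sum borel_measurable_times borel_measurable_const chain_approx_measurable[OF mc])
  have ab: "\<bar>path_approx \<psi> m Z (?w \<omega>)\<bar> \<le> B" if "\<omega> \<in> space M" for \<omega>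
    by (rule abs_path_approx_le[OF Z m wmem[OF that] B])
  have i1: "integrable M (\<lambda>\<omega>. \<psi> (?w \<omega>))"
    by (rule integrable_const_bound[where B = B, OF _ m1]) (simp add: B wmem)
  have i2: "integrable M (\<lambda>\<omega>. path_approx \<psi> m Z (?w \<omega>))"
    by (rule integrable_const_bound[where B = B, OF _ m2]) (simp add: ab)
  have i3: "integrable M (\<lambda>\<omega>. indicator Bad \<omega> :: real)"
    using Bad_sets by (intro integrable_real_indicator) (simp_all add: emeasure_eq_measure)
  have "\<bar>(\<integral>\<omega>. \<psi> (?w \<omega>) \<partial>M) - (\<integral>\<omega>. path_approx \<psi> m Z (?w \<omega>) \<partial>M)\<bar>
    = \<bar>\<integral>\<omega>. \<psi> (?w \<omega>) - path_approx \<psi> m Z (?w \<omega>) \<partial>M\<bar>"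
    using i1 i2 by simp
  also have "\<dots> \<le> (\<integral>\<omega>. \<bar>\<psi> (?w \<omega>) - path_approx \<psi> m Z (?w \<omega>)\<bar> \<partial>M)" by (rule integral_abs_bound)
  \<comment> \<open>Off \<open>Bad\<close> the pathwise estimate holds; on \<open>Bad\<close> the
    trivial bound 2 B is paid.\<close>
  also have "\<dots> \<le> (\<integral>\<omega>. ?E + 2 * B * indicator Bad \<omega> \<partial>M)"
  proof (rule integral_mono)
    show "integrable M (\<lambda>\<omega>. \<bar>\<psi> (?w \<omega>) - path_approx \<psi> m Z (?w \<omega>)\<bar>)"
      by (intro integrable_abs Bochner_Integration.integrable_diff i1 i2)
    show "integrable M (\<lambda>\<omega>. ?E + 2 * B * indicator Bad \<omega>)"
      by (intro Bochner_Integration.integrable_add integrable_const integrable_mult_right i3)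
    fix \<omega> assume w: "\<omega> \<in> space M"
    show "\<bar>\<psi> (?w \<omega>) - path_approx \<psi> m Z (?w \<omega>)\<bar> \<le> ?E + 2 * B * indicator Bad \<omega>"
    proof (cases "\<omega> \<in> Bad")
      case True
      have "\<bar>\<psi> (?w \<omega>) - path_approx \<psi> m Z (?w \<omega>)\<bar> \<le> \<bar>\<psi> (?w \<omega>)\<bar> + \<bar>path_approx \<psi> m Z (?w \<omega>)\<bar>" by linarith
      also have "\<dots> \<le> 2 * B" using ab[OF w] B[OF wmem[OF w]] by linarith
      also have "\<dots> \<le> ?E + 2 * B * indicator Bad \<omega>" using E0 True by simp
      finally show ?thesis .
    next
      case False
      then show ?thesis using good[OF w] by simp
    qed
  qed
  also have "\<dots> = ?E + 2 * B * measure M Bad"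
    using i3 Bad_sets sets.sets_into_space[OF Bad_sets] by (simp add: prob_space Int_absorb2)
  also have "\<dots> \<le> ?E + 2 * B * (real (m * K) * ?p)"
  proof -
    obtain \<omega> where "\<omega> \<in> space M" using not_empty by blast
    then have "0 \<le> 2 * B" using B0 by simp
    then show ?thesis using Bad_le by (intro add_left_mono mult_left_mono)
  qed
  finally show ?thesis .
qed

end

text \<open>With x = sqrt m * \<eta> the expression is c / \<eta>^2 times x^2 exp(-x).\<close>

lemma stretched_exp_tendsto_0:
  assumes "\<eta> > 0"
  shows "(\<lambda>m. c * (real m * exp (- (sqrt (real m) * \<eta>)))) \<longlonglongrightarrow> 0"
proof -
  have "filterlim (\<lambda>m. sqrt (real m) * \<eta>) at_top sequentially"
    using assms by (intro filterlim_at_top_mult_tendsto_pos[where c = \<eta>] tendsto_const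
      filterlim_compose[OF sqrt_at_top] filterlim_real_sequentially)
  from filterlim_compose[OF tendsto_power_div_exp_0[of 2] this]
  have "(\<lambda>m. c / \<eta>\<^sup>2 * ((sqrt (real m) * \<eta>)\<^sup>2 / exp (sqrt (real m) * \<eta>))) \<longlonglongrightarrow> c / \<eta>\<^sup>2 * 0"
    by (intro tendsto_mult tendsto_const)
  also have "(\<lambda>m. c / \<eta>\<^sup>2 * ((sqrt (real m) * \<eta>)\<^sup>2 / exp (sqrt (real m) * \<eta>)))
      = (\<lambda>m. c * (real m * exp (- (sqrt (real m) * \<eta>))))"
    using assms by (intro ext) (simp add: power_mult_distrib exp_minus inverse_eq_divide)
  finally show ?thesis by simp
qed

subsection \<open>Convergence in law\<close>

locale approximating_chains = reflecting_diffusion +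
  fixes N :: "'a measure" and Y :: "real \<Rightarrow> 'a \<Rightarrow> real"
    and M :: "nat \<Rightarrow> 'b measure" and \<pi>0 :: "nat \<Rightarrow> nat pmf" and X :: "nat \<Rightarrow> nat \<Rightarrow> 'b \<Rightarrow> nat"
  assumes Y: "diffusion_process l r P N Y"
    and mc: "\<And>n. n \<ge> 2 \<Longrightarrow> markov_chain (M n) {0..n} (\<pi>0 n) (Q n) (X n)"
    and init: "converges_in_law 2 (top_of_set {l..r}) M (\<lambda>n. interpolated_chain l r b n (X n) 0) N (Y 0)"
begin

abbreviation "random_path n \<omega> \<equiv> chain_path n (\<lambda>k. X n k \<omega>)"

text \<open>Both moments are expectations of a function of the starting point. On the grid the
  functions \<open>C n\<close> of the chain are uniformly close to the limit function, which is
  continuous, so convergence of the initial laws finishes the argument.\<close>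

lemma chain_product_tendsto:
  fixes f :: "nat \<Rightarrow> real \<Rightarrow> real"
  assumes f: "\<And>j. continuous_on {l..r} (f j)" and s: "s \<ge> 0"
  shows "(\<lambda>n. \<integral>\<omega>. (\<Prod>i\<le>K. f i (random_path n \<omega> (real i * s))) \<partial>M n)
    \<longlonglongrightarrow> (\<integral>\<omega>. (\<Prod>i\<le>K. f i (path_of Y \<omega> (real i * s))) \<partial>N)"
proof -
  let ?D = "diffusion_product s K f"
  define C where "C n = chain_product {0..n} (Q n) K (chain_index n s) (\<lambda>j i. f j (grid l r n i))" for n
  have D: "continuous_on {l..r} ?D" by (rule continuous_diffusion_product[OF f s])
  have "continuous_map (top_of_set {l..r}) euclideanreal ?D" using D by simp
  moreover have "bounded (?D ` topspace (top_of_set {l..r}))"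
    using D by (simp add: compact_imp_bounded compact_continuous_image)
  ultimately have lim: "(\<lambda>n. \<integral>\<omega>. ?D (interpolated_chain l r b n (X n) 0 \<omega>) \<partial>M n) \<longlonglongrightarrow> (\<integral>\<omega>. ?D (Y 0 \<omega>) \<partial>N)"
    using init unfolding converges_in_law_def by blast
  have eq: "(\<integral>\<omega>. (\<Prod>i\<le>K. f i (random_path n \<omega> (real i * s))) \<partial>M n) = (\<integral>\<omega>. C n (X n 0 \<omega>) \<partial>M n)"
    if n: "n \<ge> 2" for n
  proof -
    interpret finite_chain "M n" "{0..n}" "\<pi>0 n" "Q n" "X n"
      by standard (fact mc[OF n], simp)
    have mono: "mono (chain_index n s)" using n s by (intro mono_chain_index) auto
    have z: "chain_index n s 0 = 0" by (simp add: chain_index_def)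
    have "expectation (\<lambda>\<omega>. 1 * (\<Prod>i\<le>K. f i (grid l r n (X n (chain_index n s i) \<omega>))))
      = expectation (\<lambda>\<omega>. 1 * C n (X n (chain_index n s 0) \<omega>))"
      unfolding C_def
      by (rule expectation_product[OF mono, where \<Phi> = "\<lambda>_. 1" and f = "\<lambda>j i. f j (grid l r n i)"])
         (simp add: depends_upto_def)
    then show ?thesis by (simp add: chain_path_eval[OF s] z)
  qed
  have gc: "grid_converges C ?D"
    unfolding C_def by (rule grid_converges_product[where f = f and k = "\<lambda>n. chain_index n s"])
      (fact f s chain_index_increment_tendsto[OF s])+
  have diff: "(\<lambda>n. (\<integral>\<omega>. C n (X n 0 \<omega>) \<partial>M n) - (\<integral>\<omega>. ?D (interpolated_chain l r b n (X n) 0 \<omega>) \<partial>M n)) \<longlonglongrightarrow> 0"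
  proof (rule tendstoI)
    fix e :: real assume e: "e > 0"
    have "\<forall>\<^sub>F n in sequentially. \<forall>i\<le>n. \<bar>C n i - ?D (grid l r n i)\<bar> \<le> e / 2"
      using gc half_gt_zero[OF e] unfolding grid_converges_def by blast
    moreover have "\<forall>\<^sub>F n in sequentially. n \<ge> (2::nat)" by (rule eventually_ge_at_top)
    ultimately show "\<forall>\<^sub>F n in sequentially. dist ((\<integral>\<omega>. C n (X n 0 \<omega>) \<partial>M n)
        - (\<integral>\<omega>. ?D (interpolated_chain l r b n (X n) 0 \<omega>) \<partial>M n)) 0 < e"
    proof eventually_elim
      case (elim n)
      interpret finite_chain "M n" "{0..n}" "\<pi>0 n" "Q n" "X n"
        by standard (fact mc[OF elim(2)], simp)
      have int: "integrable (M n) (\<lambda>\<omega>. g (X n 0 \<omega>))" for g :: "nat \<Rightarrow> real"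
        by (rule functional_integrable[of 0 "\<lambda>p. g (p 0)"]) (simp add: depends_upto_def)
      have "(\<integral>\<omega>. C n (X n 0 \<omega>) \<partial>M n) - (\<integral>\<omega>. ?D (interpolated_chain l r b n (X n) 0 \<omega>) \<partial>M n)
        = (\<integral>\<omega>. C n (X n 0 \<omega>) - ?D (grid l r n (X n 0 \<omega>)) \<partial>M n)"
        using int[of "C n"] int[of "\<lambda>i. ?D (grid l r n i)"] by (simp add: interpolated_chain_def)
      also have "\<bar>\<dots>\<bar> \<le> (\<integral>\<omega>. \<bar>C n (X n 0 \<omega>) - ?D (grid l r n (X n 0 \<omega>))\<bar> \<partial>M n)" by (rule integral_abs_bound)
      also have "\<dots> \<le> (\<integral>\<omega>. e / 2 \<partial>M n)"
      proof (rule integral_mono[OF int[of "\<lambda>i. \<bar>C n i - ?D (grid l r n i)\<bar>"] integrable_const])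
        fix \<omega> assume "\<omega> \<in> space (M n)"
        then have "X n 0 \<omega> \<le> n" using X_mem[of \<omega> 0] by simp
        then show "\<bar>C n (X n 0 \<omega>) - ?D (grid l r n (X n 0 \<omega>))\<bar> \<le> e / 2" using elim(1) by blast
      qed
      also have "\<dots> = e / 2" by (simp add: prob_space)
      finally show ?case using e by (simp add: dist_real_def)
    qed
  qed
  have "(\<lambda>n. \<integral>\<omega>. C n (X n 0 \<omega>) \<partial>M n) \<longlonglongrightarrow> (\<integral>\<omega>. ?D (Y 0 \<omega>) \<partial>N)"
    using tendsto_add[OF diff lim] by simp
  moreover have "\<forall>\<^sub>F n in sequentially. (\<integral>\<omega>. C n (X n 0 \<omega>) \<partial>M n)
      = (\<integral>\<omega>. (\<Prod>i\<le>K. f i (random_path n \<omega> (real i * s))) \<partial>M n)"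
    using eventually_ge_at_top[of "2::nat"] by eventually_elim (rule eq[symmetric])
  ultimately have "(\<lambda>n. \<integral>\<omega>. (\<Prod>i\<le>K. f i (random_path n \<omega> (real i * s))) \<partial>M n)
    \<longlonglongrightarrow> (\<integral>\<omega>. ?D (Y 0 \<omega>) \<partial>N)" by (rule Lim_transform_eventually)
  then show ?thesis unfolding diffusion_process_product[OF Y f s] .
qed

text \<open>For fixed m the approximation is a finite linear combination of product moments; the
  values of \<open>\<psi>\<close> on the net paths are mere coefficients.\<close>

lemma chain_approx_tendsto:
  assumes Z: "is_net l r Z (1 / real m)"
  shows "(\<lambda>n. \<integral>\<omega>. path_approx \<psi> m Z (random_path n \<omega>) \<partial>M n)
    \<longlonglongrightarrow> (\<integral>\<omega>. path_approx \<psi> m Z (path_of Y \<omega>) \<partial>N)"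
proof -
  note facts = diffusion_process_facts[OF Y]
  interpret N: prob_space N by (rule facts(1))
  let ?S = "PiE {..m * m} (\<lambda>_. Z)"
  have le1: "\<bar>bump_product m Z p w\<bar> \<le> 1" if p: "p \<in> ?S" and w: "\<And>t. t \<ge> 0 \<Longrightarrow> w t \<in> {l..r}" for p w
  proof -
    have "finite ?S" using Z by (intro finite_PiE) (auto simp: is_net_def)
    then have "bump_product m Z p w \<le> (\<Sum>p\<in>?S. bump_product m Z p w)"
      using p by (intro member_le_sum bump_product_nonneg) auto
    then show ?thesis using sum_bump_product[OF Z w] bump_product_nonneg[of m Z p w] by simp
  qed
  have lhs: "(\<integral>\<omega>. path_approx \<psi> m Z (random_path n \<omega>) \<partial>M n)
    = (\<Sum>p\<in>?S. \<psi> (net_path m p) * (\<integral>\<omega>. bump_product m Z p (random_path n \<omega>) \<partial>M n))"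
    if n: "n \<ge> 2" for n
  proof -
    interpret finite_chain "M n" "{0..n}" "\<pi>0 n" "Q n" "X n"
      by standard (fact mc[OF n], simp)
    have "integrable (M n) (\<lambda>\<omega>. bump_product m Z p (random_path n \<omega>))" if p: "p \<in> ?S" for p
    proof (rule integrable_const_bound[where B = 1, OF _ chain_approx_measurable[OF mc[OF n]]])
      have "\<bar>bump_product m Z p (random_path n \<omega>)\<bar> \<le> 1" if "\<omega> \<in> space (M n)" for \<omega>
        using X_mem[OF that] n by (intro le1[OF p] cadlag_paths_bounds[OF chain_path_mem]) simp_all
      then show "AE \<omega> in M n. norm (bump_product m Z p (random_path n \<omega>)) \<le> 1"
        by (intro AE_I2) simp
    qed
    then show ?thesis unfolding path_approx_def by (subst Bochner_Integration.integral_sum) simp_all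
  qed
  have rhs: "(\<integral>\<omega>. path_approx \<psi> m Z (path_of Y \<omega>) \<partial>N)
    = (\<Sum>p\<in>?S. \<psi> (net_path m p) * (\<integral>\<omega>. bump_product m Z p (path_of Y \<omega>) \<partial>N))"
  proof -
    have "integrable N (\<lambda>\<omega>. bump_product m Z p (path_of Y \<omega>))" if p: "p \<in> ?S" for p
    proof (rule N.integrable_const_bound[where B = 1])
      have "\<bar>bump_product m Z p (path_of Y \<omega>)\<bar> \<le> 1" if "\<omega> \<in> space N" for \<omega>
        by (rule le1[OF p continuous_paths_bounds[OF facts(4)[OF that]]])
      then show "AE \<omega> in N. norm (bump_product m Z p (path_of Y \<omega>)) \<le> 1" by (intro AE_I2) simp
      show "(\<lambda>\<omega>. bump_product m Z p (path_of Y \<omega>)) \<in> borel_measurable N"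
        by (rule measurable_compose[OF facts(2) bump_product_measurable[OF Z]])
    qed
    then show ?thesis unfolding path_approx_def by (subst Bochner_Integration.integral_sum) simp_all
  qed
  have "(\<lambda>n. \<Sum>p\<in>?S. \<psi> (net_path m p) * (\<integral>\<omega>. bump_product m Z p (random_path n \<omega>) \<partial>M n))
    \<longlonglongrightarrow> (\<Sum>p\<in>?S. \<psi> (net_path m p) * (\<integral>\<omega>. bump_product m Z p (path_of Y \<omega>) \<partial>N))"
    unfolding bump_product_def
    by (intro tendsto_sum tendsto_mult tendsto_const chain_product_tendsto continuous_bump[OF Z]) simp_all
  moreover have "\<forall>\<^sub>F n in sequentially. (\<Sum>p\<in>?S. \<psi> (net_path m p) * (\<integral>\<omega>. bump_product m Z p (random_path n \<omega>) \<partial>M n))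
    = (\<integral>\<omega>. path_approx \<psi> m Z (random_path n \<omega>) \<partial>M n)"
    using eventually_ge_at_top[of "2::nat"] by eventually_elim (rule lhs[symmetric])
  ultimately show ?thesis unfolding rhs by (rule Lim_transform_eventually)
qed

text \<open>The order of choices matters: K and \<eta> from the tolerance, then m large enough for
  the limit process and for the union bound uniformly in n, and n last. Four errors of at most e / 4
  arise: pathwise approximation, bad event, convergence at fixed m, and approximation of the
  limit.\<close>

lemma chain_path_lipschitz_tendsto:
  assumes \<psi>: "path_lipschitz l r L \<psi>" and L: "L \<ge> 0"
    and B: "\<And>w. w \<in> cadlag_paths {l..r} \<Longrightarrow> \<bar>\<psi> w\<bar> \<le> B"
  shows "(\<lambda>n. \<integral>\<omega>. \<psi> (random_path n \<omega>) \<partial>M n) \<longlonglongrightarrow> (\<integral>\<omega>. \<psi> (path_of Y \<omega>) \<partial>N)"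
proof (rule tendstoI)
  fix e :: real assume e: "e > 0"
  have "\<forall>m. \<exists>Z. m \<ge> 1 \<longrightarrow> is_net l r Z (1 / real m)" using net_exists by simp
  then obtain Z where Z: "\<And>m. m \<ge> 1 \<Longrightarrow> is_net l r (Z m) (1 / real m)" by metis
  \<comment> \<open>Three error terms of size at most \<epsilon>, multiplied by L, must stay within
    e / 4; L + 1 avoids division by 0.\<close>
  define \<epsilon> where "\<epsilon> = e / (12 * (L + 1))"
  have eps: "\<epsilon> > 0" using e L by (simp add: \<epsilon>_def)
  obtain K :: nat where K: "(r - l) * exp (- real K) < \<epsilon>" using exp_tail_small[OF eps] by blast
  obtain \<eta> where \<eta>: "\<eta> > 0" "\<And>x y. x \<in> {l..r} \<Longrightarrow> y \<in> {l..r} \<Longrightarrow>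
    \<bar>cos (pi / (r - l) * (x - l)) - cos (pi / (r - l) * (y - l))\<bar> < \<eta> \<Longrightarrow> \<bar>x - y\<bar> \<le> \<epsilon>"
    using cos_inverse_uniform[OF l_less_r eps] by blast
  let ?I = "\<integral>\<omega>. \<psi> (path_of Y \<omega>) \<partial>N"
  let ?A = "\<lambda>m. \<integral>\<omega>. path_approx \<psi> m (Z m) (path_of Y \<omega>) \<partial>N"
  let ?c = "2 * B * (real K * (2 * exp (4 * drift_const)))"
  have e4: "e / 4 > 0" using e by simp
  have "\<forall>\<^sub>F m in sequentially. dist (?A m) ?I < e / 4"
    by (rule tendstoD[OF diffusion_process_approx(2)[OF Y Z \<psi> L B] e4])
  moreover have "\<forall>\<^sub>F m in sequentially. ?c * (real m * exp (- (sqrt (real m) * \<eta>))) < e / 4"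
    by (rule order_tendstoD(2)[OF stretched_exp_tendsto_0[OF \<eta>(1)] e4])
  moreover have "\<forall>\<^sub>F m in sequentially. 1 / real m < \<epsilon>"
    by (rule order_tendstoD(2)[OF lim_1_over_n eps])
  moreover have "\<forall>\<^sub>F m in sequentially. m \<ge> max K 1" by (rule eventually_ge_at_top)
  ultimately have "\<forall>\<^sub>F m in sequentially. dist (?A m) ?I < e / 4 \<and>
      ?c * (real m * exp (- (sqrt (real m) * \<eta>))) < e / 4 \<and> 1 / real m < \<epsilon> \<and> m \<ge> max K 1"
    by eventually_elim blast
  then obtain m where m: "dist (?A m) ?I < e / 4" "?c * (real m * exp (- (sqrt (real m) * \<eta>))) < e / 4"
    "1 / real m < \<epsilon>" "m \<ge> max K 1"
    unfolding eventually_sequentially by blast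
  have m1: "m \<ge> 1" "K \<le> m" using m(4) by auto
  have E: "L * (1 / real m + \<epsilon> + (r - l) * exp (- real K)) \<le> e / 4"
  proof -
    have "L * (1 / real m + \<epsilon> + (r - l) * exp (- real K)) \<le> L * (3 * \<epsilon>)"
      using m(3) K L by (intro mult_left_mono) auto
    also have "\<dots> \<le> (L + 1) * (3 * \<epsilon>)" using eps by (intro mult_right_mono) auto
    also have "\<dots> = e / 4" using L by (simp add: \<epsilon>_def field_simps)
    finally show ?thesis .
  qed
  have bad: "2 * B * (real (m * K) * (2 * exp (4 * drift_const - sqrt (real m) * \<eta>))) < e / 4"
    using m(2) by (simp add: exp_diff exp_minus inverse_eq_divide mult_ac)
  have "\<forall>\<^sub>F n in sequentially. dist (\<integral>\<omega>. path_approx \<psi> m (Z m) (random_path n \<omega>) \<partial>M n) (?A m) < e / 4"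
    by (rule tendstoD[OF chain_approx_tendsto[OF Z[OF m1(1)]] e4])
  moreover have "\<forall>\<^sub>F n in sequentially. \<tau> n < 1 / real m"
    using m1 by (intro order_tendstoD(2)[OF time_step_tendsto_0]) simp
  moreover have "\<forall>\<^sub>F n in sequentially. sqrt (real m) * (pi / real n) < 1"
  proof (rule order_tendstoD(2))
    show "(\<lambda>n. sqrt (real m) * (pi / real n)) \<longlonglongrightarrow> sqrt (real m) * 0"
      by (intro tendsto_mult tendsto_const lim_const_over_n)
  qed simp
  moreover have "\<forall>\<^sub>F n in sequentially. n \<ge> (2::nat)" by (rule eventually_ge_at_top)
  ultimately show "\<forall>\<^sub>F n in sequentially. dist (\<integral>\<omega>. \<psi> (random_path n \<omega>) \<partial>M n) ?I < e"
  proof eventually_elim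
    case (elim n)
    have "\<bar>(\<integral>\<omega>. \<psi> (random_path n \<omega>) \<partial>M n) - (\<integral>\<omega>. path_approx \<psi> m (Z m) (random_path n \<omega>) \<partial>M n)\<bar>
      \<le> L * (1 / real m + \<epsilon> + (r - l) * exp (- real K))
      + 2 * B * (real (m * K) * (2 * exp (4 * drift_const - sqrt (real m) * \<eta>)))"
      by (rule chain_approx_error[OF mc[OF elim(4)] elim(4) \<psi> L B m1(1) Z[OF m1(1)] m1(2) _ \<eta>(2)])
         (use elim eps in auto)
    then show ?case using E bad elim(1) m(1) unfolding dist_real_def by linarith
  qed
qed

theorem chain_converges_in_law:
  shows "converges_in_law 2 (skorohod_topology {l..r})
    M (\<lambda>n. path_of (interpolated_chain l r b n (X n))) N (path_of Y)"
proof -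
  have eq: "path_of (interpolated_chain l r b n (X n)) \<omega> = random_path n \<omega>" for n \<omega>
    by (simp add: path_of_interpolated_chain chain_path_def)
  \<comment> \<open>The criterion for convergence in law offers a Lipschitz constant of any sign,
    while the estimates multiply by it and require L \<ge> 0.\<close>
  have lip: "path_lipschitz l r (max L 0) \<psi>" if \<psi>: "path_lipschitz l r L \<psi>" for L \<psi>
    unfolding path_lipschitz_def
  proof (intro ballI)
    fix v w assume v: "v \<in> cadlag_paths {l..r}" and w: "w \<in> cadlag_paths {l..r}"
    have "\<bar>\<psi> v - \<psi> w\<bar> \<le> L * path_dist v w" using \<psi> v w unfolding path_lipschitz_def by blast
    also have "\<dots> \<le> max L 0 * path_dist v w"
      by (intro mult_right_mono path_dist_nonneg[OF v w]) simp
    finally show "\<bar>\<psi> v - \<psi> w\<bar> \<le> max L 0 * path_dist v w" .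
  qed
  have "\<forall>m. \<exists>Z. m \<ge> 1 \<longrightarrow> is_net l r Z (1 / real m)" using net_exists by simp
  then obtain Z where Z: "\<And>m. m \<ge> 1 \<Longrightarrow> is_net l r (Z m) (1 / real m)" by metis
  show ?thesis
    unfolding eq
  proof (rule converges_in_law_skorohodI)
    show "prob_space N" by (rule diffusion_process_facts(1)[OF Y])
    show "path_of Y \<omega> \<in> cadlag_paths {l..r}" if "\<omega> \<in> space N" for \<omega>
      using diffusion_process_facts(4)[OF Y that] continuous_paths_subset_cadlag_paths by blast
    fix n :: nat assume n: "n \<ge> 2"
    show "prob_space (M n)" using mc[OF n] unfolding markov_chain_def by blast
    interpret finite_chain "M n" "{0..n}" "\<pi>0 n" "Q n" "X n"
      by standard (fact mc[OF n], simp)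
    show "random_path n \<omega> \<in> cadlag_paths {l..r}" if "\<omega> \<in> space (M n)" for \<omega>
      using X_mem[OF that] n by (intro chain_path_mem) simp_all
  next
    fix n :: nat and L B \<psi> assume "n \<ge> 2" "path_lipschitz l r L \<psi>"
    then show "(\<lambda>\<omega>. \<psi> (random_path n \<omega>)) \<in> borel_measurable (M n)"
      by (intro chain_path_functional_measurable[OF mc _ lip]) simp_all
  next
    fix L B \<psi> assume *: "path_lipschitz l r L \<psi>" "\<And>w. w \<in> cadlag_paths {l..r} \<Longrightarrow> \<bar>\<psi> w\<bar> \<le> B"
    show "(\<lambda>\<omega>. \<psi> (path_of Y \<omega>)) \<in> borel_measurable N"
      by (rule diffusion_process_approx(1)[OF Y Z lip[OF *(1)] _ *(2)]) simp_all
    show "(\<lambda>n. \<integral>\<omega>. \<psi> (random_path n \<omega>) \<partial>M n) \<longlonglongrightarrow> (\<integral>\<omega>. \<psi> (path_of Y \<omega>) \<partial>N)"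
      by (rule chain_path_lipschitz_tendsto[OF lip[OF *(1)] _ *(2)]) simp_all
  qed
qed

end

text \<open>The derivative of S is an exponential, hence positive. This supplies the nondegenerate
  state space l < r.\<close>

lemma scale_function_increasing:
  assumes "scale_function a b s S"
  shows "S 0 < S 1"
proof (rule DERIV_pos_imp_increasing_open[of 0 1 S])
  show "\<exists>y. (S has_real_derivative y) (at x) \<and> y > 0" if "0 < x" "x < 1" for x
  proof -
    have "(S has_real_derivative s x) (at x)" "s x > 0"
      using assms that unfolding scale_function_def by auto
    then show ?thesis by blast
  qed
  show "continuous_on {0..1} S" using assms by (simp add: scale_function_def)
qed simp

theorem theorem4p1:
  fixes aX bX sX S b :: "real \<Rightarrow> real"
    and P :: "real \<Rightarrow> (real \<Rightarrow> real) measure"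
    and N :: "'a measure" and Y :: "real \<Rightarrow> 'a \<Rightarrow> real"
    and M :: "nat \<Rightarrow> 'b measure" and X :: "nat \<Rightarrow> nat \<Rightarrow> 'b \<Rightarrow> nat"
    and \<pi>0 :: "nat \<Rightarrow> nat pmf"
  assumes "continuous_on {0<..<1} aX" and "continuous_on {0<..<1} bX"
    and "\<forall>x\<in>{0<..<1}. bX x > 0"
    and "scale_function aX bX sX S"
    and "\<forall>x\<in>{0<..<1}. b (S x) = bX x * (sX x)\<^sup>2"
    and "continuous_on {S 0..S 1} b"
    and "\<exists>\<delta>>0. \<forall>y\<in>{S 0..S 1}. b y \<ge> \<delta>"
    and "regular_diffusion (S 0) (S 1) P" and "feller (S 0) (S 1) P"
    and "generator (S 0) (S 1) P = reflecting_operator (S 0) (S 1) b"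
    and "diffusion_process (S 0) (S 1) P N Y"
    and "\<forall>n\<ge>2. markov_chain (M n) {0..n} (\<pi>0 n) (transition_matrix (S 0) (S 1) b n) (X n)"
    and "converges_in_law 2 (top_of_set {S 0..S 1})
           M (\<lambda>n. interpolated_chain (S 0) (S 1) b n (X n) 0) N (Y 0)"
  shows "converges_in_law 2 (skorohod_topology {S 0..S 1})
           M (\<lambda>n. path_of (interpolated_chain (S 0) (S 1) b n (X n))) N (path_of Y)"
proof -
  interpret approximating_chains "S 0" "S 1" b P N Y M \<pi>0 X
    using assms scale_function_increasing[OF assms(4)]
    by unfold_locales (auto simp: regular_diffusion_def)
  show ?thesis by (rule chain_converges_in_law)
qed

end
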